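(* Let $d\ge 1$, $S\in\tfrac12\mathbb{N}=\{\tfrac12,1,\tfrac32,\dots\}$, $u\in[0,1]$ and $\beta>0$. Let $L$ be an even integer, $\Lambda=\{-\tfrac12L,\dots,\tfrac12L\}^d\subset\mathbb{Z}^d$, and $\mathcal{E}_\Lambda$ the set of (unordered) nearest-neighbour pairs $xy$ with $x,y\in\Lambda$. Let $\mathbf{h}=(h_x)_{x\in\Lambda}$ with $h_x\in[0,\infty)$ and consider on $\mathcal{H}_\Lambda=\bigotimes_{x\in\Lambda}\mathbb{C}^{2S+1}$ the Hamiltonian \[ H_{\Lambda,\mathbf{h}}=-\sum_{xy\in\mathcal{E}_\Lambda}\bigl(uT_{xy}+(1-u)Q_{xy}-1\bigr)-\sum_{x\in\Lambda}h_xS^3_x , \] with states $\langle M\rangle_{\Lambda,\mathbf{h}}=\operatorname{Tr}(Me^{-\beta H_{\Lambda,\mathbf{h}}})/\operatorname{Tr}e^{-\beta H_{\Lambda,\mathbf{h}}}$. Assume that $h_x\ge\alpha$ for all $x\in\Lambda$, for some $\alpha>0$. Then there exist constants $C,c>0$, depending on $S,d,\alpha$ but not on $L$ or $\beta$, such that \[ 0<\langle S^1_0S^1_x\rangle_{\Lambda,\mathbf{h}}<Ce^{-c\|x\|}\qquad\text{for all }x\in\Lambda . \]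
   Context: Let $|a\rangle$, $a=-S,-S+1,\dots,S$, be the basis of $\mathbb{C}^{2S+1}$ of eigenvectors of the spin operator $S^3$, $S^3|a\rangle=a|a\rangle$; $S^1,S^2,S^3$ are the standard spin-$S$ operators (satisfying $[S^1,S^2]=iS^3$ and cyclic permutations), and $S^i_x$ denotes $S^i$ acting on the factor at site $x$. The transposition operator $T_{xy}$ acts on $\mathbb{C}^{2S+1}\otimes\mathbb{C}^{2S+1}$ (sites $x,y$) by $T_{xy}|a\rangle_x\otimes|b\rangle_y=|b\rangle_x\otimes|a\rangle_y$, and $Q_{xy}$ has matrix elements $\langle a|_x\otimes\langle b|_y\,Q_{xy}\,|c\rangle_x\otimes|d\rangle_y=\delta_{a,b}\delta_{c,d}$. For $S=\tfrac12$ this Hamiltonian equals $-2\sum_{xy}(S^1_xS^1_y+(2u-1)S^2_xS^2_y+S^3_xS^3_y-\tfrac14)-\sum_x h_xS^3_x$ (e.g. $u=1$ Heisenberg ferromagnet, $u=\tfrac12$ XY model). $\|x\|$ denotes the (Euclidean) norm of $x\in\mathbb{Z}^d$. *)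

theory Defs
  imports Complex_Main
begin

text \<open>Sites of Z^d are functions nat => int vanishing at coordinates >= d.
  The spin label a in {-S,..,S} is encoded by k in {0..n}, n = 2S, a = k - n/2.
  A basis vector of the tensor product over Lambda is a configuration
  sigma : site => nat with sigma x <= n on Lambda and sigma x = 0 off Lambda.
  Operators are given by their matrix elements in this basis.\<close>

type_synonym site = "nat \<Rightarrow> int"
type_synonym config = "site \<Rightarrow> nat"
type_synonym op = "config \<Rightarrow> config \<Rightarrow> complex"

definition box :: "nat \<Rightarrow> nat \<Rightarrow> site set" where
  "box d L = {x. (\<forall>i<d. - (int L div 2) \<le> x i \<and> x i \<le> int L div 2) \<and> (\<forall>i\<ge>d. x i = 0)}"

definition configs :: "nat \<Rightarrow> site set \<Rightarrow> config set" where
  "configs n \<Lambda> = {\<sigma>. (\<forall>x\<in>\<Lambda>. \<sigma> x \<le> n) \<and> (\<forall>x. x \<notin> \<Lambda> \<longrightarrow> \<sigma> x = 0)}"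

definition spin_val :: "nat \<Rightarrow> nat \<Rightarrow> real" where
  "spin_val n k = real k - real n / 2"

definition op_mult :: "config set \<Rightarrow> op \<Rightarrow> op \<Rightarrow> op" where
  "op_mult C A B = (\<lambda>\<sigma> \<tau>. \<Sum>\<rho>\<in>C. A \<sigma> \<rho> * B \<rho> \<tau>)"

definition op_id :: op where
  "op_id = (\<lambda>\<sigma> \<tau>. if \<sigma> = \<tau> then 1 else 0)"

fun op_pow :: "config set \<Rightarrow> op \<Rightarrow> nat \<Rightarrow> op" where
  "op_pow C A 0 = op_id"
| "op_pow C A (Suc m) = op_mult C A (op_pow C A m)"

definition op_exp :: "config set \<Rightarrow> op \<Rightarrow> op" where
  "op_exp C A = (\<lambda>\<sigma> \<tau>. \<Sum>m. op_pow C A m \<sigma> \<tau> / of_nat (fact m))"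

definition op_trace :: "config set \<Rightarrow> op \<Rightarrow> complex" where
  "op_trace C A = (\<Sum>\<sigma>\<in>C. A \<sigma> \<sigma>)"

text \<open>Single-site spin matrices (standard basis, S^3 diagonal, S^+ with
  nonnegative entries): S^3 and S^1 = (S^+ + S^-)/2.\<close>

definition spin3 :: "nat \<Rightarrow> nat \<Rightarrow> nat \<Rightarrow> complex" where
  "spin3 n k k' = (if k = k' then complex_of_real (spin_val n k) else 0)"

definition spin1 :: "nat \<Rightarrow> nat \<Rightarrow> nat \<Rightarrow> complex" where
  "spin1 n k k' = (if k' = k + 1 \<or> k = k' + 1 then
      complex_of_real (sqrt ((real n / 2) * (real n / 2 + 1) - spin_val n k * spin_val n k') / 2)
    else 0)"

definition site_op :: "site set \<Rightarrow> site \<Rightarrow> (nat \<Rightarrow> nat \<Rightarrow> complex) \<Rightarrow> op" where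
  "site_op \<Lambda> x A = (\<lambda>\<sigma> \<tau>. if (\<forall>y\<in>\<Lambda> - {x}. \<sigma> y = \<tau> y) then A (\<sigma> x) (\<tau> x) else 0)"

definition transp_op :: "site set \<Rightarrow> site \<Rightarrow> site \<Rightarrow> op" where
  "transp_op \<Lambda> x y = (\<lambda>\<sigma> \<tau>. if \<sigma> x = \<tau> y \<and> \<sigma> y = \<tau> x \<and> (\<forall>z\<in>\<Lambda> - {x, y}. \<sigma> z = \<tau> z)
      then 1 else 0)"

definition Q_op :: "site set \<Rightarrow> site \<Rightarrow> site \<Rightarrow> op" where
  "Q_op \<Lambda> x y = (\<lambda>\<sigma> \<tau>. if \<sigma> x = \<sigma> y \<and> \<tau> x = \<tau> y \<and> (\<forall>z\<in>\<Lambda> - {x, y}. \<sigma> z = \<tau> z)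
      then 1 else 0)"

text \<open>Each unordered nearest-neighbour pair {x,y} of the box is listed exactly once,
  as (x, x + e_i).\<close>
definition edges :: "nat \<Rightarrow> nat \<Rightarrow> (site \<times> site) set" where
  "edges d L = {(x, y). x \<in> box d L \<and> y \<in> box d L \<and> (\<exists>i<d. y = x(i := x i + 1))}"

definition hamiltonian :: "nat \<Rightarrow> nat \<Rightarrow> nat \<Rightarrow> real \<Rightarrow> (site \<Rightarrow> real) \<Rightarrow> op" where
  "hamiltonian n d L u h = (\<lambda>\<sigma> \<tau>.
     - (\<Sum>e\<in>edges d L. complex_of_real u * transp_op (box d L) (fst e) (snd e) \<sigma> \<tau>
          + complex_of_real (1 - u) * Q_op (box d L) (fst e) (snd e) \<sigma> \<tau> - op_id \<sigma> \<tau>)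
     - (\<Sum>x\<in>box d L. complex_of_real (h x) * site_op (box d L) x (spin3 n) \<sigma> \<tau>))"

definition gibbs_state :: "nat \<Rightarrow> nat \<Rightarrow> nat \<Rightarrow> real \<Rightarrow> (site \<Rightarrow> real) \<Rightarrow> real \<Rightarrow> op \<Rightarrow> complex" where
  "gibbs_state n d L u h \<beta> M =
     (let C = configs n (box d L);
          E = op_exp C (\<lambda>\<sigma> \<tau>. - complex_of_real \<beta> * hamiltonian n d L u h \<sigma> \<tau>)
      in op_trace C (op_mult C M E) / op_trace C E)"

definition origin :: site where "origin = (\<lambda>_. 0)"

definition site_norm :: "nat \<Rightarrow> site \<Rightarrow> real" where
  "site_norm d x = sqrt (\<Sum>i<d. (real_of_int (x i))\<^sup>2)"

definition two_point :: "nat \<Rightarrow> nat \<Rightarrow> nat \<Rightarrow> real \<Rightarrow> (site \<Rightarrow> real) \<Rightarrow> real \<Rightarrow> site \<Rightarrow> complex" where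
  "two_point n d L u h \<beta> x =
     gibbs_state n d L u h \<beta>
       (op_mult (configs n (box d L)) (site_op (box d L) origin (spin1 n)) (site_op (box d L) x (spin1 n)))"

end

theory Submission
  imports "HOL-Analysis.Uniform_Limit" "HOL-Library.FuncSet" Defs
begin

text \<open>
  Discretising time, the trace of the Gibbs weight becomes a sum over words of slots (no link, a
  transposition or a \<open>Q\<close>-link) and over colourings of the space-time points by spin values which
  are constant along the paths of the resulting loop graph; the field contributes an exponential
  weight that increases with the colours. The two insertions of \<open>S\<^sup>1\<close> cut this graph open at two
  points. Raising by one the colour of the arc with the lower colour closes the colouring again and
  gains \<open>exp (h * length)\<close>, where by parity the arc runs from the origin to \<open>x\<close>. If the arc is long,
  this gain already gives the decay. If it is short, the word contains a chain of links from the
  origin to \<open>x\<close> that can be run through in a short time; each link can be removed at the cost of a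
  constant times the time step, because recolouring loops with the larger of two colours shows that
  a link changes the loop weight by a bounded factor only, so a first-passage estimate shows that
  such chains are exponentially unlikely. All bounds are uniform in the time step.
\<close>

section \<open>Operator powers and exponentials\<close>

text \<open>The obstacle is uniformity in \<beta>: over a long time an edge carries many links, so
  counting links alone gives no decay. A chain from the origin to \<open>x\<close> is therefore also
  charged for the time between its links. Summing the position of one link over the time circle with
  weight \<open>exp (- \<mu> * time)\<close> gives about 1/(\<mu> \<delta>), and the link itself
  costs a constant times \<delta>; the product is a constant divided by \<mu>, small for large \<mu>
  whatever \<delta>, \<beta> and L are. The price is that only arcs of duration up to ||x||/(2
  \<mu>) can be treated in this way; the field, at least \<alpha>, takes care of the longer ones.
  Links are not independent under the loop measure, which is why their removal is an inequality
  between weights. Strict positivity does not come from this expansion: the off-diagonal entries of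
  -H and all entries of S^1 are nonnegative, and a path of positive entries makes the required entry
  of the exponential positive, as in Perron-Frobenius theory.\<close>

lemma op_mult_id_right:
  assumes "finite C" "\<tau> \<in> C"
  shows "op_mult C A op_id \<sigma> \<tau> = A \<sigma> \<tau>"
  using assms unfolding op_mult_def op_id_def by (simp add: sum.delta if_distrib cong: if_cong)

lemma op_mult_id_left:
  assumes "finite C" "\<sigma> \<in> C"
  shows "op_mult C op_id A \<sigma> \<tau> = A \<sigma> \<tau>"
proof -
  have "op_mult C op_id A \<sigma> \<tau> = (\<Sum>\<rho>\<in>C. if \<rho> = \<sigma> then A \<rho> \<tau> else 0)"
    unfolding op_mult_def op_id_def by (rule sum.cong) auto
  with assms show ?thesis by (simp add: sum.delta)
qed

lemma op_mult_assoc: "op_mult C (op_mult C A B) D = op_mult C A (op_mult C B D)"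
proof (intro ext)
  fix \<sigma> \<tau>
  have "op_mult C (op_mult C A B) D \<sigma> \<tau> = (\<Sum>\<rho>\<in>C. \<Sum>\<pi>\<in>C. A \<sigma> \<pi> * B \<pi> \<rho> * D \<rho> \<tau>)"
    unfolding op_mult_def by (simp add: sum_distrib_right)
  also have "\<dots> = (\<Sum>\<pi>\<in>C. \<Sum>\<rho>\<in>C. A \<sigma> \<pi> * B \<pi> \<rho> * D \<rho> \<tau>)"
    by (rule sum.swap)
  also have "\<dots> = op_mult C A (op_mult C B D) \<sigma> \<tau>"
    unfolding op_mult_def by (simp add: sum_distrib_left mult.assoc)
  finally show "op_mult C (op_mult C A B) D \<sigma> \<tau> = op_mult C A (op_mult C B D) \<sigma> \<tau>" .
qed

text \<open>\<open>op_pow\<close> multiplies from the left, while the path expansion appends the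
  last time step on the right. Both indices must lie in \<open>C\<close>, since \<open>op_id\<close>
  acts as an identity only on entries within the range of summation.\<close>

lemma op_pow_Suc_right:
  assumes "finite C" "\<sigma> \<in> C" "\<tau> \<in> C"
  shows "op_pow C A (Suc m) \<sigma> \<tau> = op_mult C (op_pow C A m) A \<sigma> \<tau>"
  using assms(2,3)
proof (induction m arbitrary: \<sigma>)
  case 0
  then show ?case by (simp add: op_mult_id_right op_mult_id_left assms(1))
next
  case (Suc m)
  have "op_pow C A (Suc (Suc m)) \<sigma> \<tau> = (\<Sum>\<rho>\<in>C. A \<sigma> \<rho> * op_pow C A (Suc m) \<rho> \<tau>)"
    by (simp only: op_pow.simps(2)[of C A "Suc m"] op_mult_def)
  also have "\<dots> = op_mult C A (op_mult C (op_pow C A m) A) \<sigma> \<tau>"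
    unfolding op_mult_def[of C A "op_mult C (op_pow C A m) A"] 
    using Suc.IH Suc.prems by (intro sum.cong) auto
  finally show ?case by (simp add: op_mult_assoc)
qed

lemma op_pow_scale: "op_pow C (\<lambda>\<sigma> \<tau>. X \<sigma> \<tau> / c) k \<sigma> \<tau> = op_pow C X k \<sigma> \<tau> / c ^ k"
  by (induction k arbitrary: \<sigma>) (simp_all add: op_mult_def sum_divide_distrib mult_ac)

text \<open>Pascal's rule in the shape of the induction step of the binomial theorem;
  \<open>x k\<close> stands for an entry of the k-th power.\<close>

lemma pascal_sum:
  fixes c :: "'a::comm_ring_1" and x :: "nat \<Rightarrow> 'a"
  shows "c * (\<Sum>k\<le>m. of_nat (m choose k) * c ^ (m - k) * x k)
       + (\<Sum>k\<le>m. of_nat (m choose k) * c ^ (m - k) * x (Suc k))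
       = (\<Sum>k\<le>Suc m. of_nat (Suc m choose k) * c ^ (Suc m - k) * x k)"
proof -
  have "c * (\<Sum>k\<le>m. of_nat (m choose k) * c ^ (m - k) * x k)
      = (\<Sum>k\<le>m. of_nat (m choose k) * c ^ (Suc m - k) * x k)"
    by (simp add: sum_distrib_left Suc_diff_le algebra_simps)
  also have "\<dots> = (\<Sum>k\<le>Suc m. of_nat (m choose k) * c ^ (Suc m - k) * x k)"
    by (simp add: binomial_eq_0)
  also have "\<dots> = c ^ Suc m * x 0 + (\<Sum>k\<le>m. of_nat (m choose Suc k) * c ^ (m - k) * x (Suc k))"
    by (subst sum.atMost_Suc_shift) simp
  finally show ?thesis
    by (subst sum.atMost_Suc_shift) (simp add: sum.distrib algebra_simps)
qed

text \<open>A multiple of the identity commutes with \<open>X\<close>. The case \<open>c = 1\<close>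
  serves Euler's limit, general \<open>c\<close> the shift of the exponential.\<close>

lemma op_pow_binomial:
  assumes "finite C" "\<sigma> \<in> C"
  shows "op_pow C (\<lambda>\<sigma> \<tau>. c * op_id \<sigma> \<tau> + X \<sigma> \<tau>) m \<sigma> \<tau>
       = (\<Sum>k\<le>m. of_nat (m choose k) * c ^ (m - k) * op_pow C X k \<sigma> \<tau>)"
  using assms(2)
proof (induction m arbitrary: \<sigma>)
  case 0
  then show ?case by simp
next
  case (Suc m)
  let ?Y = "\<lambda>\<sigma> \<tau>. c * op_id \<sigma> \<tau> + X \<sigma> \<tau>"
  have "op_pow C ?Y (Suc m) \<sigma> \<tau>
      = c * op_mult C op_id (op_pow C ?Y m) \<sigma> \<tau> + (\<Sum>\<rho>\<in>C. X \<sigma> \<rho> * op_pow C ?Y m \<rho> \<tau>)"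
    by (simp add: op_mult_def sum.distrib distrib_right sum_distrib_left mult.assoc)
  also have "op_mult C op_id (op_pow C ?Y m) \<sigma> \<tau> = op_pow C ?Y m \<sigma> \<tau>"
    using assms(1) Suc.prems by (rule op_mult_id_left)
  also have "(\<Sum>\<rho>\<in>C. X \<sigma> \<rho> * op_pow C ?Y m \<rho> \<tau>)
      = (\<Sum>\<rho>\<in>C. \<Sum>k\<le>m. X \<sigma> \<rho> * (of_nat (m choose k) * c ^ (m - k) * op_pow C X k \<rho> \<tau>))"
    using Suc.IH by (intro sum.cong refl) (simp add: sum_distrib_left)
  also have "\<dots> = (\<Sum>k\<le>m. of_nat (m choose k) * c ^ (m - k) * op_pow C X (Suc k) \<sigma> \<tau>)"
    by (subst sum.swap) (simp add: op_mult_def sum_distrib_left algebra_simps)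
  finally show ?case
    by (simp only: Suc.IH[OF Suc.prems] pascal_sum[of c m "\<lambda>k. op_pow C X k \<sigma> \<tau>"])
qed

section \<open>Euler's limit for the matrix exponential\<close>

lemma norm_op_pow_le:
  assumes "finite C" "\<And>\<sigma> \<tau>. \<sigma> \<in> C \<Longrightarrow> \<tau> \<in> C \<Longrightarrow> norm (X \<sigma> \<tau>) \<le> B" "\<sigma> \<in> C" "\<tau> \<in> C"
  shows "norm (op_pow C X k \<sigma> \<tau>) \<le> (of_nat (card C) * B) ^ k"
  using assms(3)
proof (induction k arbitrary: \<sigma>)
  case 0
  then show ?case by (simp add: op_id_def)
next
  case (Suc k)
  have "0 \<le> B"
    using assms(2)[OF Suc.prems Suc.prems] norm_ge_zero order_trans by blast
  have "norm (op_pow C X (Suc k) \<sigma> \<tau>) \<le> (\<Sum>\<rho>\<in>C. norm (X \<sigma> \<rho> * op_pow C X k \<rho> \<tau>))"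
    by (simp add: op_mult_def norm_sum)
  also have "\<dots> \<le> (\<Sum>\<rho>\<in>C. B * (of_nat (card C) * B) ^ k)"
    using Suc assms(2) \<open>0 \<le> B\<close> by (intro sum_mono) (auto simp: norm_mult intro!: mult_mono)
  finally show ?case by (simp add: algebra_simps)
qed

text \<open>The quotient is 1/k! times a product of \<open>k\<close> factors 1 - i/N, each of which
  tends to 1.\<close>

lemma binomial_over_power_tendsto:
  "(\<lambda>N. of_nat (N choose k) / of_nat N ^ k :: complex) \<longlonglongrightarrow> 1 / fact k"
proof -
  have "(\<lambda>N. (\<Prod>i<k. 1 - complex_of_nat i / of_nat N) / fact k) \<longlonglongrightarrow> (\<Prod>i<k. 1 - 0) / fact k"
    by (intro tendsto_intros lim_const_over_n) auto
  moreover have "\<forall>\<^sub>F N in sequentially. (\<Prod>i<k. 1 - complex_of_nat i / of_nat N) / fact k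
      = of_nat (N choose k) / of_nat N ^ k"
  proof (rule eventually_mono[OF eventually_gt_at_top[of 0]])
    fix N :: nat assume "0 < N"
    have "of_nat (N choose k) / of_nat N ^ k
        = (\<Prod>i<k. complex_of_nat N - of_nat i) / fact k / (\<Prod>i<k. of_nat N)"
      by (simp add: binomial_gbinomial gbinomial_prod_rev atLeast0LessThan)
    also have "\<dots> = (\<Prod>i<k. (complex_of_nat N - of_nat i) / of_nat N) / fact k"
      by (subst prod_dividef) simp
    also have "\<dots> = (\<Prod>i<k. 1 - complex_of_nat i / of_nat N) / fact k"
      using \<open>0 < N\<close> by (simp add: diff_divide_distrib)
    finally show "(\<Prod>i<k. 1 - complex_of_nat i / of_nat N) / fact k
      = of_nat (N choose k) / of_nat N ^ k" by simp
  qed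
  ultimately show ?thesis by (simp add: filterlim_cong)
qed

lemma op_pow_tendsto:
  assumes "\<And>\<sigma> \<tau>. \<sigma> \<in> C \<Longrightarrow> \<tau> \<in> C \<Longrightarrow> (\<lambda>N. X N \<sigma> \<tau>) \<longlonglongrightarrow> Y \<sigma> \<tau>" "\<sigma> \<in> C" "\<tau> \<in> C"
  shows "(\<lambda>N. op_pow C (X N) k \<sigma> \<tau>) \<longlonglongrightarrow> op_pow C Y k \<sigma> \<tau>"
  using assms(2) by (induction k arbitrary: \<sigma>) (auto simp: op_mult_def intro!: tendsto_intros assms)

lemma summable_op_exp:
  assumes "finite C" "\<sigma> \<in> C" "\<tau> \<in> C"
  shows "summable (\<lambda>m. norm (op_pow C X m \<sigma> \<tau> / of_nat (fact m)))"
proof -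
  define B where "B = (\<Sum>\<sigma>\<in>C. \<Sum>\<tau>\<in>C. norm (X \<sigma> \<tau>))"
  have B: "norm (X \<sigma> \<tau>) \<le> B" if "\<sigma> \<in> C" "\<tau> \<in> C" for \<sigma> \<tau>
  proof -
    have "norm (X \<sigma> \<tau>) \<le> (\<Sum>\<tau>\<in>C. norm (X \<sigma> \<tau>))"
      using that assms(1) by (intro member_le_sum) auto
    also have "\<dots> \<le> B" unfolding B_def
      using that assms(1) by (intro member_le_sum[of \<sigma>]) (auto intro: sum_nonneg)
    finally show ?thesis .
  qed
  have "summable (\<lambda>m. (of_nat (card C) * B) ^ m / fact m :: real)"
    using summable_exp[of "of_nat (card C) * B"] by (simp add: divide_inverse mult.commute)
  then show ?thesis
    by (rule summable_comparison_test[rotated])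
      (auto simp: norm_divide intro!: exI[of _ 0] divide_right_mono norm_op_pow_le[OF assms(1)] B assms)
qed

text \<open>Binomial expansion and dominated convergence for series (Tannery), with the exponential
  series of \<open>card C * B\<close> as majorant. \<open>X\<close> may depend on \<open>N\<close>,
  as it does for the discretised Gibbs weight.\<close>

lemma op_exp_tendsto:
  assumes fin: "finite C"
    and lim: "\<And>\<sigma> \<tau>. \<sigma> \<in> C \<Longrightarrow> \<tau> \<in> C \<Longrightarrow> (\<lambda>N. X N \<sigma> \<tau>) \<longlonglongrightarrow> Y \<sigma> \<tau>"
    and \<sigma>: "\<sigma> \<in> C" and \<tau>: "\<tau> \<in> C"
  shows "(\<lambda>N. op_pow C (\<lambda>\<sigma> \<tau>. op_id \<sigma> \<tau> + X N \<sigma> \<tau> / of_nat N) N \<sigma> \<tau>) \<longlonglongrightarrow> op_exp C Y \<sigma> \<tau>"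
proof -
  define a where "a k N = of_nat (N choose k) / of_nat N ^ k * op_pow C (X N) k \<sigma> \<tau>" for k N
  \<comment> \<open>The summand 1 makes \<open>B\<close> strictly larger than every entry of the
    limit \<open>Y\<close>, so that it eventually bounds the entries of \<open>X N\<close> as
    well.\<close>
  define B where "B = (\<Sum>\<sigma>\<in>C. \<Sum>\<tau>\<in>C. norm (Y \<sigma> \<tau>) + 1)"
  have B: "norm (Y \<sigma> \<tau>) < B" if "\<sigma> \<in> C" "\<tau> \<in> C" for \<sigma> \<tau>
  proof -
    have "norm (Y \<sigma> \<tau>) + 1 \<le> (\<Sum>\<tau>\<in>C. norm (Y \<sigma> \<tau>) + 1)"
      using that fin by (intro member_le_sum[of \<tau>]) auto
    also have "\<dots> \<le> B" unfolding B_def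
      using that fin by (intro member_le_sum[of \<sigma>]) (auto intro!: sum_nonneg add_nonneg_nonneg)
    finally show ?thesis by simp
  qed
  let ?M = "\<lambda>k. (of_nat (card C) * B) ^ k / fact k :: real"
  have lima: "(\<lambda>N. a k N) \<longlonglongrightarrow> op_pow C Y k \<sigma> \<tau> / of_nat (fact k)" for k
    using tendsto_mult[OF binomial_over_power_tendsto[of k] op_pow_tendsto[where k = k and X = X, OF lim \<sigma> \<tau>]]
    by (simp add: a_def)
  have evB: "\<forall>\<^sub>F N in sequentially. \<forall>\<sigma>\<in>C. \<forall>\<tau>\<in>C. norm (X N \<sigma> \<tau>) < B"
    using order_tendstoD(2)[OF tendsto_norm[OF lim] B]
    by (intro eventually_ball_finite ballI fin) auto
  have bnd: "norm (a k N) \<le> ?M k"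
    if N: "\<forall>\<sigma>\<in>C. \<forall>\<tau>\<in>C. norm (X N \<sigma> \<tau>) < B" and "0 < N" for k N
  proof -
    have "real (N choose k) * fact k \<le> real N ^ k"
      using binomial_fact_pow[of N k] by (metis of_nat_fact of_nat_le_iff of_nat_mult of_nat_power)
    then have "real (N choose k) / real N ^ k \<le> 1 / fact k"
      using \<open>0 < N\<close> by (simp add: field_simps)
    moreover have "norm (op_pow C (X N) k \<sigma> \<tau>) \<le> (of_nat (card C) * B) ^ k"
      using N by (intro norm_op_pow_le fin \<sigma> \<tau>) (auto intro: less_imp_le)
    ultimately have "real (N choose k) / real N ^ k * norm (op_pow C (X N) k \<sigma> \<tau>)
        \<le> 1 / fact k * (of_nat (card C) * B) ^ k"
      by (intro mult_mono) auto
    then show ?thesis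
      by (simp add: a_def norm_mult norm_divide norm_power)
  qed
  have ev: "\<forall>\<^sub>F N in sequentially. \<forall>k. norm (a k N) \<le> ?M k"
    using evB eventually_gt_at_top[of 0] by eventually_elim (use bnd in blast)
  have sM: "summable ?M"
    using summable_exp[of "of_nat (card C) * B"] by (simp add: divide_inverse mult.commute)
  have "\<forall>\<^sub>F (k, N) in at_top \<times>\<^sub>F sequentially. norm (a k N) \<le> ?M k"
    using eventually_prodI[OF always_eventually[of "\<lambda>_. True"] ev]
    by (rule eventually_mono) auto
  from tannerys_theorem[of a, OF lima this sM]
  have "(\<lambda>N. suminf (\<lambda>k. a k N)) \<longlonglongrightarrow> (\<Sum>k. op_pow C Y k \<sigma> \<tau> / of_nat (fact k))"
    by simp
  moreover have "suminf (\<lambda>k. a k N) = op_pow C (\<lambda>\<sigma> \<tau>. op_id \<sigma> \<tau> + X N \<sigma> \<tau> / of_nat N) N \<sigma> \<tau>" for N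
  proof -
    have "suminf (\<lambda>k. a k N) = (\<Sum>k\<le>N. a k N)"
      by (rule suminf_finite) (auto simp: a_def)
    also have "\<dots> = op_pow C (\<lambda>\<sigma> \<tau>. 1 * op_id \<sigma> \<tau> + X N \<sigma> \<tau> / of_nat N) N \<sigma> \<tau>"
      by (subst op_pow_binomial[OF fin \<sigma>]) (simp add: a_def op_pow_scale)
    finally show ?thesis by simp
  qed
  ultimately show ?thesis by (simp add: op_exp_def)
qed

text \<open>The positivity argument uses this to make the diagonal of -\<beta>H nonnegative at the
  cost of a positive factor.\<close>

lemma op_exp_shift:
  assumes fin: "finite C" and \<sigma>: "\<sigma> \<in> C" and \<tau>: "\<tau> \<in> C"
  shows "op_exp C (\<lambda>\<sigma> \<tau>. c * op_id \<sigma> \<tau> + X \<sigma> \<tau>) \<sigma> \<tau> = exp c * op_exp C X \<sigma> \<tau>"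
proof -
  let ?e = "\<lambda>k. c ^ k / of_nat (fact k)" and ?x = "\<lambda>k. op_pow C X k \<sigma> \<tau> / of_nat (fact k)"
  have "summable (\<lambda>k. norm (?e k))"
    using summable_exp[of "norm c"] by (simp add: divide_inverse mult.commute norm_mult norm_power norm_inverse)
  from Cauchy_product[OF this summable_op_exp[OF assms, of X]]
  have "suminf ?e * op_exp C X \<sigma> \<tau> = (\<Sum>k. \<Sum>i\<le>k. ?e i * ?x (k - i))"
    by (simp add: op_exp_def)
  also have "(\<lambda>k. \<Sum>i\<le>k. ?e i * ?x (k - i))
      = (\<lambda>k. op_pow C (\<lambda>\<sigma> \<tau>. c * op_id \<sigma> \<tau> + X \<sigma> \<tau>) k \<sigma> \<tau> / of_nat (fact k))"
  proof
    fix k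
    have "(\<Sum>i\<le>k. ?e i * ?x (k - i)) = (\<Sum>i\<le>k. ?e (k - i) * ?x i)"
      by (rule sum.reindex_bij_witness[of _ "\<lambda>i. k - i" "\<lambda>i. k - i"]) auto
    also have "\<dots> = (\<Sum>i\<le>k. of_nat (k choose i) * c ^ (k - i) * op_pow C X i \<sigma> \<tau> / of_nat (fact k))"
      by (intro sum.cong refl) (simp add: binomial_fact field_simps)
    finally show "(\<Sum>i\<le>k. ?e i * ?x (k - i))
        = op_pow C (\<lambda>\<sigma> \<tau>. c * op_id \<sigma> \<tau> + X \<sigma> \<tau>) k \<sigma> \<tau> / of_nat (fact k)"
      by (simp add: op_pow_binomial[OF fin \<sigma>] sum_divide_distrib)
  qed
  also have "suminf ?e = exp c"
    by (simp add: exp_def scaleR_conv_of_real divide_inverse mult.commute)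
  finally show ?thesis by (simp add: op_exp_def)
qed

section \<open>Weighted colourings of a graph\<close>

text \<open>The value 0 off \<open>V\<close> makes a colouring determined by its values on
  \<open>V\<close>, so that there are finitely many; \<open>configs\<close> has the same
  convention.\<close>

definition colorings :: "nat \<Rightarrow> 'v set \<Rightarrow> ('v \<Rightarrow> nat) set" where
  "colorings n V = {s. (\<forall>v\<in>V. s v \<le> n) \<and> (\<forall>v. v \<notin> V \<longrightarrow> s v = 0)}"

definition cols :: "nat \<Rightarrow> 'v set \<Rightarrow> ('v \<times> 'v) set \<Rightarrow> ('v \<Rightarrow> nat) set" where
  "cols n V G = {s \<in> colorings n V. \<forall>(p, q)\<in>G. s p = s q}"

definition component :: "('v \<times> 'v) set \<Rightarrow> 'v \<Rightarrow> 'v set" where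
  "component G p = {q. (p, q) \<in> (G \<union> G\<inverse>)\<^sup>*}"

definition field_weight :: "nat \<Rightarrow> 'v set \<Rightarrow> ('v \<Rightarrow> real) \<Rightarrow> ('v \<Rightarrow> nat) \<Rightarrow> real" where
  "field_weight n V g s = exp (\<Sum>v\<in>V. g v * spin_val n (s v))"

text \<open>The partition function of the coloured graph. For the closed graph of a word it is what
  remains of the trace once all links are fixed.\<close>

definition wsum :: "nat \<Rightarrow> 'v set \<Rightarrow> ('v \<Rightarrow> real) \<Rightarrow> ('v \<times> 'v) set \<Rightarrow> real" where
  "wsum n V g G = (\<Sum>s\<in>cols n V G. field_weight n V g s)"

lemma configs_eq_colorings: "configs n \<Lambda> = colorings n \<Lambda>"
  by (simp add: configs_def colorings_def)

lemma finite_colorings: "finite V \<Longrightarrow> finite (colorings n V)"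
proof -
  assume "finite V"
  then have "finite {s. \<forall>v. (v \<in> V \<longrightarrow> s v \<in> {..n}) \<and> (v \<notin> V \<longrightarrow> s v = 0)}"
    by (intro finite_set_of_finite_funs) auto
  then show ?thesis
    by (rule rev_finite_subset) (auto simp: colorings_def)
qed

lemma finite_cols: "finite V \<Longrightarrow> finite (cols n V G)"
  unfolding cols_def by (simp add: finite_colorings)

lemma component_refl: "p \<in> component G p"
  by (simp add: component_def)

lemma component_closed:
  assumes "(a, b) \<in> G"
  shows "a \<in> component G p \<longleftrightarrow> b \<in> component G p"
  using assms unfolding component_def
  by (auto intro: rtrancl_into_rtrancl)

lemma component_subset:
  assumes "p \<in> B" "\<And>a b. a \<in> B \<Longrightarrow> (a, b) \<in> G \<or> (b, a) \<in> G \<Longrightarrow> b \<in> B"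
  shows "component G p \<subseteq> B"
proof
  fix q assume "q \<in> component G p"
  then have "(p, q) \<in> (G \<union> G\<inverse>)\<^sup>*" by (simp add: component_def)
  then show "q \<in> B"
    by (induction rule: rtrancl_induct) (use assms in auto)
qed

lemma component_subset_vertices: "G \<subseteq> V \<times> V \<Longrightarrow> p \<in> V \<Longrightarrow> component G p \<subseteq> V"
  by (rule component_subset) auto

lemma cols_component:
  assumes "s \<in> cols n V G" "q \<in> component G p"
  shows "s q = s p"
proof -
  have "component G p \<subseteq> {q. s q = s p}"
    by (rule component_subset) (use assms(1) in \<open>auto simp: cols_def\<close>)
  then show ?thesis using assms(2) by auto
qed

lemma field_weight_pos: "0 < field_weight n V g s"
  by (simp add: field_weight_def)

lemma wsum_nonneg: "0 \<le> wsum n V g G"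
  unfolding wsum_def by (intro sum_nonneg less_imp_le field_weight_pos)

lemma wsum_antimono: "finite V \<Longrightarrow> H \<subseteq> G \<Longrightarrow> wsum n V g G \<le> wsum n V g H"
  unfolding wsum_def
  by (intro sum_mono2 finite_cols) (auto simp: cols_def less_imp_le[OF field_weight_pos])

text \<open>Recolouring both components with the larger of the two colours does not decrease the
  weight, and the old colouring is recovered from the new one and the two old colours.\<close>

lemma wsum_insert:
  assumes fin: "finite V" and G: "G \<subseteq> V \<times> V" and pq: "p \<in> V" "q \<in> V"
    and g: "\<And>v. v \<in> V \<Longrightarrow> 0 \<le> g v"
  shows "wsum n V g G \<le> real ((n + 1)\<^sup>2) * wsum n V g (insert (p, q) G)"
proof -
  let ?P = "component G p" and ?Q = "component G q"
  let ?T = "cols n V (insert (p, q) G) \<times> ({..n} \<times> {..n})"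
  have "wsum n V g G \<le> (\<Sum>(s, a, b)\<in>?T. field_weight n V g s)"
    unfolding wsum_def
  proof (rule sum_le_included[where i = "\<lambda>(s, a, b) v. if v \<in> ?P then a else if v \<in> ?Q then b else s v"])
    show "\<forall>s\<in>cols n V G. \<exists>y\<in>?T. (case y of (s, a, b) \<Rightarrow> \<lambda>v. if v \<in> ?P then a else if v \<in> ?Q then b else s v) = s
        \<and> field_weight n V g s \<le> (case y of (s, a, b) \<Rightarrow> field_weight n V g s)"
    proof
      fix s assume s: "s \<in> cols n V G"
      define s' where "s' v = (if v \<in> ?P \<union> ?Q then max (s p) (s q) else s v)" for v
      have le: "s p \<le> n" "s q \<le> n"
        using s pq by (auto simp: cols_def colorings_def)
      have sP: "s v = s p" if "v \<in> ?P" for v using cols_component[OF s that] .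
      have sQ: "s v = s q" if "v \<in> ?Q" for v using cols_component[OF s that] .
      have sub: "?P \<subseteq> V" "?Q \<subseteq> V"
        using component_subset_vertices[OF G] pq by auto
      have "s' \<in> cols n V (insert (p, q) G)"
        using s le sub component_closed[of _ _ G p] component_closed[of _ _ G q]
        by (fastforce simp: cols_def colorings_def s'_def component_refl)
      \<comment> \<open>If the two components coincide, the two old colours agree as well, so
        reading \<open>?P\<close> first loses nothing.\<close>
      moreover have "(\<lambda>v. if v \<in> ?P then s p else if v \<in> ?Q then s q else s' v) = s"
        by (auto simp: s'_def sP sQ)
      moreover have "field_weight n V g s \<le> field_weight n V g s'"
        unfolding field_weight_def
        by (auto intro!: sum_mono mult_left_mono g simp: spin_val_def s'_def sP sQ)
      ultimately show "\<exists>y\<in>?T. (case y of (s, a, b) \<Rightarrow> \<lambda>v. if v \<in> ?P then a else if v \<in> ?Q then b else s v) = s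
        \<and> field_weight n V g s \<le> (case y of (s, a, b) \<Rightarrow> field_weight n V g s)"
        using le by (intro bexI[of _ "(s', s p, s q)"]) auto
    qed
  qed (use fin in \<open>auto simp: finite_cols intro: less_imp_le[OF field_weight_pos]\<close>)
  also have "\<dots> = (\<Sum>s\<in>cols n V (insert (p, q) G). \<Sum>y\<in>{..n} \<times> {..n}. field_weight n V g s)"
    by (subst sum.cartesian_product) (simp add: case_prod_unfold)
  also have "\<dots> = real ((n + 1)\<^sup>2) * wsum n V g (insert (p, q) G)"
    by (simp add: wsum_def sum_distrib_left power2_eq_square)
  finally show ?thesis .
qed

section \<open>The discrete loop model\<close>

lemma sum_remove2:
  assumes "finite A" "x \<in> A" "y \<in> A" "x \<noteq> y"
  shows "sum f A = f x + (f y + sum f (A - {x} - {y}))"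
  using assms sum.remove[of A x f] sum.remove[of "A - {x}" y f] by simp

text \<open>\<open>None\<close> is a time step without link; in \<open>Some (e, b)\<close> the flag
  \<open>b\<close> is true for a transposition and false for a \<open>Q\<close>-link. One link per
  step suffices, as several links are of second order in the time step.\<close>

type_synonym slot = "((site \<times> site) \<times> bool) option"

text \<open>In the application \<delta> = \<beta>/N. By \<open>delta_small\<close> an empty slot has
  weight at least 1/2, so that replacing a link by an empty slot gains a factor of order 1/\<delta>.
  As no assumption mentions \<open>n\<close>, the predicate \<open>loop_model\<close> does not take
  it, while \<open>expansion\<close> and \<open>partition_fun\<close> do.\<close>

locale loop_model =
  fixes \<Lambda> :: "site set" and E :: "(site \<times> site) set" and n N :: nat
    and \<delta> u \<alpha> :: real and h :: "site \<Rightarrow> real"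
  assumes finite_sites: "finite \<Lambda>"
    and edges_sites: "E \<subseteq> \<Lambda> \<times> \<Lambda>"
    and edges_irrefl: "(x, y) \<in> E \<Longrightarrow> x \<noteq> y"
    and u: "0 \<le> u" "u \<le> 1"
    and delta_pos: "0 < \<delta>"
    and delta_small: "\<delta> * card E \<le> 1 / 2"
    and N_pos: "0 < N"
    and alpha_pos: "0 < \<alpha>"
    and field_ge: "x \<in> \<Lambda> \<Longrightarrow> \<alpha> \<le> h x"
begin

definition slots :: "slot set" where
  "slots = insert None (Some ` (E \<times> UNIV))"

text \<open>The first-order form of a Poisson process of rate one on every edge with a random type:
  the weights of all slots add up to one, because the -1 in the Hamiltonian turns the empty slot
  into 1 - \<delta>|E|.\<close>

fun slot_weight :: "slot \<Rightarrow> real" where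
  "slot_weight None = 1 - \<delta> * card E"
| "slot_weight (Some (e, b)) = \<delta> * (if b then u else 1 - u)"

text \<open>At a transposition the vertical lines cross; at a \<open>Q\<close>-link they turn back,
  so its edges are horizontal, one in each of the two layers.\<close>

fun slot_graph :: "slot \<Rightarrow> nat \<Rightarrow> ((nat \<times> site) \<times> (nat \<times> site)) set" where
  "slot_graph None t = {((t, z), (Suc t, z)) | z. z \<in> \<Lambda>}"
| "slot_graph (Some ((x, y), b)) t = {((t, z), (Suc t, z)) | z. z \<in> \<Lambda> - {x, y}} \<union>
     (if b then {((t, x), (Suc t, y)), ((t, y), (Suc t, x))}
      else {((t, x), (t, y)), ((Suc t, x), (Suc t, y))})"

definition points :: "(nat \<times> site) set" where
  "points = {..N} \<times> \<Lambda>"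

definition word_graph :: "(nat \<Rightarrow> slot) \<Rightarrow> ((nat \<times> site) \<times> (nat \<times> site)) set" where
  "word_graph \<omega> = (\<Union>t<N. slot_graph (\<omega> t) t)"

text \<open>The trace identifies the layers 0 and \<open>N\<close>; at the sites of
  \<open>I\<close>, where spin operators are inserted, the identification is left open.\<close>

definition closing :: "site set \<Rightarrow> ((nat \<times> site) \<times> (nat \<times> site)) set" where
  "closing I = {((0, z), (N, z)) | z. z \<in> \<Lambda> - I}"

definition words :: "(nat \<Rightarrow> slot) set" where
  "words = PiE {..<N} (\<lambda>_. slots)"

definition word_weight :: "(nat \<Rightarrow> slot) \<Rightarrow> real" where
  "word_weight \<omega> = (\<Prod>t<N. slot_weight (\<omega> t))"

text \<open>Each time step gives half of its field to each of its two layers, so a point of the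
  first or last layer carries half as much as an inner one; hence the uniform lower bound
  \<open>\<alpha> * \<delta> / 2\<close>.\<close>

definition field :: "nat \<times> site \<Rightarrow> real" where
  "field v = \<delta> * h (snd v) / 2 * (of_bool (fst v < N) + of_bool (0 < fst v))"

definition loop_weight :: "(nat \<Rightarrow> slot) \<Rightarrow> real" where
  "loop_weight \<omega> = wsum n points field (word_graph \<omega> \<union> closing {})"

definition partition_fun :: real where
  "partition_fun = (\<Sum>\<omega>\<in>words. word_weight \<omega> * loop_weight \<omega>)"

lemma finite_edges: "finite E"
  using finite_subset[OF edges_sites] finite_sites by auto

lemma finite_slots: "finite slots"
  by (simp add: slots_def finite_edges)

lemma finite_points: "finite points"
  by (simp add: points_def finite_sites)

lemma finite_words: "finite words"
  unfolding words_def by (intro finite_PiE) (auto simp: finite_slots)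

lemma word_slot: "\<omega> \<in> words \<Longrightarrow> t < N \<Longrightarrow> \<omega> t \<in> slots"
  by (auto simp: words_def)

lemma slot_weight_None: "1 / 2 \<le> slot_weight None"
  using delta_small delta_pos by auto

lemma slot_weight_nonneg: "0 \<le> slot_weight sl"
proof (cases sl)
  case None
  then show ?thesis using slot_weight_None by simp
next
  case (Some a)
  then show ?thesis using delta_pos u by (cases a) auto
qed

lemma slot_weight_Some: "slot_weight (Some a) \<le> \<delta>"
  using delta_pos u by (cases a) (auto simp: mult_le_cancel_left2)

lemma word_weight_nonneg: "0 \<le> word_weight \<omega>"
  unfolding word_weight_def by (intro prod_nonneg) (simp add: slot_weight_nonneg)

lemma loop_weight_nonneg: "0 \<le> loop_weight \<omega>"
  unfolding loop_weight_def by (rule wsum_nonneg)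

lemma partition_fun_nonneg: "0 \<le> partition_fun"
  unfolding partition_fun_def
  by (intro sum_nonneg mult_nonneg_nonneg word_weight_nonneg loop_weight_nonneg)

lemma field_lower: "v \<in> points \<Longrightarrow> \<alpha> * \<delta> / 2 \<le> field v"
proof -
  assume v: "v \<in> points"
  have "\<alpha> * \<delta> / 2 * 1 \<le> \<delta> * h (snd v) / 2 * (of_bool (fst v < N) + of_bool (0 < fst v))"
    using v delta_pos alpha_pos field_ge[of "snd v"] N_pos
    by (intro mult_mono) (auto simp: points_def of_bool_def)
  then show ?thesis by (simp add: field_def)
qed

lemma field_nonneg: "v \<in> points \<Longrightarrow> 0 \<le> field v"
  using field_lower[of v] alpha_pos delta_pos by (smt (verit) divide_nonneg_nonneg mult_nonneg_nonneg)

lemma slot_graph_points: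
  assumes "t < N" "sl \<in> slots"
  shows "slot_graph sl t \<subseteq> points \<times> points"
proof (cases sl)
  case None
  then show ?thesis using assms by (auto simp: points_def)
next
  case (Some a)
  then obtain x y b where "sl = Some ((x, y), b)" by (cases a) auto
  then show ?thesis using assms edges_sites by (auto simp: points_def slots_def)
qed

lemma word_graph_points: "\<omega> \<in> words \<Longrightarrow> word_graph \<omega> \<union> closing I \<subseteq> points \<times> points"
proof -
  assume \<omega>: "\<omega> \<in> words"
  have "slot_graph (\<omega> t) t \<subseteq> points \<times> points" if "t < N" for t
    using that by (intro slot_graph_points word_slot \<omega>)
  then show ?thesis
    unfolding word_graph_def closing_def by (auto simp: points_def)
qed

section \<open>Removal of links\<close>

text \<open>Dropping the edges of the link leaves a graph \<open>G\<close> with weaker constraints.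
  The empty slot then needs the vertical edges at \<open>x\<close> and \<open>y\<close>; each
  insertion costs (n + 1)^2 by \<open>wsum_insert\<close>, hence the fourth power.\<close>

lemma loop_weight_remove_link:
  assumes \<omega>: "\<omega> \<in> words" and j: "j < N" and link: "\<omega> j = Some ((x, y), b)"
  shows "loop_weight \<omega> \<le> real ((n + 1) ^ 4) * loop_weight (\<omega>(j := None))"
proof -
  define R where "R = (\<Union>t\<in>{..<N} - {j}. slot_graph (\<omega> t) t) \<union> closing {}"
  define G where "G = {((j, z), (Suc j, z)) | z. z \<in> \<Lambda> - {x, y}} \<union> R"
  have split: "{..<N} = insert j ({..<N} - {j})" using j by auto
  have expand: "word_graph \<omega>' = slot_graph (\<omega>' j) j \<union> (\<Union>t\<in>{..<N} - {j}. slot_graph (\<omega>' t) t)" for \<omega>'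
    unfolding word_graph_def by (subst split) (rule UN_insert)
  have G1: "word_graph \<omega> \<union> closing {} = slot_graph (\<omega> j) j \<union> R"
    unfolding R_def expand[of \<omega>] by (simp only: Un_assoc)
  have xy: "x \<in> \<Lambda>" "y \<in> \<Lambda>"
    using word_slot[OF \<omega> j] link edges_sites by (auto simp: slots_def)
  have G2: "word_graph (\<omega>(j := None)) \<union> closing {}
      = insert ((j, y), (Suc j, y)) (insert ((j, x), (Suc j, x)) G)"
  proof -
    have "word_graph (\<omega>(j := None)) \<union> closing {} = slot_graph None j \<union> R"
      unfolding R_def expand[of "\<omega>(j := None)"] by (simp add: Un_assoc)
    also have "slot_graph None j = insert ((j, y), (Suc j, y)) (insert ((j, x), (Suc j, x))
        {((j, z), (Suc j, z)) | z. z \<in> \<Lambda> - {x, y}})"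
      using xy by auto
    finally show ?thesis by (simp only: G_def Un_insert_left)
  qed
  have sub: "G \<subseteq> points \<times> points"
    using word_graph_points[OF \<omega>, of "{}"] link unfolding G1 G_def by auto
  have pts: "(j, x) \<in> points" "(Suc j, x) \<in> points" "(j, y) \<in> points" "(Suc j, y) \<in> points"
    using xy j by (auto simp: points_def)
  have "loop_weight \<omega> \<le> wsum n points field G"
    unfolding loop_weight_def G1 using link
    by (intro wsum_antimono finite_points) (auto simp: G_def)
  also have "\<dots> \<le> real ((n + 1)\<^sup>2) * wsum n points field (insert ((j, x), (Suc j, x)) G)"
    by (intro wsum_insert finite_points sub pts field_nonneg)
  also have "\<dots> \<le> real ((n + 1)\<^sup>2) * (real ((n + 1)\<^sup>2) *
      wsum n points field (insert ((j, y), (Suc j, y)) (insert ((j, x), (Suc j, x)) G)))"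
    using sub pts by (intro mult_left_mono wsum_insert finite_points field_nonneg) auto
  also have "\<dots> = real ((n + 1) ^ 4) * loop_weight (\<omega>(j := None))"
    unfolding loop_weight_def G2 by (simp only: mult.assoc[symmetric] of_nat_mult[symmetric] power_add[symmetric]) simp
  finally show ?thesis .
qed

text \<open>A link has weight at most \<delta>, an empty slot at least 1/2.\<close>

lemma word_weight_remove_link:
  assumes "j < N" "\<omega> j = Some a"
  shows "word_weight \<omega> \<le> 2 * \<delta> * word_weight (\<omega>(j := None))"
proof -
  let ?R = "\<Prod>t\<in>{..<N} - {j}. slot_weight (\<omega> t)"
  have "word_weight \<omega> = slot_weight (\<omega> j) * ?R"
    unfolding word_weight_def using assms by (intro prod.remove) auto
  also have "\<dots> \<le> (2 * \<delta> * slot_weight None) * ?R"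
  proof (intro mult_right_mono prod_nonneg)
    have "2 * \<delta> * (1 / 2) \<le> 2 * \<delta> * slot_weight None"
      using slot_weight_None delta_pos by (intro mult_left_mono) auto
    then show "slot_weight (\<omega> j) \<le> 2 * \<delta> * slot_weight None"
      using slot_weight_Some[of a] assms(2) by simp
  qed (simp add: slot_weight_nonneg)
  also have "slot_weight None * ?R = word_weight (\<omega>(j := None))"
  proof -
    have "word_weight (\<omega>(j := None))
        = slot_weight ((\<omega>(j := None)) j) * (\<Prod>t\<in>{..<N} - {j}. slot_weight ((\<omega>(j := None)) t))"
      unfolding word_weight_def using assms(1) by (intro prod.remove) auto
    also have "(\<Prod>t\<in>{..<N} - {j}. slot_weight ((\<omega>(j := None)) t)) = ?R"
      by (rule prod.cong) auto
    finally show ?thesis by (simp only: fun_upd_same)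
  qed
  then have "2 * \<delta> * slot_weight None * ?R = 2 * \<delta> * word_weight (\<omega>(j := None))"
    by (simp add: mult.assoc)
  finally show ?thesis .
qed

text \<open>The price of one prescribed link: 2\<delta>(n + 1)^4 for removing it, times 4 because a
  chain fixes it only up to orientation and type.\<close>

definition link_cost :: real where
  "link_cost = 8 * real ((n + 1) ^ 4) * \<delta>"

lemma link_cost_pos: "0 < link_cost"
  unfolding link_cost_def using delta_pos by (intro mult_pos_pos) auto

text \<open>Induction on the prescribed slots. Emptying slot \<open>j\<close> keeps the constraints
  at the other slots, and the word is recovered from the emptied one and one of the at most four
  elements of \<open>L j\<close>.\<close>

lemma prescribed_links_le:
  assumes "finite J" "J \<subseteq> {..<N}"
    and "\<And>j. j \<in> J \<Longrightarrow> L j \<subseteq> range Some" "\<And>j. j \<in> J \<Longrightarrow> finite (L j)" "\<And>j. j \<in> J \<Longrightarrow> card (L j) \<le> 4"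
  shows "(\<Sum>\<omega> | \<omega> \<in> words \<and> (\<forall>j\<in>J. \<omega> j \<in> L j). word_weight \<omega> * loop_weight \<omega>)
       \<le> link_cost ^ card J * partition_fun"
  using assms
proof (induction J rule: finite_induct)
  case empty
  then show ?case by (simp add: partition_fun_def)
next
  case (insert j J)
  let ?S = "{\<omega>. \<omega> \<in> words \<and> (\<forall>j\<in>J. \<omega> j \<in> L j)}"
  let ?f = "\<lambda>\<omega>. word_weight \<omega> * loop_weight \<omega>"
  let ?k = "2 * \<delta> * real ((n + 1) ^ 4)"
  have j: "j < N" "L j \<subseteq> range Some" "finite (L j)" "card (L j) \<le> 4" using insert.prems by auto
  have k: "0 \<le> ?k" using delta_pos by simp
  have "(\<Sum>\<omega> | \<omega> \<in> words \<and> (\<forall>j\<in>insert j J. \<omega> j \<in> L j). ?f \<omega>)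
      \<le> (\<Sum>(\<omega>, l)\<in>?S \<times> L j. ?k * ?f \<omega>)"
  proof (rule sum_le_included[where i = "\<lambda>(\<omega>, l). \<omega>(j := l)"])
    show "\<forall>x\<in>{\<omega> \<in> words. \<forall>j\<in>insert j J. \<omega> j \<in> L j}. \<exists>y\<in>?S \<times> L j.
        (case y of (\<omega>, l) \<Rightarrow> \<omega>(j := l)) = x \<and> ?f x \<le> (case y of (\<omega>, l) \<Rightarrow> ?k * ?f \<omega>)"
    proof
      fix \<omega> assume "\<omega> \<in> {\<omega> \<in> words. \<forall>j\<in>insert j J. \<omega> j \<in> L j}"
      then have \<omega>: "\<omega> \<in> words" "\<omega> j \<in> L j" "\<forall>j\<in>J. \<omega> j \<in> L j" by auto
      then obtain x y b where a: "\<omega> j = Some ((x, y), b)" using j(2) by fastforce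
      have "?f \<omega> \<le> (2 * \<delta> * word_weight (\<omega>(j := None))) * (real ((n + 1) ^ 4) * loop_weight (\<omega>(j := None)))"
        using loop_weight_remove_link[OF \<omega>(1) j(1) a] word_weight_remove_link[of j \<omega>, OF j(1) a] delta_pos
        by (intro mult_mono loop_weight_nonneg mult_nonneg_nonneg word_weight_nonneg) auto
      then have "?f \<omega> \<le> ?k * ?f (\<omega>(j := None))" by (simp add: mult_ac)
      moreover have "\<omega>(j := None) \<in> ?S"
        using \<omega> insert.hyps j(1) by (auto simp: words_def slots_def PiE_def Pi_def extensional_def)
      ultimately show "\<exists>y\<in>?S \<times> L j.
        (case y of (\<omega>, l) \<Rightarrow> \<omega>(j := l)) = \<omega> \<and> ?f \<omega> \<le> (case y of (\<omega>, l) \<Rightarrow> ?k * ?f \<omega>)"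
        using \<omega>(2) by (intro bexI[of _ "(\<omega>(j := None), \<omega> j)"]) auto
    qed
  qed (use j delta_pos finite_words in \<open>auto intro!: mult_nonneg_nonneg word_weight_nonneg loop_weight_nonneg\<close>)
  also have "\<dots> = real (card (L j)) * ?k * (\<Sum>\<omega>\<in>?S. ?f \<omega>)"
    by (subst sum.cartesian_product[symmetric]) (simp add: sum_distrib_left mult_ac)
  also have "\<dots> \<le> (4 * ?k) * (link_cost ^ card J * partition_fun)"
  proof (rule mult_mono)
    show "real (card (L j)) * ?k \<le> 4 * ?k" using j(4) k by (intro mult_right_mono) auto
    show "sum ?f ?S \<le> link_cost ^ card J * partition_fun" using insert by auto
    show "0 \<le> 4 * ?k" using k by linarith
    show "0 \<le> sum ?f ?S"
      by (intro sum_nonneg mult_nonneg_nonneg word_weight_nonneg loop_weight_nonneg)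
  qed
  also have "\<dots> = link_cost ^ card (insert j J) * partition_fun"
    using insert.hyps by (simp add: link_cost_def)
  finally show ?case .
qed

section \<open>Parity of open ends and the raising of an arc\<close>

text \<open>The slot graph matches the points of the layers \<open>t\<close> and
  \<open>Suc t\<close> in pairs, and a set closed under its edges contains both points of a pair or
  neither.\<close>

lemma slot_parity:
  assumes sl: "sl \<in> slots" and closed: "\<And>a b. (a, b) \<in> slot_graph sl t \<Longrightarrow> a \<in> P \<longleftrightarrow> b \<in> P"
  shows "even ((\<Sum>z\<in>\<Lambda>. of_bool ((t, z) \<in> P)) + (\<Sum>z\<in>\<Lambda>. of_bool ((Suc t, z) \<in> P)) :: nat)"
proof (cases sl)
  case None
  then have "(t, z) \<in> P \<longleftrightarrow> (Suc t, z) \<in> P" if "z \<in> \<Lambda>" for z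
    using that by (intro closed) auto
  then have "(\<Sum>z\<in>\<Lambda>. of_bool ((t, z) \<in> P)) = (\<Sum>z\<in>\<Lambda>. of_bool ((Suc t, z) \<in> P) :: nat)"
    by (intro sum.cong) auto
  then show ?thesis by simp
next
  case (Some a)
  then obtain x y b where a: "sl = Some ((x, y), b)" by (cases a) auto
  then have xy: "x \<in> \<Lambda>" "y \<in> \<Lambda>" "x \<noteq> y"
    using sl edges_sites edges_irrefl by (auto simp: slots_def)
  have split: "(\<Sum>z\<in>\<Lambda>. of_bool ((t', z) \<in> P))
      = of_bool ((t', x) \<in> P) + (of_bool ((t', y) \<in> P) + (\<Sum>z\<in>\<Lambda> - {x} - {y}. of_bool ((t', z) \<in> P) :: nat))" for t'
    by (rule sum_remove2[OF finite_sites xy])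
  have "(\<Sum>z\<in>\<Lambda> - {x} - {y}. of_bool ((t, z) \<in> P)) = (\<Sum>z\<in>\<Lambda> - {x} - {y}. of_bool ((Suc t, z) \<in> P) :: nat)"
  proof (rule sum.cong)
    fix z assume "z \<in> \<Lambda> - {x} - {y}"
    then have "((t, z), (Suc t, z)) \<in> slot_graph sl t" unfolding a by auto
    then show "of_bool ((t, z) \<in> P) = (of_bool ((Suc t, z) \<in> P) :: nat)" using closed[of "(t, z)" "(Suc t, z)"] by simp
  qed simp
  moreover have "if b then ((t, x) \<in> P \<longleftrightarrow> (Suc t, y) \<in> P) \<and> ((t, y) \<in> P \<longleftrightarrow> (Suc t, x) \<in> P)
      else ((t, x) \<in> P \<longleftrightarrow> (t, y) \<in> P) \<and> ((Suc t, x) \<in> P \<longleftrightarrow> (Suc t, y) \<in> P)"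
    using closed[of "(t, x)" "(Suc t, y)"] closed[of "(t, y)" "(Suc t, x)"]
      closed[of "(t, x)" "(t, y)"] closed[of "(Suc t, x)" "(Suc t, y)"]
    by (simp add: a)
  ultimately show ?thesis
    unfolding split by (auto simp: of_bool_def split: if_splits)
qed

text \<open>The number of points of a component in a time layer changes by an even number at each
  slot, so that the component of an open end contains exactly one further open end.\<close>

lemma open_ends_parity:
  assumes \<omega>: "\<omega> \<in> words" and xy: "x \<in> \<Lambda>" "y \<in> \<Lambda>" "x \<noteq> y"
    and closed: "\<And>a b. (a, b) \<in> word_graph \<omega> \<union> closing {x, y} \<Longrightarrow> a \<in> P \<longleftrightarrow> b \<in> P"
  shows "((0, x) \<in> P \<longleftrightarrow> (N, x) \<in> P) \<longleftrightarrow> ((0, y) \<in> P \<longleftrightarrow> (N, y) \<in> P)"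
proof -
  let ?c = "\<lambda>t. \<Sum>z\<in>\<Lambda>. of_bool ((t, z) \<in> P) :: nat"
  have "even (?c 0 + ?c t)" if "t \<le> N" for t
    using that
  proof (induction t)
    case (Suc t)
    have "even (?c t + ?c (Suc t))"
    proof (rule slot_parity[of "\<omega> t"])
      show "\<omega> t \<in> slots" using word_slot[OF \<omega>, of t] Suc.prems by simp
      fix a b assume "(a, b) \<in> slot_graph (\<omega> t) t"
      then have "(a, b) \<in> word_graph \<omega> \<union> closing {x, y}"
        using Suc.prems by (auto simp: word_graph_def)
      then show "a \<in> P \<longleftrightarrow> b \<in> P" by (rule closed)
    qed
    moreover have "even (?c 0 + ?c t)" using Suc by simp
    ultimately show ?case by presburger
  qed simp
  then have ev: "even (?c 0 + ?c N)" by simp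
  have split: "?c t' = of_bool ((t', x) \<in> P) + (of_bool ((t', y) \<in> P) + (\<Sum>z\<in>\<Lambda> - {x} - {y}. of_bool ((t', z) \<in> P)))" for t'
    by (rule sum_remove2[OF finite_sites xy])
  have "(\<Sum>z\<in>\<Lambda> - {x} - {y}. of_bool ((0, z) \<in> P)) = (\<Sum>z\<in>\<Lambda> - {x} - {y}. of_bool ((N, z) \<in> P) :: nat)"
  proof (rule sum.cong)
    fix z assume "z \<in> \<Lambda> - {x} - {y}"
    then have "((0, z), (N, z)) \<in> closing {x, y}" unfolding closing_def by auto
    then show "of_bool ((0, z) \<in> P) = (of_bool ((N, z) \<in> P) :: nat)" using closed[of "(0, z)" "(N, z)"] by simp
  qed simp
  with ev show ?thesis
    unfolding split by (auto simp: of_bool_def split: if_splits)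
qed

definition open_component :: "(nat \<Rightarrow> slot) \<Rightarrow> site \<Rightarrow> site \<Rightarrow> nat \<Rightarrow> (nat \<times> site) set" where
  "open_component \<omega> x y t = component (word_graph \<omega> \<union> closing {x, y}) (t, x)"

definition open_cols :: "(nat \<Rightarrow> slot) \<Rightarrow> site \<Rightarrow> site \<Rightarrow> (nat \<times> site \<Rightarrow> nat) set" where
  "open_cols \<omega> x y = {s \<in> cols n points (word_graph \<omega> \<union> closing {x, y}).
     \<forall>z\<in>{x, y}. s (0, z) = s (N, z) + 1 \<or> s (N, z) = s (0, z) + 1}"

text \<open>Components that miss both ends at \<open>y\<close> get the value 0. Parity excludes them
  for the arc that is raised, so nothing is lost, and the later estimate may assume that the arc
  joins \<open>x\<close> to \<open>y\<close>.\<close>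

definition arc_weight :: "(nat \<Rightarrow> slot) \<Rightarrow> site \<Rightarrow> site \<Rightarrow> nat \<Rightarrow> real" where
  "arc_weight \<omega> x y t = (if (0, y) \<in> open_component \<omega> x y t \<or> (N, y) \<in> open_component \<omega> x y t
     then exp (- (\<Sum>v\<in>open_component \<omega> x y t. field v)) else 0)"

lemma open_component_points:
  assumes "\<omega> \<in> words" "x \<in> \<Lambda>" "t \<le> N"
  shows "open_component \<omega> x y t \<subseteq> points"
  unfolding open_component_def using assms
  by (intro component_subset_vertices word_graph_points) (auto simp: points_def)

text \<open>Raising by one the colour of the arc that starts at the lower of the two open ends at
  \<open>x\<close> closes the colouring and gains the field weight of this arc.\<close>

lemma open_cols_raise:
  assumes \<omega>: "\<omega> \<in> words" and xy: "x \<in> \<Lambda>" "y \<in> \<Lambda>" "x \<noteq> y" and s: "s \<in> open_cols \<omega> x y"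
  shows "\<exists>t\<in>{0, N}. \<exists>s'\<in>cols n points (word_graph \<omega> \<union> closing {}).
    (\<lambda>v. if v \<in> open_component \<omega> x y t then s' v - 1 else s' v) = s \<and>
    field_weight n points field s = arc_weight \<omega> x y t * field_weight n points field s'"
proof -
  let ?G = "word_graph \<omega> \<union> closing {x, y}"
  have sG: "s \<in> cols n points ?G" using s by (simp add: open_cols_def)
  \<comment> \<open>\<open>(t, x)\<close> is the lower of the two ends at \<open>x\<close>; it may
    lie in layer 0 or in layer \<open>N\<close>.\<close>
  obtain t t' where t: "{t, t'} = {0, N}" and up: "s (t', x) = s (t, x) + 1"
    using s by (auto simp: open_cols_def)
  have tN: "t \<in> {0, N}" "t' \<in> {0, N}" using t by auto
  let ?P = "open_component \<omega> x y t" and ?P' = "open_component \<omega> x y t'"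
  have colP: "s v = s (t, x)" if "v \<in> ?P" for v
    using cols_component[OF sG] that by (simp add: open_component_def)
  have colP': "s v = s (t, x) + 1" if "v \<in> ?P'" for v
    using cols_component[OF sG, of v "(t', x)"] that up by (simp add: open_component_def)
  have closed: "a \<in> open_component \<omega> x y t0 \<longleftrightarrow> b \<in> open_component \<omega> x y t0" if "(a, b) \<in> ?G" for a b t0
    unfolding open_component_def by (rule component_closed[OF that])
  have base: "(t, x) \<in> ?P" "(t', x) \<in> ?P'"
    by (simp_all add: open_component_def component_refl)
  \<comment> \<open>The two ends at \<open>x\<close> have different colours, so they lie in
    different components, and parity can be applied to each of them.\<close>
  have disj: "?P \<inter> ?P' = {}" using colP colP' by fastforce
  have "((0, x) \<in> ?P \<longleftrightarrow> (N, x) \<in> ?P) \<longleftrightarrow> ((0, y) \<in> ?P \<longleftrightarrow> (N, y) \<in> ?P)"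
    by (rule open_ends_parity[OF \<omega> xy closed])
  then have par: "(0, y) \<in> ?P \<longleftrightarrow> (N, y) \<notin> ?P"
    using base disj t by (auto simp: doubleton_eq_iff)
  have "((0, x) \<in> ?P' \<longleftrightarrow> (N, x) \<in> ?P') \<longleftrightarrow> ((0, y) \<in> ?P' \<longleftrightarrow> (N, y) \<in> ?P')"
    by (rule open_ends_parity[OF \<omega> xy closed])
  then have par': "(0, y) \<in> ?P' \<longleftrightarrow> (N, y) \<notin> ?P'"
    using base disj t by (auto simp: doubleton_eq_iff)
  define s' where "s' v = (if v \<in> ?P then s v + 1 else s v)" for v
  have sub: "?P \<subseteq> points" using open_component_points[OF \<omega> xy(1)] tN by auto
  have le: "s (t, x) + 1 \<le> n"
  proof -
    have "(t', x) \<in> points" using tN xy by (auto simp: points_def)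
    then show ?thesis using sG up by (auto simp: cols_def colorings_def)
  qed
  have s'_col: "s' \<in> colorings n points"
    using sG sub le colP by (auto simp: cols_def colorings_def s'_def)
  have s'_G: "s' a = s' b" if "(a, b) \<in> ?G" for a b
    using sG that closed[OF that] by (auto simp: cols_def s'_def)
  have "s' (0, x) = s' (N, x)"
    using base disj t up by (auto simp: s'_def doubleton_eq_iff)
  \<comment> \<open>Each of the two disjoint arcs contains exactly one end at \<open>y\<close>. The
    one in \<open>?P\<close> has the lower colour and is raised to that of the one in
    \<open>?P'\<close>.\<close>
  moreover have "s' (0, y) = s' (N, y)"
    using par par' disj colP colP' by (cases "(0, y) \<in> ?P") (auto simp: s'_def)
  ultimately have "s' a = s' b" if "(a, b) \<in> word_graph \<omega> \<union> closing {}" for a b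
    using that s'_G[of a b] by (auto simp: closing_def)
  then have "s' \<in> cols n points (word_graph \<omega> \<union> closing {})"
    using s'_col by (auto simp: cols_def)
  moreover have "(\<lambda>v. if v \<in> ?P then s' v - 1 else s' v) = s"
    by (auto simp: s'_def)
  moreover have "field_weight n points field s = arc_weight \<omega> x y t * field_weight n points field s'"
  proof -
    have "(\<Sum>v\<in>points. field v * spin_val n (s' v))
        = (\<Sum>v\<in>points. field v * spin_val n (s v) + (if v \<in> ?P then field v else 0))"
      by (intro sum.cong refl) (auto simp: s'_def spin_val_def algebra_simps)
    also have "\<dots> = (\<Sum>v\<in>points. field v * spin_val n (s v)) + (\<Sum>v\<in>?P. field v)"
      using sub by (simp add: sum.distrib sum.If_cases finite_points Int_absorb1)
    finally show ?thesis
      using par by (auto simp: field_weight_def arc_weight_def exp_add[symmetric])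
  qed
  ultimately show ?thesis using tN by blast
qed

text \<open>The raised colouring and the layer of the lower end determine the original, which is
  recovered by lowering the arc again. The two summands stand for the two possible layers of the
  lower end.\<close>

lemma open_cols_sum_le:
  assumes "\<omega> \<in> words" "x \<in> \<Lambda>" "y \<in> \<Lambda>" "x \<noteq> y"
  shows "(\<Sum>s\<in>open_cols \<omega> x y. field_weight n points field s)
       \<le> (arc_weight \<omega> x y 0 + arc_weight \<omega> x y N) * loop_weight \<omega>"
proof -
  let ?C = "cols n points (word_graph \<omega> \<union> closing {})"
  have aw: "0 \<le> arc_weight \<omega> x y t" for t by (simp add: arc_weight_def)
  have "(\<Sum>s\<in>open_cols \<omega> x y. field_weight n points field s)
      \<le> (\<Sum>(t, s)\<in>{0, N} \<times> ?C. arc_weight \<omega> x y t * field_weight n points field s)"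
  proof (rule sum_le_included[where i = "\<lambda>(t, s) v. if v \<in> open_component \<omega> x y t then s v - 1 else s v"])
    show "finite (open_cols \<omega> x y)"
      unfolding open_cols_def by (simp add: finite_cols finite_points)
    show "\<forall>s\<in>open_cols \<omega> x y. \<exists>p\<in>{0, N} \<times> ?C.
        (case p of (t, s) \<Rightarrow> \<lambda>v. if v \<in> open_component \<omega> x y t then s v - 1 else s v) = s \<and>
        field_weight n points field s \<le> (case p of (t, s) \<Rightarrow> arc_weight \<omega> x y t * field_weight n points field s)"
    proof
      fix s assume "s \<in> open_cols \<omega> x y"
      from open_cols_raise[OF assms this] obtain t s' where
        "t \<in> {0, N}" "s' \<in> ?C"
        "(\<lambda>v. if v \<in> open_component \<omega> x y t then s' v - 1 else s' v) = s"
        "field_weight n points field s = arc_weight \<omega> x y t * field_weight n points field s'"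
        by blast
      then show "\<exists>p\<in>{0, N} \<times> ?C.
        (case p of (t, s) \<Rightarrow> \<lambda>v. if v \<in> open_component \<omega> x y t then s v - 1 else s v) = s \<and>
        field_weight n points field s \<le> (case p of (t, s) \<Rightarrow> arc_weight \<omega> x y t * field_weight n points field s)"
        by (intro bexI[of _ "(t, s')"]) auto
    qed
  qed (auto simp: finite_cols finite_points intro!: mult_nonneg_nonneg aw less_imp_le[OF field_weight_pos])
  also have "\<dots> = (\<Sum>t\<in>{0, N}. arc_weight \<omega> x y t * loop_weight \<omega>)"
    by (subst sum.cartesian_product[symmetric]) (simp add: loop_weight_def wsum_def sum_distrib_left)
  also have "\<dots> = (arc_weight \<omega> x y 0 + arc_weight \<omega> x y N) * loop_weight \<omega>"
    using N_pos by (simp add: distrib_right)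
  finally show ?thesis .
qed

end

section \<open>Chains of links\<close>

text \<open>Distance on the time circle, where 0 and \<open>N\<close> are the same instant. With
  truncated subtraction, \<open>(s - t) + (t - s)\<close> is the absolute difference.\<close>

definition cyc_dist :: "nat \<Rightarrow> nat \<Rightarrow> nat \<Rightarrow> nat" where
  "cyc_dist N s t = min ((s - t) + (t - s)) (N - ((s - t) + (t - s)))"

text \<open>The four choices in the two minima on the right are covered by the triangle inequalities
  for the absolute differences and, if both distances wrap around, by
  \<open>p + q + r \<le> 2 * N\<close>.\<close>

lemma cyc_dist_triangle:
  assumes "a \<le> N" "b \<le> N" "c \<le> N"
  shows "cyc_dist N a c \<le> cyc_dist N a b + cyc_dist N b c"
proof -
  define p q r where "p = (a - b) + (b - a)" and "q = (b - c) + (c - b)" and "r = (a - c) + (c - a)"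
  have "r \<le> p + q" "q \<le> p + r" "p \<le> q + r"
    by (simp_all add: p_def q_def r_def)
  moreover have "p + q + r \<le> 2 * N"
    using assms by (cases "a \<le> b"; cases "b \<le> c"; cases "a \<le> c"; simp add: p_def q_def r_def)
  ultimately show ?thesis
    unfolding cyc_dist_def p_def[symmetric] q_def[symmetric] r_def[symmetric] by linarith
qed

lemma cyc_dist_le_Suc:
  assumes "t \<in> {j, Suc j}" "t' \<in> {j, Suc j}"
  shows "cyc_dist N t t' \<le> 1"
  using assms unfolding cyc_dist_def by (elim insertE) simp_all

text \<open>A chain is a list of jumps: \<open>(t, z)\<close> means that the link in slot
  \<open>t\<close> leads to the site \<open>z\<close>. Starting site and time are kept
  apart.\<close>

fun end_site :: "'s \<Rightarrow> (nat \<times> 's) list \<Rightarrow> 's" where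
  "end_site z [] = z"
| "end_site z ((t, z') # c) = end_site z' c"

fun end_time :: "nat \<Rightarrow> (nat \<times> 's) list \<Rightarrow> nat" where
  "end_time t [] = t"
| "end_time t ((t', z) # c) = end_time t' c"

text \<open>Only the time up to the last link is counted; the stretch after it is added in
  \<open>reach\<close>.\<close>

fun chain_cost :: "nat \<Rightarrow> nat \<Rightarrow> (nat \<times> 's) list \<Rightarrow> nat" where
  "chain_cost N t [] = 0"
| "chain_cost N t ((t', z) # c) = cyc_dist N t t' + chain_cost N t' c"

lemma end_site_append: "end_site z (c @ c') = end_site (end_site z c) c'"
  by (induction z c rule: end_site.induct) auto

lemma end_time_append: "end_time t (c @ c') = end_time (end_time t c) c'"
  by (induction t c rule: end_time.induct) auto

lemma chain_cost_append: "chain_cost N t (c @ c') = chain_cost N t c + chain_cost N (end_time t c) c'"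
  by (induction N t c rule: chain_cost.induct) auto

lemma chain_split:
  assumes "z \<in> set (x # map snd c)"
  shows "\<exists>c1 c2. c = c1 @ c2 \<and> end_site x c1 = z"
  using assms
proof (induction c arbitrary: x)
  case (Cons a c)
  obtain t y where a: "a = (t, y)" by (cases a)
  show ?case
  proof (cases "z = x")
    case True
    then show ?thesis by (intro exI[of _ "[]"] exI[of _ "a # c"]) simp
  next
    case False
    then have "z \<in> set (y # map snd c)" using Cons.prems a by auto
    from Cons.IH[OF this] obtain c1 c2 where "c = c1 @ c2" "end_site y c1 = z" by auto
    then show ?thesis using a by (intro exI[of _ "a # c1"] exI[of _ c2]) auto
  qed
qed auto

text \<open>While \<open>q\<close> is missing, \<open>B k\<close> does not contain the whole
  component; the part it contains is then not closed under edges, so the next step adds a point.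
  Hence the number of steps without reaching \<open>q\<close> is less than the size of the
  component.\<close>

lemma component_growth:
  fixes B :: "nat \<Rightarrow> 'v set"
  assumes fin: "finite (component G p)" and base: "p \<in> B 0"
    and step: "\<And>k a b. a \<in> B k \<Longrightarrow> (a, b) \<in> G \<or> (b, a) \<in> G \<Longrightarrow> b \<in> B (Suc k)"
    and mono: "\<And>k. B k \<subseteq> B (Suc k)"
    and q: "q \<in> component G p" "q \<notin> B k"
  shows "Suc k \<le> card (component G p \<inter> B k)"
  using q(2)
proof (induction k)
  case 0
  have "p \<in> component G p \<inter> B 0" using base by (simp add: component_refl)
  then show ?case using fin by (metis One_nat_def Suc_leI card_gt_0_iff empty_iff finite_Int)
next
  case (Suc k)
  let ?P = "component G p"
  have qk: "q \<notin> B k" using Suc.prems mono by blast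
  have pk: "p \<in> B k" by (induction k) (use base mono in auto)
  have "?P \<inter> B k \<noteq> ?P \<inter> B (Suc k)"
  proof
    assume eq: "?P \<inter> B k = ?P \<inter> B (Suc k)"
    have "?P \<subseteq> ?P \<inter> B k"
    proof (rule component_subset)
      fix a b assume a: "a \<in> ?P \<inter> B k" and ab: "(a, b) \<in> G \<or> (b, a) \<in> G"
      then have "b \<in> ?P" using component_closed by (metis IntD1)
      then show "b \<in> ?P \<inter> B k" using step[of a k b] a ab eq by auto
    qed (use pk in \<open>simp add: component_refl\<close>)
    then show False using q(1) qk by auto
  qed
  then have "?P \<inter> B k \<subset> ?P \<inter> B (Suc k)" using mono by blast
  then have "card (?P \<inter> B k) < card (?P \<inter> B (Suc k))" using fin by (intro psubset_card_mono) auto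
  then show ?case using Suc.IH[OF qk] by simp
qed

section \<open>Short chains inside a component\<close>

context loop_model
begin

fun linked :: "(nat \<Rightarrow> slot) \<Rightarrow> site \<Rightarrow> (nat \<times> site) list \<Rightarrow> bool" where
  "linked \<omega> z [] \<longleftrightarrow> True"
| "linked \<omega> z ((t, z') # c) \<longleftrightarrow> t < N \<and> (\<exists>b. \<omega> t \<in> {Some ((z, z'), b), Some ((z', z), b)}) \<and> linked \<omega> z' c"

lemma linked_append: "linked \<omega> z (c @ c') \<longleftrightarrow> linked \<omega> z c \<and> linked \<omega> (end_site z c) c'"
  by (induction \<omega> z c rule: linked.induct) auto

lemma end_time_le: "linked \<omega> z c \<Longrightarrow> t \<le> N \<Longrightarrow> end_time t c \<le> N"
  by (induction \<omega> z c arbitrary: t rule: linked.induct) auto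

text \<open>The triangle inequality along a chain; it bounds the cost when a chain is cut at a
  revisited site.\<close>

lemma cyc_dist_le_chain_cost:
  assumes "linked \<omega> z c" "a \<le> N" "t \<le> N"
  shows "cyc_dist N a t \<le> chain_cost N a c + cyc_dist N (end_time a c) t"
  using assms
proof (induction \<omega> z c arbitrary: a rule: linked.induct)
  case (2 \<omega> z t' z' c)
  then have "cyc_dist N t' t \<le> chain_cost N t' c + cyc_dist N (end_time t' c) t" by auto
  moreover have "cyc_dist N a t \<le> cyc_dist N a t' + cyc_dist N t' t"
    by (rule cyc_dist_triangle) (use 2 in auto)
  ultimately show ?case by simp
qed auto

text \<open>Slot \<open>j\<close> lies between the layers \<open>j\<close> and \<open>Suc j\<close>.
  Crossing a link may cost one unit to get to \<open>j\<close> and one more to get to the new layer,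
  whence \<open>2 * k\<close>.\<close>

definition reach :: "(nat \<Rightarrow> slot) \<Rightarrow> site \<Rightarrow> nat \<Rightarrow> (nat \<times> site) set" where
  "reach \<omega> x k = {(t, z). t \<le> N \<and> (\<exists>c. linked \<omega> x c \<and> distinct (x # map snd c) \<and> end_site x c = z
     \<and> chain_cost N 0 c + cyc_dist N (end_time 0 c) t \<le> 2 * k)}"

lemma slot_graph_edge:
  assumes "((t, z), (t', z')) \<in> slot_graph sl j"
  shows "t \<in> {j, Suc j} \<and> t' \<in> {j, Suc j} \<and>
    (z = z' \<or> (\<exists>b. sl \<in> {Some ((z, z'), b), Some ((z', z), b)}))"
proof (cases sl)
  case None
  then show ?thesis using assms by auto
next
  case (Some a)
  then obtain x y b where "sl = Some ((x, y), b)" by (cases a) auto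
  then show ?thesis using assms by (auto split: if_splits)
qed

text \<open>An edge of the closing joins the layers 0 and \<open>N\<close>, which have cyclic
  distance 0. This is why time is measured on a circle.\<close>

lemma word_graph_edge:
  assumes "((t, z), (t', z')) \<in> word_graph \<omega> \<union> closing I \<or> ((t', z'), (t, z)) \<in> word_graph \<omega> \<union> closing I"
  shows "t' \<le> N \<and> (z = z' \<and> cyc_dist N t t' \<le> 1 \<or>
    (\<exists>j<N. t \<in> {j, Suc j} \<and> t' \<in> {j, Suc j} \<and> (\<exists>b. \<omega> j \<in> {Some ((z, z'), b), Some ((z', z), b)})))"
proof -
  consider j where "j < N" "((t, z), (t', z')) \<in> slot_graph (\<omega> j) j \<or> ((t', z'), (t, z)) \<in> slot_graph (\<omega> j) j"
    | "z = z'" "t = 0 \<and> t' = N \<or> t = N \<and> t' = 0"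
    using assms unfolding word_graph_def closing_def by fastforce
  then show ?thesis
  proof cases
    case 1
    then have "t \<in> {j, Suc j} \<and> t' \<in> {j, Suc j} \<and>
        (z = z' \<or> (\<exists>b. \<omega> j \<in> {Some ((z, z'), b), Some ((z', z), b)}))"
      using slot_graph_edge[of t z t' z' "\<omega> j" j] slot_graph_edge[of t' z' t z "\<omega> j" j] by blast
    then show ?thesis using cyc_dist_le_Suc[of t j t' N] \<open>j < N\<close> by auto
  next
    case 2
    then show ?thesis by (auto simp: cyc_dist_def)
  qed
qed

text \<open>When the walk returns to a site of the chain, the chain is cut there: its sites stay
  distinct, and the triangle inequality controls the cost.\<close>

lemma reach_step:
  assumes "a \<in> reach \<omega> x k" "(a, b) \<in> word_graph \<omega> \<union> closing I \<or> (b, a) \<in> word_graph \<omega> \<union> closing I"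
  shows "b \<in> reach \<omega> x (Suc k)"
proof -
  obtain t z t' z' where ab: "a = (t, z)" "b = (t', z')" by (cases a, cases b)
  obtain c where t: "t \<le> N" and c: "linked \<omega> x c" "distinct (x # map snd c)" "end_site x c = z"
    and cost: "chain_cost N 0 c + cyc_dist N (end_time 0 c) t \<le> 2 * k"
    using assms(1) unfolding ab reach_def by auto
  have eN: "end_time 0 c \<le> N" by (rule end_time_le[OF c(1)]) simp
  have t': "t' \<le> N" and
    cases: "z = z' \<and> cyc_dist N t t' \<le> 1 \<or>
    (\<exists>j<N. t \<in> {j, Suc j} \<and> t' \<in> {j, Suc j} \<and> (\<exists>b. \<omega> j \<in> {Some ((z, z'), b), Some ((z', z), b)}))"
    using word_graph_edge[OF assms(2)[unfolded ab]] by auto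
  have near: "cyc_dist N t t' \<le> 1" using cases cyc_dist_le_Suc by blast
  have tri: "cyc_dist N (end_time 0 c) t' \<le> cyc_dist N (end_time 0 c) t + cyc_dist N t t'"
    by (rule cyc_dist_triangle[OF eN t t'])
  show ?thesis
  proof (cases "z' \<in> set (x # map snd c)")
    case True
    from chain_split[OF this] obtain c1 c2 where c12: "c = c1 @ c2" "end_site x c1 = z'" by (elim exE conjE)
    have l: "linked \<omega> x c1" "linked \<omega> z' c2" using c(1) c12 by (auto simp: linked_append)
    have "end_time 0 c1 \<le> N" by (rule end_time_le[OF l(1)]) simp
    from cyc_dist_le_chain_cost[OF l(2) this t']
    have "chain_cost N 0 c1 + cyc_dist N (end_time 0 c1) t' \<le> chain_cost N 0 c + cyc_dist N (end_time 0 c) t'"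
      using c12 by (simp add: chain_cost_append end_time_append)
    also have "\<dots> \<le> 2 * Suc k" using cost near tri by simp
    finally show ?thesis
      using l(1) c12 c(2) t' unfolding ab reach_def by auto
  next
    case False
    then have "z \<noteq> z'" using c(3) by (cases c rule: rev_cases) (auto simp: end_site_append)
    then obtain j b where j: "j < N" "t \<in> {j, Suc j}" "t' \<in> {j, Suc j}"
      "\<omega> j \<in> {Some ((z, z'), b), Some ((z', z), b)}"
      using cases by blast
    let ?c = "c @ [(j, z')]"
    have "cyc_dist N (end_time 0 c) j \<le> cyc_dist N (end_time 0 c) t + cyc_dist N t j"
      by (rule cyc_dist_triangle) (use eN t j(1) in auto)
    moreover have "cyc_dist N t j \<le> 1" "cyc_dist N j t' \<le> 1"
      using j cyc_dist_le_Suc by blast+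
    ultimately have "chain_cost N 0 ?c + cyc_dist N (end_time 0 ?c) t' \<le> 2 * Suc k"
      using cost by (simp add: chain_cost_append end_time_append)
    moreover have "linked \<omega> x ?c" using c j by (auto simp: linked_append)
    moreover have "distinct (x # map snd ?c)" using c(2) False by auto
    ultimately show ?thesis
      using t' unfolding ab reach_def by (auto simp: end_site_append intro!: exI[of _ ?c])
  qed
qed

text \<open>If the arc did not reach \<open>y\<close> within as many steps as it has points, every
  step would add a point and there would be too many. So the duration of the arc bounds the cost of
  a chain.\<close>

lemma open_component_chain:
  assumes "\<omega> \<in> words" "x \<in> \<Lambda>" "t \<in> {0, N}" "(t', y) \<in> open_component \<omega> x y t"
  shows "\<exists>c. linked \<omega> x c \<and> distinct (x # map snd c) \<and> end_site x c = y
    \<and> chain_cost N 0 c \<le> 2 * card (open_component \<omega> x y t)"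
proof -
  let ?P = "open_component \<omega> x y t"
  let ?G = "word_graph \<omega> \<union> closing {x, y}"
  have fin: "finite ?P"
    using open_component_points[of \<omega> x t y] assms finite_points by (auto intro: finite_subset)
  have "(t', y) \<in> reach \<omega> x (card ?P)"
  proof (rule ccontr)
    assume "(t', y) \<notin> reach \<omega> x (card ?P)"
    then have "Suc (card ?P) \<le> card (component ?G (t, x) \<inter> reach \<omega> x (card ?P))"
    proof (rule component_growth[rotated -1])
      \<comment> \<open>Both ends start at cost 0, as \<open>cyc_dist N 0 N = 0\<close>; the cost is
        counted from time 0 in either case.\<close>
      show "(t, x) \<in> reach \<omega> x 0"
        using assms(3) by (auto simp: reach_def cyc_dist_def intro!: exI[of _ "[]"])
      show "\<And>k. reach \<omega> x k \<subseteq> reach \<omega> x (Suc k)"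
        unfolding reach_def by fastforce
    qed (use fin assms(4) reach_step in \<open>auto simp: open_component_def\<close>)
    also have "\<dots> \<le> card ?P" using fin by (auto simp: open_component_def intro: card_mono)
    finally show False by simp
  qed
  then show ?thesis unfolding reach_def by auto
qed

end

section \<open>Summation over chains\<close>

lemma sum_power_inj_le:
  fixes q :: real
  assumes "finite A" "inj_on f A" "0 \<le> q" "q < 1"
  shows "(\<Sum>a\<in>A. q ^ f a) \<le> 1 / (1 - q)"
proof -
  have "(\<Sum>a\<in>A. q ^ f a) = (\<Sum>k\<in>f ` A. q ^ k)"
    using assms(2) by (simp add: sum.reindex)
  also have "\<dots> \<le> (\<Sum>k. q ^ k)"
    using assms by (intro sum_le_suminf) (auto simp: summable_geometric)
  also have "\<dots> = 1 / (1 - q)"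
    using assms by (intro suminf_geometric) auto
  finally show ?thesis .
qed

text \<open>Four geometric series: the direct distances on either side of \<open>t\<close>, and the
  distance around the circle, which is at least \<open>t'\<close> if \<open>t' \<le> t\<close> and
  at least \<open>N - t'\<close> otherwise. The bound depends on neither \<open>N\<close> nor
  \<open>t\<close>.\<close>

lemma sum_power_cyc_dist_le:
  fixes q :: real
  assumes t: "t \<le> N" and q: "0 \<le> q" "q < 1"
  shows "(\<Sum>t'<N. q ^ cyc_dist N t t') \<le> 4 / (1 - q)"
proof -
  let ?a = "\<lambda>t'. if t' \<le> t then q ^ (t - t') else 0"
  let ?b = "\<lambda>t'. if t \<le> t' then q ^ (t' - t) else 0"
  have le: "q ^ cyc_dist N t t' \<le> ?a t' + ?b t' + q ^ t' + q ^ (N - t')" if t': "t' < N" for t'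
  proof (cases "cyc_dist N t t' = (t - t') + (t' - t)")
    case True
    then show ?thesis using q by (cases "t' \<le> t") auto
  next
    case False
    then have eq: "cyc_dist N t t' = N - ((t - t') + (t' - t))" by (auto simp: cyc_dist_def min_def)
    show ?thesis
    proof (cases "t' \<le> t")
      case True
      then have "q ^ cyc_dist N t t' \<le> q ^ t'" using eq t q by (intro power_decreasing) auto
      then show ?thesis using q by (smt (verit) zero_le_power)
    next
      case False
      then have "q ^ cyc_dist N t t' \<le> q ^ (N - t')" using eq t t' q by (intro power_decreasing) auto
      then show ?thesis using q by (smt (verit) zero_le_power)
    qed
  qed
  have "(\<Sum>t'<N. q ^ cyc_dist N t t') \<le> (\<Sum>t'<N. ?a t' + ?b t' + q ^ t' + q ^ (N - t'))"
    using le by (intro sum_mono) auto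
  also have "\<dots> = (\<Sum>t'\<in>{t'\<in>{..<N}. t' \<le> t}. q ^ (t - t')) + (\<Sum>t'\<in>{t'\<in>{..<N}. t \<le> t'}. q ^ (t' - t))
      + (\<Sum>t'<N. q ^ t') + (\<Sum>t'<N. q ^ (N - t'))"
    by (simp only: sum.distrib sum.inter_filter[OF finite_lessThan])
  also have "\<dots> \<le> 1 / (1 - q) + 1 / (1 - q) + 1 / (1 - q) + 1 / (1 - q)"
    using q by (intro add_mono sum_power_inj_le) (auto simp: inj_on_def)
  finally show ?thesis by simp
qed

context loop_model
begin

definition nbrs :: "site \<Rightarrow> site set" where
  "nbrs z = {z'. (z, z') \<in> E \<or> (z', z) \<in> E}"

text \<open>The candidates for a chain with \<open>m\<close> links, irrespective of the word, so
  that the sums over chains and over words can be exchanged.\<close>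

fun walks :: "nat \<Rightarrow> site \<Rightarrow> (nat \<times> site) list set" where
  "walks 0 z = {[]}"
| "walks (Suc m) z = (\<lambda>(p, c). p # c) ` (SIGMA p:{..<N} \<times> nbrs z. walks m (snd p))"

lemma nbrs_sites: "nbrs z \<subseteq> \<Lambda>"
  using edges_sites by (auto simp: nbrs_def)

lemma finite_nbrs: "finite (nbrs z)"
  using nbrs_sites finite_sites finite_subset by blast

lemma finite_walks: "finite (walks m z)"
  by (induction m arbitrary: z) (auto simp: finite_nbrs)

lemma linked_walk: "\<omega> \<in> words \<Longrightarrow> linked \<omega> z c \<Longrightarrow> c \<in> walks (length c) z"
proof (induction \<omega> z c rule: linked.induct)
  case (2 \<omega> z t z' c)
  then have "t < N" "\<omega> t \<in> slots" "c \<in> walks (length c) z'" using word_slot by auto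
  moreover have "z' \<in> nbrs z" using 2 \<open>\<omega> t \<in> slots\<close> by (auto simp: nbrs_def slots_def)
  ultimately show ?case by (auto intro!: image_eqI[of _ _ "((t, z'), c)"])
qed auto

lemma walk_sites: "c \<in> walks m z \<Longrightarrow> set (map snd c) \<subseteq> \<Lambda>"
proof (induction m arbitrary: z c)
  case (Suc m)
  then show ?case using nbrs_sites by fastforce
qed auto

lemma walk_length: "c \<in> walks m z \<Longrightarrow> length c = m"
  by (induction m arbitrary: z c) auto

text \<open>In each step there are at most \<open>D\<close> neighbours, and the sum over the time of
  the link is at most \<open>4 / (1 - q)\<close> whatever the current time.\<close>

lemma walks_sum_le:
  fixes q :: real
  assumes deg: "\<And>z. card (nbrs z) \<le> D" and q: "0 \<le> q" "q < 1" and t: "t \<le> N"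
  shows "(\<Sum>c\<in>walks m z. q ^ chain_cost N t c) \<le> (real D * (4 / (1 - q))) ^ m"
  using t
proof (induction m arbitrary: z t)
  case (Suc m)
  let ?B = "(real D * (4 / (1 - q))) ^ m"
  have B: "0 \<le> ?B" using q by auto
  have "inj_on (\<lambda>(p, c). p # c) (SIGMA p:{..<N} \<times> nbrs z. walks m (snd p))"
    by (auto simp: inj_on_def)
  then have "(\<Sum>c\<in>walks (Suc m) z. q ^ chain_cost N t c)
      = (\<Sum>(p, c)\<in>(SIGMA p:{..<N} \<times> nbrs z. walks m (snd p)). q ^ chain_cost N t (p # c))"
    by (simp add: sum.reindex case_prod_unfold)
  also have "\<dots> = (\<Sum>p\<in>{..<N} \<times> nbrs z. \<Sum>c\<in>walks m (snd p). q ^ chain_cost N t (p # c))"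
    by (subst sum.Sigma) (auto simp: finite_nbrs finite_walks)
  also have "\<dots> = (\<Sum>p\<in>{..<N} \<times> nbrs z. q ^ cyc_dist N t (fst p) * (\<Sum>c\<in>walks m (snd p). q ^ chain_cost N (fst p) c))"
    by (intro sum.cong refl) (auto simp: sum_distrib_left power_add)
  also have "\<dots> \<le> (\<Sum>p\<in>{..<N} \<times> nbrs z. q ^ cyc_dist N t (fst p) * ?B)"
    using Suc.IH q by (intro sum_mono mult_left_mono) auto
  also have "\<dots> = (\<Sum>t'<N. \<Sum>z'\<in>nbrs z. q ^ cyc_dist N t t' * ?B)"
    by (subst sum.cartesian_product) (simp add: case_prod_unfold)
  also have "\<dots> = (\<Sum>t'<N. q ^ cyc_dist N t t') * real (card (nbrs z)) * ?B"
    by (simp add: sum_distrib_right sum_distrib_left mult_ac)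
  also have "\<dots> \<le> 4 / (1 - q) * real D * ?B"
    using q deg[of z] Suc.prems B
    by (intro mult_right_mono mult_mono sum_power_cyc_dist_le) auto
  finally show ?case by (simp add: mult_ac)
qed simp

lemma linked_slots:
  assumes "linked \<omega> z c" "j \<in> fst ` set c"
  shows "j < N \<and> (\<exists>a b' i. \<omega> j = Some ((a, b'), i) \<and> a \<in> set (z # map snd c) \<and> b' \<in> set (z # map snd c))"
  using assms
proof (induction \<omega> z c rule: linked.induct)
  case (2 \<omega> z t z' c)
  show ?case
  proof (cases "j = t")
    case True
    then show ?thesis using 2 by auto
  next
    case False
    then have "j \<in> fst ` set c" using 2 by auto
    then show ?thesis using 2 by auto
  qed
qed auto

text \<open>A slot used again would bring the chain back to the site from which its link was first
  crossed. Thus a self-avoiding chain with \<open>m\<close> links occupies \<open>m\<close> slots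
  and pays \<open>link_cost\<close> for each.\<close>

lemma linked_distinct_times:
  assumes "linked \<omega> z c" "distinct (z # map snd c)"
  shows "distinct (map fst c)"
  using assms
proof (induction \<omega> z c rule: linked.induct)
  case (2 \<omega> z t z' c)
  have "t \<notin> fst ` set c"
  proof
    assume "t \<in> fst ` set c"
    then obtain a b' i where "\<omega> t = Some ((a, b'), i)" "a \<in> set (z' # map snd c)" "b' \<in> set (z' # map snd c)"
      using linked_slots[of \<omega> z' c t] 2 by auto
    then show False using 2 by auto
  qed
  then show ?case using 2 by auto
qed auto

text \<open>All words carrying the chain have the same edges at its slots as a reference word
  \<open>\<omega>'\<close>, up to orientation and type. These are the four candidates for
  \<open>prescribed_links_le\<close>.\<close>

lemma linked_agree:
  assumes "linked \<omega> z c" "linked \<omega>' z c" "j \<in> fst ` set c"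
  shows "\<omega> j \<in> Some ` ({fst (the (\<omega>' j)), prod.swap (fst (the (\<omega>' j)))} \<times> UNIV)"
  using assms
proof (induction \<omega> z c rule: linked.induct)
  case (2 \<omega> z t z' c)
  show ?case
  proof (cases "j \<in> fst ` set c")
    case True
    then show ?thesis using 2 by auto
  next
    case False
    then have "j = t" using 2 by auto
    then show ?thesis using 2 by auto
  qed
qed auto

lemma linked_sum_le:
  assumes dist: "distinct (x # map snd c)"
  shows "(\<Sum>\<omega> | \<omega> \<in> words \<and> linked \<omega> x c. word_weight \<omega> * loop_weight \<omega>)
       \<le> link_cost ^ length c * partition_fun"
proof (cases "\<exists>\<omega>'\<in>words. linked \<omega>' x c")
  case False
  then have "{\<omega>. \<omega> \<in> words \<and> linked \<omega> x c} = {}" by auto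
  then show ?thesis
    using link_cost_pos partition_fun_nonneg by (simp only: sum.empty) simp
next
  case True
  then obtain \<omega>' where \<omega>': "linked \<omega>' x c" by auto
  define L where "L j = Some ` ({fst (the (\<omega>' j)), prod.swap (fst (the (\<omega>' j)))} \<times> (UNIV :: bool set))" for j
  let ?J = "fst ` set c"
  have card: "card ?J = length c"
    using distinct_card[OF linked_distinct_times[OF \<omega>' dist]] by simp
  have "card (L j) \<le> 4" for j
  proof -
    have "card (L j) \<le> card ({fst (the (\<omega>' j)), prod.swap (fst (the (\<omega>' j)))} \<times> (UNIV :: bool set))"
      unfolding L_def by (intro card_image_le) auto
    also have "\<dots> \<le> 2 * 2"
      unfolding card_cartesian_product by (intro mult_mono) (auto simp: card_insert_if)
    finally show ?thesis by simp
  qed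
  moreover have "?J \<subseteq> {..<N}" using linked_slots[OF \<omega>'] by auto
  ultimately have "(\<Sum>\<omega> | \<omega> \<in> words \<and> (\<forall>j\<in>?J. \<omega> j \<in> L j). word_weight \<omega> * loop_weight \<omega>)
      \<le> link_cost ^ card ?J * partition_fun"
    by (intro prescribed_links_le) (auto simp: L_def)
  moreover have "(\<Sum>\<omega> | \<omega> \<in> words \<and> linked \<omega> x c. word_weight \<omega> * loop_weight \<omega>)
      \<le> (\<Sum>\<omega> | \<omega> \<in> words \<and> (\<forall>j\<in>?J. \<omega> j \<in> L j). word_weight \<omega> * loop_weight \<omega>)"
  proof (rule sum_mono2)
    show "{\<omega>. \<omega> \<in> words \<and> linked \<omega> x c} \<subseteq> {\<omega>. \<omega> \<in> words \<and> (\<forall>j\<in>?J. \<omega> j \<in> L j)}"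
      using linked_agree[OF _ \<omega>'] unfolding L_def by blast
  qed (auto simp: finite_words intro!: mult_nonneg_nonneg word_weight_nonneg loop_weight_nonneg)
  ultimately show ?thesis using card by simp
qed

text \<open>A self-avoiding chain has at most |\<Lambda>| links, so the bound on \<open>m\<close>
  loses nothing and makes the set finite.\<close>

definition link_chains :: "site \<Rightarrow> site \<Rightarrow> (nat \<times> site) list set" where
  "link_chains x y = {c \<in> (\<Union>m\<le>card \<Lambda>. walks m x). distinct (x # map snd c) \<and> end_site x c = y}"

lemma finite_link_chains: "finite (link_chains x y)"
  unfolding link_chains_def by (simp add: finite_walks)

text \<open>The threshold is the duration \<open>r / (2 * \<mu>)\<close>. A longer arc has weight at
  most \<open>exp (- (\<alpha> / 2) * (r / (2 * \<mu>)))\<close>. A shorter one yields a chain with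
  \<open>\<mu> * \<delta> * cost \<le> r\<close>, so 1 is at most
  \<open>exp r * exp (- \<mu> * \<delta>) ^ cost\<close>: an exponential Chebyshev bound, summed
  over all chains.\<close>

lemma arc_weight_le:
  assumes \<omega>: "\<omega> \<in> words" and x: "x \<in> \<Lambda>" and t: "t \<in> {0, N}"
    and \<mu>: "0 < \<mu>" and r: "0 \<le> r"
  shows "arc_weight \<omega> x y t \<le> exp (- (\<alpha> / (4 * \<mu>)) * r)
    + exp r * (\<Sum>c\<in>link_chains x y. of_bool (linked \<omega> x c) * exp (- \<mu> * \<delta>) ^ chain_cost N 0 c)"
    (is "_ \<le> ?A + exp r * ?S")
proof -
  let ?P = "open_component \<omega> x y t"
  have S: "0 \<le> ?S" by (intro sum_nonneg) auto
  have sub: "?P \<subseteq> points" using open_component_points[OF \<omega> x, of t y] t by auto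
  show ?thesis
  proof (cases "(0, y) \<in> ?P \<or> (N, y) \<in> ?P")
    case False
    then show ?thesis using S by (simp add: arc_weight_def)
  next
    case True
    then obtain t' where t': "(t', y) \<in> ?P" by auto
    have aw: "arc_weight \<omega> x y t = exp (- (\<Sum>v\<in>?P. field v))" using True by (simp add: arc_weight_def)
    have "real (card ?P) * (\<alpha> * \<delta> / 2) \<le> (\<Sum>v\<in>?P. field v)"
      using sub field_lower by (intro sum_bounded_below) auto
    then have aw2: "arc_weight \<omega> x y t \<le> exp (- (real (card ?P) * (\<alpha> * \<delta> / 2)))"
      unfolding aw by simp
    show ?thesis
    proof (cases "r / (2 * \<mu>) \<le> \<delta> * card ?P")
      case True
      then have "\<alpha> / 2 * (r / (2 * \<mu>)) \<le> \<alpha> / 2 * (\<delta> * card ?P)"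
        using alpha_pos by (intro mult_left_mono) auto
      then have "exp (- (real (card ?P) * (\<alpha> * \<delta> / 2))) \<le> ?A"
        by (simp add: mult_ac)
      moreover have "0 \<le> exp r * ?S" using S by simp
      ultimately show ?thesis using aw2 by linarith
    next
      case False
      from open_component_chain[OF \<omega> x t t'] obtain c where
        c: "linked \<omega> x c" "distinct (x # map snd c)" "end_site x c = y" "chain_cost N 0 c \<le> 2 * card ?P"
        by (elim exE conjE)
      have cw: "c \<in> walks (length c) x" by (rule linked_walk[OF \<omega> c(1)])
      have "card (set (map snd c)) \<le> card \<Lambda>"
        by (intro card_mono finite_sites walk_sites[OF cw])
      then have "length c \<le> card \<Lambda>" using c(2) distinct_card[of "map snd c"] by simp
      then have cc: "c \<in> link_chains x y" using cw c by (auto simp: link_chains_def)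
      have "\<delta> * real (chain_cost N 0 c) \<le> \<delta> * (2 * real (card ?P))"
        using c(4) delta_pos by (intro mult_left_mono) auto
      also have "\<dots> \<le> r / \<mu>" using False by (simp add: field_simps)
      finally have "\<mu> * \<delta> * real (chain_cost N 0 c) \<le> r" using \<mu> by (simp add: field_simps)
      then have "1 \<le> exp r * exp (- \<mu> * \<delta>) ^ chain_cost N 0 c"
        by (simp add: exp_of_nat_mult[symmetric] exp_add[symmetric] mult_ac)
      also have "\<dots> \<le> exp r * ?S"
      proof (intro mult_left_mono)
        have "of_bool (linked \<omega> x c) * exp (- \<mu> * \<delta>) ^ chain_cost N 0 c \<le> ?S"
          by (rule member_le_sum[OF cc]) (auto simp: finite_link_chains)
        then show "exp (- \<mu> * \<delta>) ^ chain_cost N 0 c \<le> ?S" using c(1) by simp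
      qed simp
      finally have "1 \<le> exp r * ?S" .
      moreover have "arc_weight \<omega> x y t \<le> 1"
      proof -
        have "0 \<le> (\<Sum>v\<in>?P. field v)" using sub field_nonneg by (intro sum_nonneg) auto
        then show ?thesis unfolding aw by simp
      qed
      moreover have "0 \<le> ?A" by simp
      ultimately show ?thesis by linarith
    qed
  qed
qed

text \<open>A chain has at least \<open>r\<close> links, each contributing at most
  \<open>exp (- 3)\<close>. Of this, \<open>exp (- 2)\<close> gives the decay
  \<open>exp (- 2 * r)\<close>, and \<open>exp (- 1)\<close> makes the sum over the lengths at most
  2.\<close>

lemma link_chains_sum_le:
  assumes deg: "\<And>z. card (nbrs z) \<le> D" and q: "0 \<le> q" "q < 1"
    and dist: "\<And>m c. c \<in> walks m x \<Longrightarrow> end_site x c = y \<Longrightarrow> r \<le> real m" and r: "0 \<le> r"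
    and small: "link_cost * (real D * (4 / (1 - q))) \<le> exp (- 3)"
  shows "(\<Sum>c\<in>link_chains x y. q ^ chain_cost N 0 c * link_cost ^ length c) \<le> 2 * exp (- 2 * r)"
proof -
  let ?f = "\<lambda>c. q ^ chain_cost N 0 c * link_cost ^ length c"
  let ?C = "\<lambda>m. {c \<in> walks m x. end_site x c = y}"
  have f: "0 \<le> ?f c" for c using q link_cost_pos by auto
  have "(\<Sum>c\<in>link_chains x y. ?f c) \<le> (\<Sum>c\<in>(\<Union>m\<le>card \<Lambda>. ?C m). ?f c)"
    using f by (intro sum_mono2) (auto simp: link_chains_def finite_walks)
  also have "\<dots> \<le> (\<Sum>m\<le>card \<Lambda>. \<Sum>c\<in>?C m. ?f c)"
  proof (subst sum.UNION_disjoint)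
    show "\<forall>i\<in>{..card \<Lambda>}. \<forall>j\<in>{..card \<Lambda>}. i \<noteq> j \<longrightarrow> ?C i \<inter> ?C j = {}"
      using walk_length by blast
  qed (auto simp: finite_walks)
  also have "\<dots> \<le> (\<Sum>m\<le>card \<Lambda>. exp (- 2 * r) * exp (- 1) ^ m)"
  proof (rule sum_mono)
    fix m
    show "(\<Sum>c\<in>?C m. ?f c) \<le> exp (- 2 * r) * exp (- 1) ^ m"
    proof (cases "?C m = {}")
      case True
      then show ?thesis by (simp only: sum.empty) simp
    next
      case False
      then have rm: "r \<le> real m" using dist by blast
      have "(\<Sum>c\<in>?C m. ?f c) \<le> (\<Sum>c\<in>walks m x. ?f c)"
        using f by (intro sum_mono2) (auto simp: finite_walks)
      also have "\<dots> = (\<Sum>c\<in>walks m x. q ^ chain_cost N 0 c) * link_cost ^ m"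
        by (simp add: sum_distrib_right walk_length)
      also have "\<dots> \<le> (real D * (4 / (1 - q))) ^ m * link_cost ^ m"
        using link_cost_pos by (intro mult_right_mono walks_sum_le deg q) auto
      also have "\<dots> = (link_cost * (real D * (4 / (1 - q)))) ^ m"
        by (metis power_mult_distrib mult.commute)
      also have "\<dots> \<le> exp (- 3) ^ m"
        using q link_cost_pos small by (intro power_mono) auto
      also have "\<dots> = exp (- 2 * real m) * exp (- 1) ^ m"
        by (simp add: exp_of_nat_mult[symmetric] exp_add[symmetric])
      also have "\<dots> \<le> exp (- 2 * r) * exp (- 1) ^ m"
        using rm by (intro mult_right_mono) auto
      finally show ?thesis .
    qed
  qed
  also have "\<dots> = exp (- 2 * r) * (\<Sum>m\<le>card \<Lambda>. exp (- 1) ^ m)"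
    by (simp add: sum_distrib_left)
  also have "\<dots> \<le> exp (- 2 * r) * 2"
  proof (intro mult_left_mono)
    have e: "exp (- 1 :: real) \<le> 1 / 2"
    proof -
      have "2 \<le> exp (1 :: real)" using exp_ge_add_one_self[of 1] by simp
      then show ?thesis by (simp add: exp_minus field_simps)
    qed
    have "(\<Sum>m\<le>card \<Lambda>. exp (- 1 :: real) ^ m) \<le> 1 / (1 - exp (- 1))"
      using sum_power_inj_le[of "{..card \<Lambda>}" "\<lambda>m. m" "exp (- 1 :: real)"] e by auto
    also have "\<dots> \<le> 2" using e by (simp add: field_simps)
    finally show "(\<Sum>m\<le>card \<Lambda>. exp (- 1 :: real) ^ m) \<le> 2" .
  qed simp
  finally show ?thesis by simp
qed

text \<open>One step of a chain costs at most \<open>8 * 4 * 2\<close> times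
  \<open>(n + 1) ^ 4 * D / \<mu>\<close>: the time step cancels, and \<open>large\<close> makes this
  at most \<open>exp (- 3)\<close>. The factor \<open>exp r\<close> of the Chebyshev bound uses up
  half of the decay \<open>exp (- 2 * r)\<close>.\<close>

lemma arc_weight_sum_le:
  assumes x: "x \<in> \<Lambda>" and t: "t \<in> {0, N}" and \<mu>: "0 < \<mu>" "\<mu> * \<delta> \<le> 1"
    and deg: "\<And>z. card (nbrs z) \<le> D"
    and dist: "\<And>m c. c \<in> walks m x \<Longrightarrow> end_site x c = y \<Longrightarrow> r \<le> real m" and r: "0 \<le> r"
    and large: "64 * real ((n + 1) ^ 4) * real D * exp 3 \<le> \<mu>"
  shows "(\<Sum>\<omega>\<in>words. word_weight \<omega> * (arc_weight \<omega> x y t * loop_weight \<omega>))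
    \<le> (exp (- (\<alpha> / (4 * \<mu>)) * r) + 2 * exp (- r)) * partition_fun"
proof -
  let ?q = "exp (- \<mu> * \<delta>)" and ?A = "exp (- (\<alpha> / (4 * \<mu>)) * r)"
  let ?w = "\<lambda>\<omega>. word_weight \<omega> * loop_weight \<omega>"
  have w: "0 \<le> ?w \<omega>" for \<omega> by (intro mult_nonneg_nonneg word_weight_nonneg loop_weight_nonneg)
  have ld: "0 < \<mu> * \<delta>" using \<mu> delta_pos by simp
  have q: "0 \<le> ?q" "?q < 1" using ld by auto
  \<comment> \<open>With s = \<mu> \<delta>: \<open>exp (- s) \<le> 1 / (1 + s)\<close>, which is at
    most \<open>1 - s / 2\<close> for s between 0 and 1.\<close>
  have half: "\<mu> * \<delta> / 2 \<le> 1 - ?q"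
  proof -
    have "exp (\<mu> * \<delta>) \<ge> 1 + \<mu> * \<delta>" by simp
    then have "?q \<le> 1 / (1 + \<mu> * \<delta>)" using ld by (simp add: exp_minus field_simps)
    also have "\<dots> \<le> 1 - \<mu> * \<delta> / 2"
    proof -
      have "0 \<le> (\<mu> * \<delta>) * (1 - \<mu> * \<delta>)" using ld \<mu> delta_pos by (intro mult_nonneg_nonneg) auto
      then have "1 \<le> (1 - \<mu> * \<delta> / 2) * (1 + \<mu> * \<delta>)" by (simp add: algebra_simps)
      then show ?thesis using ld by (simp add: pos_divide_le_eq)
    qed
    finally show ?thesis by simp
  qed
  have small: "link_cost * (real D * (4 / (1 - ?q))) \<le> exp (- 3)"
  proof -
    let ?k = "real ((n + 1) ^ 4) * real D"
    have "link_cost * (real D * (4 / (1 - ?q))) = 32 * ?k * \<delta> / (1 - ?q)"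
      by (simp add: link_cost_def)
    also have "\<dots> \<le> 32 * ?k * \<delta> / (\<mu> * \<delta> / 2)"
      using half ld q delta_pos by (intro divide_left_mono mult_pos_pos) auto
    also have "\<dots> = 64 * ?k / \<mu>" using delta_pos by simp
    also have "\<dots> \<le> exp (- 3)"
    proof -
      have "64 * ?k = (64 * ?k * exp 3) * exp (- 3)" by (simp add: exp_minus)
      also have "\<dots> \<le> \<mu> * exp (- 3)" using large by (intro mult_right_mono) (auto simp: mult_ac)
      finally show ?thesis using \<mu> by (simp add: pos_divide_le_eq mult_ac)
    qed
    finally show ?thesis .
  qed
  have "(\<Sum>\<omega>\<in>words. word_weight \<omega> * (arc_weight \<omega> x y t * loop_weight \<omega>)) = (\<Sum>\<omega>\<in>words. arc_weight \<omega> x y t * ?w \<omega>)"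
    by (simp add: mult_ac)
  also have "\<dots> \<le> (\<Sum>\<omega>\<in>words. (?A + exp r * (\<Sum>c\<in>link_chains x y. of_bool (linked \<omega> x c) * ?q ^ chain_cost N 0 c)) * ?w \<omega>)"
    using arc_weight_le[OF _ x t \<mu>(1) r] w by (intro sum_mono mult_right_mono) auto
  also have "\<dots> = ?A * partition_fun
      + exp r * (\<Sum>\<omega>\<in>words. \<Sum>c\<in>link_chains x y. ?q ^ chain_cost N 0 c * (of_bool (linked \<omega> x c) * ?w \<omega>))"
    by (simp add: partition_fun_def sum.distrib sum_distrib_left sum_distrib_right algebra_simps)
  also have "(\<Sum>\<omega>\<in>words. \<Sum>c\<in>link_chains x y. ?q ^ chain_cost N 0 c * (of_bool (linked \<omega> x c) * ?w \<omega>))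
      = (\<Sum>c\<in>link_chains x y. ?q ^ chain_cost N 0 c * (\<Sum>\<omega>\<in>words. of_bool (linked \<omega> x c) * ?w \<omega>))"
    by (subst sum.swap) (simp add: sum_distrib_left)
  also have "\<dots> \<le> (\<Sum>c\<in>link_chains x y. ?q ^ chain_cost N 0 c * (link_cost ^ length c * partition_fun))"
  proof (intro sum_mono mult_left_mono)
    fix c assume "c \<in> link_chains x y"
    then have "distinct (x # map snd c)" by (simp add: link_chains_def)
    from linked_sum_le[OF this]
    show "(\<Sum>\<omega>\<in>words. of_bool (linked \<omega> x c) * ?w \<omega>) \<le> link_cost ^ length c * partition_fun"
      by (simp add: of_bool_def if_distrib if_distribR sum.inter_filter[OF finite_words] cong: if_cong)
  qed auto
  also have "\<dots> = (\<Sum>c\<in>link_chains x y. ?q ^ chain_cost N 0 c * link_cost ^ length c) * partition_fun"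
    by (simp add: sum_distrib_right sum_distrib_left mult_ac)
  also have "\<dots> \<le> (2 * exp (- 2 * r)) * partition_fun"
    by (intro mult_right_mono link_chains_sum_le[OF deg q dist r small] partition_fun_nonneg)
  finally have "(\<Sum>\<omega>\<in>words. word_weight \<omega> * (arc_weight \<omega> x y t * loop_weight \<omega>))
      \<le> ?A * partition_fun + exp r * (2 * exp (- 2 * r) * partition_fun)"
    by simp
  also have "exp r * (2 * exp (- 2 * r) * partition_fun) = 2 * exp (- r) * partition_fun"
    by (simp add: exp_add[symmetric] mult.assoc[symmetric])
  finally show ?thesis by (simp add: distrib_right)
qed

text \<open>For two spin operators at the same site there is a single opening; no decay is required,
  and recolouring its two ends alike suffices.\<close>

lemma wsum_open_one_le:
  assumes "\<omega> \<in> words" "x \<in> \<Lambda>"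
  shows "wsum n points field (word_graph \<omega> \<union> closing {x}) \<le> real ((n + 1)\<^sup>2) * loop_weight \<omega>"
proof -
  have "insert ((0, x), (N, x)) (word_graph \<omega> \<union> closing {x}) = word_graph \<omega> \<union> closing {}"
    using assms(2) by (auto simp: closing_def)
  then show ?thesis
    using wsum_insert[OF finite_points word_graph_points[OF assms(1)], of "(0, x)" "(N, x)" field n "{x}"]
      field_nonneg assms(2) by (auto simp: loop_weight_def points_def)
qed

end

section \<open>Expansion of traces\<close>

lemma curry_in_configs:
  assumes "s \<in> colorings n ({..N} \<times> \<Lambda>)" "t \<le> N"
  shows "curry s t \<in> configs n \<Lambda>"
  using assms by (auto simp: colorings_def configs_def)

text \<open>A colouring of space-time is a path of configurations, one per layer. The kernel
  \<open>Y\<close> is arbitrary because the induction absorbs the last step into it.\<close>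

lemma path_expansion:
  fixes Y A :: op
  assumes fin: "finite \<Lambda>"
  shows "(\<Sum>\<sigma>\<in>configs n \<Lambda>. \<Sum>\<tau>\<in>configs n \<Lambda>. Y \<sigma> \<tau> * op_pow (configs n \<Lambda>) A N \<sigma> \<tau>)
    = (\<Sum>s\<in>colorings n ({..N} \<times> \<Lambda>). Y (curry s 0) (curry s N) * (\<Prod>t<N. A (curry s t) (curry s (Suc t))))"
proof (induction N arbitrary: Y)
  case 0
  let ?C = "configs n \<Lambda>"
  have finC: "finite ?C" using fin by (simp add: configs_eq_colorings finite_colorings)
  have "(\<Sum>\<sigma>\<in>?C. \<Sum>\<tau>\<in>?C. Y \<sigma> \<tau> * op_pow ?C A 0 \<sigma> \<tau>) = (\<Sum>\<sigma>\<in>?C. \<Sum>\<tau>\<in>?C. if \<sigma> = \<tau> then Y \<sigma> \<tau> else 0)"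
    by (intro sum.cong refl) (simp add: op_id_def)
  also have "\<dots> = (\<Sum>\<sigma>\<in>?C. Y \<sigma> \<sigma>)"
    using finC by simp
  also have "\<dots> = (\<Sum>s\<in>colorings n ({..0::nat} \<times> \<Lambda>). Y (curry s 0) (curry s 0))"
    by (rule sum.reindex_bij_witness[of _ "\<lambda>s. curry s 0" "\<lambda>\<sigma> (t, z). if t = 0 then \<sigma> z else 0"])
      (auto simp: colorings_def configs_def fun_eq_iff curry_def)
  finally show ?case by (simp only: lessThan_0 prod.empty mult_1_right)
next
  case (Suc N)
  let ?C = "configs n \<Lambda>"
  let ?P = "\<lambda>s. \<Prod>t<N. A (curry s t) (curry s (Suc t))"
  have finC: "finite ?C" using fin by (simp add: configs_eq_colorings finite_colorings)
  have finP: "finite (colorings n ({..N} \<times> \<Lambda>))" using fin by (simp add: finite_colorings)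
  have "(\<Sum>\<sigma>\<in>?C. \<Sum>\<tau>\<in>?C. Y \<sigma> \<tau> * op_pow ?C A (Suc N) \<sigma> \<tau>)
      = (\<Sum>\<sigma>\<in>?C. \<Sum>\<tau>\<in>?C. \<Sum>\<rho>\<in>?C. Y \<sigma> \<tau> * A \<rho> \<tau> * op_pow ?C A N \<sigma> \<rho>)"
    using op_pow_Suc_right[OF finC, of _ _ A N]
    by (intro sum.cong refl) (simp add: op_mult_def sum_distrib_left mult_ac del: op_pow.simps)
  also have "\<dots> = (\<Sum>\<sigma>\<in>?C. \<Sum>\<rho>\<in>?C. (\<Sum>\<tau>\<in>?C. Y \<sigma> \<tau> * A \<rho> \<tau>) * op_pow ?C A N \<sigma> \<rho>)"
    by (rule sum.cong[OF refl], subst sum.swap) (simp add: sum_distrib_right)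
  also have "\<dots> = (\<Sum>s\<in>colorings n ({..N} \<times> \<Lambda>). (\<Sum>\<tau>\<in>?C. Y (curry s 0) \<tau> * A (curry s N) \<tau>) * ?P s)"
    by (rule Suc.IH)
  also have "\<dots> = (\<Sum>(s, \<tau>)\<in>colorings n ({..N} \<times> \<Lambda>) \<times> ?C. Y (curry s 0) \<tau> * (?P s * A (curry s N) \<tau>))"
    by (subst sum.cartesian_product[symmetric]) (simp add: sum_distrib_right sum_distrib_left mult_ac)
  also have "\<dots> = (\<Sum>s\<in>colorings n ({..Suc N} \<times> \<Lambda>). Y (curry s 0) (curry s (Suc N)) * (?P s * A (curry s N) (curry s (Suc N))))"
  proof (rule sum.reindex_bij_witness[of _
        "\<lambda>s. (\<lambda>(t, z). if t \<le> N then s (t, z) else 0, curry s (Suc N))"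
        "\<lambda>(s, \<tau>) (t, z). if t = Suc N then \<tau> z else s (t, z)"], goal_cases)
    case (1 a)
    then show ?case by (auto simp: colorings_def fun_eq_iff curry_def)
  next
    case (2 a)
    then show ?case by (auto simp: colorings_def configs_def)
  next
    case (3 s)
    then show ?case by (auto simp: colorings_def fun_eq_iff le_Suc_eq)
  next
    case (4 s)
    then show ?case by (auto simp: colorings_def configs_def)
  next
    case (5 a)
    have c: "curry (\<lambda>(t, z). if t = Suc N then snd a z else fst a (t, z)) t
        = (if t = Suc N then snd a else curry (fst a) t)" for t
      by (auto simp: fun_eq_iff curry_def)
    then show ?case by (simp add: case_prod_unfold)
  qed
  finally show ?case by (simp only: prod.lessThan_Suc)
qed

section \<open>One time step as a sum over slots\<close>

definition swap_compat :: "site set \<Rightarrow> site \<Rightarrow> site \<Rightarrow> config \<Rightarrow> config \<Rightarrow> bool" where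
  "swap_compat \<Lambda> x y \<sigma> \<tau> \<longleftrightarrow> \<sigma> x = \<tau> y \<and> \<sigma> y = \<tau> x \<and> (\<forall>z\<in>\<Lambda> - {x, y}. \<sigma> z = \<tau> z)"

definition pair_compat :: "site set \<Rightarrow> site \<Rightarrow> site \<Rightarrow> config \<Rightarrow> config \<Rightarrow> bool" where
  "pair_compat \<Lambda> x y \<sigma> \<tau> \<longleftrightarrow> \<sigma> x = \<sigma> y \<and> \<tau> x = \<tau> y \<and> (\<forall>z\<in>\<Lambda> - {x, y}. \<sigma> z = \<tau> z)"

definition link_sum :: "site set \<Rightarrow> (site \<times> site) set \<Rightarrow> real \<Rightarrow> config \<Rightarrow> config \<Rightarrow> real" where
  "link_sum \<Lambda> E u \<sigma> \<tau> = (\<Sum>(x, y)\<in>E. u * of_bool (swap_compat \<Lambda> x y \<sigma> \<tau>) + (1 - u) * of_bool (pair_compat \<Lambda> x y \<sigma> \<tau>))"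

definition field_energy :: "nat \<Rightarrow> site set \<Rightarrow> (site \<Rightarrow> real) \<Rightarrow> config \<Rightarrow> real" where
  "field_energy n \<Lambda> h \<sigma> = (\<Sum>z\<in>\<Lambda>. h z * spin_val n (\<sigma> z))"

text \<open>One time step of length \<open>\<delta>\<close>. The field is split symmetrically so that every
  space-time point, including those of the first and last time layer, carries a field.\<close>

definition step_elem :: "nat \<Rightarrow> site set \<Rightarrow> (site \<times> site) set \<Rightarrow> real \<Rightarrow> (site \<Rightarrow> real) \<Rightarrow> real \<Rightarrow> config \<Rightarrow> config \<Rightarrow> real" where
  "step_elem n \<Lambda> E u h \<delta> \<sigma> \<tau> = (of_bool (\<sigma> = \<tau>) * (1 - \<delta> * card E) + \<delta> * link_sum \<Lambda> E u \<sigma> \<tau>)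
     * exp (\<delta> * ((field_energy n \<Lambda> h \<sigma> + field_energy n \<Lambda> h \<tau>) / 2))"

text \<open>Inner layers belong to two steps, the first and the last to one; this is the origin of
  the indicators in \<open>field\<close>.\<close>

lemma sum_consecutive:
  fixes f :: "nat \<Rightarrow> real"
  shows "(\<Sum>t<N. f t + f (Suc t)) = (\<Sum>t\<le>N. (of_bool (t < N) + of_bool (0 < t)) * f t)"
proof -
  have "(\<Sum>t\<le>N. of_bool (t < N) * f t) = (\<Sum>t<N. f t)"
    by (subst lessThan_Suc_atMost[symmetric]) simp
  moreover have "(\<Sum>t\<le>N. of_bool (0 < t) * f t) = (\<Sum>t<N. f (Suc t))"
    by (subst sum.atMost_shift) simp
  ultimately show ?thesis by (simp add: sum.distrib distrib_right)
qed

lemma prod_of_bool: "finite A \<Longrightarrow> (\<Prod>t\<in>A. of_bool (P t)) = (of_bool (\<forall>t\<in>A. P t) :: real)"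
  by (induction A rule: finite_induct) auto

context loop_model
begin

fun slot_compat :: "slot \<Rightarrow> config \<Rightarrow> config \<Rightarrow> bool" where
  "slot_compat None \<sigma> \<tau> \<longleftrightarrow> (\<forall>z\<in>\<Lambda>. \<sigma> z = \<tau> z)"
| "slot_compat (Some ((x, y), b)) \<sigma> \<tau> \<longleftrightarrow> (if b then swap_compat \<Lambda> x y \<sigma> \<tau> else pair_compat \<Lambda> x y \<sigma> \<tau>)"

lemma slot_compat_iff:
  "slot_compat sl (curry s t) (curry s (Suc t)) \<longleftrightarrow> (\<forall>(p, q)\<in>slot_graph sl t. s p = s q)"
proof (cases sl)
  case None
  then show ?thesis by auto
next
  case (Some a)
  then obtain x y b where "sl = Some ((x, y), b)" by (cases a) auto
  then show ?thesis by (cases b) (auto simp: swap_compat_def pair_compat_def)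
qed

lemma step_elem_slots:
  assumes "\<sigma> \<in> configs n \<Lambda>" "\<tau> \<in> configs n \<Lambda>"
  shows "step_elem n \<Lambda> E u h \<delta> \<sigma> \<tau> = (\<Sum>sl\<in>slots. slot_weight sl * of_bool (slot_compat sl \<sigma> \<tau>))
     * exp (\<delta> * ((field_energy n \<Lambda> h \<sigma> + field_energy n \<Lambda> h \<tau>) / 2))"
proof -
  have eq: "(\<forall>z\<in>\<Lambda>. \<sigma> z = \<tau> z) \<longleftrightarrow> \<sigma> = \<tau>"
    using assms by (auto simp: configs_def fun_eq_iff)
  have "(\<Sum>sl\<in>Some ` (E \<times> UNIV). slot_weight sl * of_bool (slot_compat sl \<sigma> \<tau>))
      = (\<Sum>p\<in>E \<times> UNIV. slot_weight (Some p) * of_bool (slot_compat (Some p) \<sigma> \<tau>))"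
    by (subst sum.reindex) (auto simp: inj_on_def)
  also have "\<dots> = (\<Sum>e\<in>E. \<Sum>b\<in>UNIV. slot_weight (Some (e, b)) * of_bool (slot_compat (Some (e, b)) \<sigma> \<tau>))"
    by (subst sum.cartesian_product, rule sum.cong) auto
  also have "\<dots> = \<delta> * link_sum \<Lambda> E u \<sigma> \<tau>"
    unfolding link_sum_def sum_distrib_left
    by (intro sum.cong refl) (auto simp: UNIV_bool algebra_simps)
  finally have "(\<Sum>sl\<in>slots. slot_weight sl * of_bool (slot_compat sl \<sigma> \<tau>))
      = of_bool (\<sigma> = \<tau>) * (1 - \<delta> * card E) + \<delta> * link_sum \<Lambda> E u \<sigma> \<tau>"
    unfolding slots_def by (subst sum.insert) (auto simp: finite_edges eq)
  then show ?thesis by (simp add: step_elem_def)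
qed

lemma step_fields:
  "(\<Prod>t<N. exp (\<delta> * ((field_energy n \<Lambda> h (curry s t) + field_energy n \<Lambda> h (curry s (Suc t))) / 2)))
    = field_weight n points field s"
proof -
  let ?f = "\<lambda>t. \<delta> / 2 * field_energy n \<Lambda> h (curry s t)"
  have "(\<Sum>t<N. \<delta> * ((field_energy n \<Lambda> h (curry s t) + field_energy n \<Lambda> h (curry s (Suc t))) / 2))
      = (\<Sum>t<N. ?f t + ?f (Suc t))"
    by (intro sum.cong refl) (simp add: field_simps)
  also have "\<dots> = (\<Sum>t\<le>N. (of_bool (t < N) + of_bool (0 < t)) * ?f t)"
    by (rule sum_consecutive)
  also have "\<dots> = (\<Sum>t\<le>N. \<Sum>z\<in>\<Lambda>. field (t, z) * spin_val n (s (t, z)))"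
    unfolding field_energy_def sum_distrib_left
    by (intro sum.cong refl) (simp add: field_def mult_ac)
  also have "\<dots> = (\<Sum>v\<in>points. field v * spin_val n (s v))"
    unfolding points_def by (subst sum.cartesian_product) (simp add: case_prod_unfold)
  finally have eq: "(\<Sum>t<N. \<delta> * ((field_energy n \<Lambda> h (curry s t) + field_energy n \<Lambda> h (curry s (Suc t))) / 2))
      = (\<Sum>v\<in>points. field v * spin_val n (s v))" .
  show ?thesis by (simp only: field_weight_def eq[symmetric] exp_sum[OF finite_lessThan])
qed

text \<open>Multiplying out the product over the steps chooses a slot for each, that is, a word; its
  slots are all compatible with the path exactly if \<open>s\<close> colours the word graph.\<close>

lemma step_prod:
  assumes "s \<in> colorings n points"
  shows "(\<Prod>t<N. step_elem n \<Lambda> E u h \<delta> (curry s t) (curry s (Suc t)))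
    = (\<Sum>\<omega>\<in>words. word_weight \<omega> * (of_bool (s \<in> cols n points (word_graph \<omega>)) * field_weight n points field s))"
proof -
  let ?K = "\<lambda>t sl. slot_compat sl (curry s t) (curry s (Suc t))"
  have "(\<Prod>t<N. step_elem n \<Lambda> E u h \<delta> (curry s t) (curry s (Suc t)))
      = (\<Prod>t<N. (\<Sum>sl\<in>slots. slot_weight sl * of_bool (?K t sl))
          * exp (\<delta> * ((field_energy n \<Lambda> h (curry s t) + field_energy n \<Lambda> h (curry s (Suc t))) / 2)))"
    using assms by (intro prod.cong refl step_elem_slots curry_in_configs[of s n N]) (auto simp: points_def)
  also have "\<dots> = (\<Prod>t<N. \<Sum>sl\<in>slots. slot_weight sl * of_bool (?K t sl)) * field_weight n points field s"
    by (simp only: prod.distrib step_fields)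
  also have "(\<Prod>t<N. \<Sum>sl\<in>slots. slot_weight sl * of_bool (?K t sl))
      = (\<Sum>\<omega>\<in>words. \<Prod>t<N. slot_weight (\<omega> t) * of_bool (?K t (\<omega> t)))"
    unfolding words_def by (rule prod_sum_PiE) (auto simp: finite_slots)
  also have "\<dots> = (\<Sum>\<omega>\<in>words. word_weight \<omega> * of_bool (s \<in> cols n points (word_graph \<omega>)))"
  proof (intro sum.cong refl)
    fix \<omega>
    have eq: "(\<forall>t\<in>{..<N}. ?K t (\<omega> t)) \<longleftrightarrow> s \<in> cols n points (word_graph \<omega>)"
      using assms unfolding cols_def word_graph_def slot_compat_iff by blast
    show "(\<Prod>t<N. slot_weight (\<omega> t) * of_bool (?K t (\<omega> t))) = word_weight \<omega> * of_bool (s \<in> cols n points (word_graph \<omega>))"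
      by (simp only: prod.distrib prod_of_bool[OF finite_lessThan] word_weight_def eq)
  qed
  finally show ?thesis by (simp only: sum_distrib_right mult.assoc)
qed

text \<open>The Gibbs weight leads from layer 0 to layer \<open>N\<close> and the inserted operator
  back from \<open>N\<close> to 0; hence the order of its arguments.\<close>

definition expansion :: "(config \<Rightarrow> config \<Rightarrow> real) \<Rightarrow> real" where
  "expansion X = (\<Sum>\<omega>\<in>words. word_weight \<omega> *
     (\<Sum>s\<in>cols n points (word_graph \<omega>). X (curry s N) (curry s 0) * field_weight n points field s))"

lemma trace_expansion:
  "op_trace (configs n \<Lambda>) (op_mult (configs n \<Lambda>) (\<lambda>\<sigma> \<tau>. of_real (X \<sigma> \<tau>))
      (op_pow (configs n \<Lambda>) (\<lambda>\<sigma> \<tau>. of_real (step_elem n \<Lambda> E u h \<delta> \<sigma> \<tau>)) N))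
    = of_real (expansion X)"
proof -
  let ?C = "configs n \<Lambda>" and ?A = "\<lambda>\<sigma> \<tau>. of_real (step_elem n \<Lambda> E u h \<delta> \<sigma> \<tau>) :: complex"
  have "op_trace ?C (op_mult ?C (\<lambda>\<sigma> \<tau>. of_real (X \<sigma> \<tau>)) (op_pow ?C ?A N))
      = (\<Sum>\<sigma>\<in>?C. \<Sum>\<tau>\<in>?C. of_real (X \<tau> \<sigma>) * op_pow ?C ?A N \<sigma> \<tau>)"
    unfolding op_trace_def op_mult_def by (rule sum.swap)
  also have "\<dots> = (\<Sum>s\<in>colorings n points. of_real (X (curry s N) (curry s 0)) * (\<Prod>t<N. ?A (curry s t) (curry s (Suc t))))"
    unfolding points_def by (rule path_expansion[OF finite_sites])
  also have "\<dots> = of_real (\<Sum>s\<in>colorings n points. X (curry s N) (curry s 0) *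
      (\<Prod>t<N. step_elem n \<Lambda> E u h \<delta> (curry s t) (curry s (Suc t))))"
    by simp
  also have "(\<Sum>s\<in>colorings n points. X (curry s N) (curry s 0) *
      (\<Prod>t<N. step_elem n \<Lambda> E u h \<delta> (curry s t) (curry s (Suc t))))
    = (\<Sum>s\<in>colorings n points. \<Sum>\<omega>\<in>words. word_weight \<omega> *
        (of_bool (s \<in> cols n points (word_graph \<omega>)) * (X (curry s N) (curry s 0) * field_weight n points field s)))"
    by (intro sum.cong refl) (simp add: step_prod sum_distrib_left mult_ac)
  also have "\<dots> = (\<Sum>\<omega>\<in>words. \<Sum>s\<in>colorings n points. word_weight \<omega> *
        (of_bool (s \<in> cols n points (word_graph \<omega>)) * (X (curry s N) (curry s 0) * field_weight n points field s)))"
    by (rule sum.swap)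
  also have "\<dots> = expansion X"
    unfolding expansion_def
  proof (intro sum.cong refl)
    fix \<omega>
    let ?g = "\<lambda>s. X (curry s N) (curry s 0) * field_weight n points field s"
    have "(\<Sum>s\<in>cols n points (word_graph \<omega>). ?g s)
        = (\<Sum>s\<in>colorings n points. of_bool (s \<in> cols n points (word_graph \<omega>)) * ?g s)"
      by (rule sum.mono_neutral_cong_left) (auto simp: finite_colorings finite_points cols_def)
    then show "(\<Sum>s\<in>colorings n points. word_weight \<omega> * (of_bool (s \<in> cols n points (word_graph \<omega>)) * ?g s))
        = word_weight \<omega> * (\<Sum>s\<in>cols n points (word_graph \<omega>). ?g s)"
      by (simp add: sum_distrib_left)
  qed
  finally show ?thesis .
qed

lemma cols_closing:
  "s \<in> cols n points (word_graph \<omega> \<union> closing I) \<longleftrightarrow>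
    s \<in> cols n points (word_graph \<omega>) \<and> (\<forall>z\<in>\<Lambda> - I. curry s N z = curry s 0 z)"
proof -
  have "(\<forall>(p, q)\<in>closing I. s p = s q) \<longleftrightarrow> (\<forall>z\<in>\<Lambda> - I. s (0, z) = s (N, z))"
    by (auto simp: closing_def)
  then show ?thesis unfolding cols_def by (auto simp: ball_Un)
qed

lemma expansion_mono_sets:
  assumes "\<And>\<omega>. S \<omega> = {s \<in> cols n points (word_graph \<omega>). R (curry s N) (curry s 0)}"
    and "\<And>\<sigma> \<tau>. \<sigma> \<in> configs n \<Lambda> \<Longrightarrow> \<tau> \<in> configs n \<Lambda> \<Longrightarrow> X \<sigma> \<tau> \<le> K * of_bool (R \<sigma> \<tau>)"
  shows "expansion X \<le> K * (\<Sum>\<omega>\<in>words. word_weight \<omega> * (\<Sum>s\<in>S \<omega>. field_weight n points field s))"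
proof -
  have "expansion X \<le> (\<Sum>\<omega>\<in>words. word_weight \<omega> * (K * (\<Sum>s\<in>S \<omega>. field_weight n points field s)))"
    unfolding expansion_def
  proof (intro sum_mono mult_left_mono word_weight_nonneg)
    fix \<omega>
    have "(\<Sum>s\<in>cols n points (word_graph \<omega>). X (curry s N) (curry s 0) * field_weight n points field s)
        \<le> (\<Sum>s\<in>cols n points (word_graph \<omega>). (K * of_bool (R (curry s N) (curry s 0))) * field_weight n points field s)"
      using field_weight_pos[of n points field]
      by (intro sum_mono mult_right_mono assms(2) curry_in_configs[of _ n N])
        (auto simp: cols_def points_def intro: less_imp_le)
    also have "\<dots> = K * (\<Sum>s\<in>S \<omega>. field_weight n points field s)"
      unfolding assms(1) sum_distrib_left
      by (rule sum.mono_neutral_cong_right) (auto simp: finite_cols finite_points)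
    finally show "(\<Sum>s\<in>cols n points (word_graph \<omega>). X (curry s N) (curry s 0) * field_weight n points field s)
        \<le> K * (\<Sum>s\<in>S \<omega>. field_weight n points field s)" .
  qed
  then show ?thesis by (simp add: sum_distrib_left mult_ac)
qed

lemma expansion_id: "expansion (\<lambda>\<sigma> \<tau>. of_bool (\<sigma> = \<tau>)) = partition_fun"
  unfolding expansion_def partition_fun_def loop_weight_def wsum_def
proof (rule sum.cong[OF refl], rule arg_cong2[where f = times, OF refl])
  fix \<omega>
  have "s \<in> cols n points (word_graph \<omega> \<union> closing {}) \<longleftrightarrow>
      s \<in> cols n points (word_graph \<omega>) \<and> curry s N = curry s 0" for s
    unfolding cols_closing by (auto simp: cols_def colorings_def points_def fun_eq_iff)
  then show "(\<Sum>s\<in>cols n points (word_graph \<omega>). of_bool (curry s N = curry s 0) * field_weight n points field s)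
      = (\<Sum>s\<in>cols n points (word_graph \<omega> \<union> closing {}). field_weight n points field s)"
    by (intro sum.mono_neutral_cong_right) (auto simp: finite_cols finite_points)
qed

lemma expansion_one_le:
  assumes "x \<in> \<Lambda>" "0 \<le> K"
    and "\<And>\<sigma> \<tau>. \<sigma> \<in> configs n \<Lambda> \<Longrightarrow> \<tau> \<in> configs n \<Lambda> \<Longrightarrow> X \<sigma> \<tau> \<le> K * of_bool (\<forall>z\<in>\<Lambda> - {x}. \<sigma> z = \<tau> z)"
  shows "expansion X \<le> K * real ((n + 1)\<^sup>2) * partition_fun"
proof -
  have "expansion X \<le> K * (\<Sum>\<omega>\<in>words. word_weight \<omega> * wsum n points field (word_graph \<omega> \<union> closing {x}))"
    unfolding wsum_def
    by (rule expansion_mono_sets[where R = "\<lambda>\<sigma> \<tau>. \<forall>z\<in>\<Lambda> - {x}. \<sigma> z = \<tau> z"]) (use assms(3) cols_closing in blast)+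
  also have "\<dots> \<le> K * (\<Sum>\<omega>\<in>words. word_weight \<omega> * (real ((n + 1)\<^sup>2) * loop_weight \<omega>))"
    using assms by (intro mult_left_mono sum_mono wsum_open_one_le word_weight_nonneg)
  also have "\<dots> = K * real ((n + 1)\<^sup>2) * partition_fun"
    by (simp add: partition_fun_def sum_distrib_left mult_ac)
  finally show ?thesis .
qed

text \<open>\<open>X\<close> stands for a product of S^1 at two different sites, whose entries
  vanish unless both spins change by one. The factor 2 comes from the two possible layers of the
  lower end.\<close>

lemma expansion_two_le:
  assumes xy: "x \<in> \<Lambda>" "y \<in> \<Lambda>" "x \<noteq> y" and K: "0 \<le> K"
    and X: "\<And>\<sigma> \<tau>. \<sigma> \<in> configs n \<Lambda> \<Longrightarrow> \<tau> \<in> configs n \<Lambda> \<Longrightarrow> X \<sigma> \<tau> \<le> K * of_bool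
      ((\<forall>z\<in>\<Lambda> - {x, y}. \<sigma> z = \<tau> z) \<and> (\<forall>z\<in>{x, y}. \<tau> z = \<sigma> z + 1 \<or> \<sigma> z = \<tau> z + 1))"
    and \<mu>: "0 < \<mu>" "\<mu> * \<delta> \<le> 1" and deg: "\<And>z. card (nbrs z) \<le> D"
    and dist: "\<And>m c. c \<in> walks m x \<Longrightarrow> end_site x c = y \<Longrightarrow> r \<le> real m" and r: "0 \<le> r"
    and large: "64 * real ((n + 1) ^ 4) * real D * exp 3 \<le> \<mu>"
  shows "expansion X \<le> 2 * K * (exp (- (\<alpha> / (4 * \<mu>)) * r) + 2 * exp (- r)) * partition_fun"
proof -
  let ?B = "(exp (- (\<alpha> / (4 * \<mu>)) * r) + 2 * exp (- r)) * partition_fun"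
  have "expansion X \<le> K * (\<Sum>\<omega>\<in>words. word_weight \<omega> * (\<Sum>s\<in>open_cols \<omega> x y. field_weight n points field s))"
    by (rule expansion_mono_sets[OF _ X]) (auto simp: open_cols_def cols_closing)
  also have "\<dots> \<le> K * (\<Sum>\<omega>\<in>words. word_weight \<omega> * ((arc_weight \<omega> x y 0 + arc_weight \<omega> x y N) * loop_weight \<omega>))"
    using K xy by (intro mult_left_mono sum_mono open_cols_sum_le word_weight_nonneg)
  also have "\<dots> = K * ((\<Sum>\<omega>\<in>words. word_weight \<omega> * (arc_weight \<omega> x y 0 * loop_weight \<omega>))
      + (\<Sum>\<omega>\<in>words. word_weight \<omega> * (arc_weight \<omega> x y N * loop_weight \<omega>)))"
    by (simp add: sum.distrib[symmetric] algebra_simps)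
  also have "\<dots> \<le> K * (?B + ?B)"
    using K arc_weight_sum_le[OF xy(1) _ \<mu> deg dist r large] by (intro mult_left_mono add_mono) auto
  finally show ?thesis by (simp add: algebra_simps)
qed

end

section \<open>Geometry of the box and matrix elements\<close>

text \<open>Applied to the l1 norm, which dominates the Euclidean one, this supplies the lower bound
  \<open>dist\<close> on the number of links.\<close>

lemma (in loop_model) walk_lipschitz:
  fixes f :: "site \<Rightarrow> real"
  assumes "\<And>z z'. (z, z') \<in> E \<Longrightarrow> \<bar>f z - f z'\<bar> \<le> 1" "c \<in> walks m z"
  shows "f (end_site z c) \<le> f z + real m"
  using assms(2)
proof (induction m arbitrary: z c)
  case (Suc m)
  then obtain t z' c' where c: "c = (t, z') # c'" "z' \<in> nbrs z" "c' \<in> walks m z'" by auto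
  have "f (end_site z' c') \<le> f z' + real m" by (rule Suc.IH[OF c(3)])
  moreover have "f z' \<le> f z + 1" using c(2) assms(1)[of z z'] assms(1)[of z' z] by (auto simp: nbrs_def)
  ultimately show ?case using c(1) by simp
qed auto

definition l1_norm :: "nat \<Rightarrow> site \<Rightarrow> real" where
  "l1_norm d x = (\<Sum>i<d. \<bar>real_of_int (x i)\<bar>)"

lemma site_norm_le_l1_norm: "site_norm d x \<le> l1_norm d x"
proof -
  have "(\<Sum>i<d. (real_of_int (x i))\<^sup>2) \<le> (l1_norm d x)\<^sup>2 \<and> 0 \<le> l1_norm d x"
  proof (induction d)
    case (Suc d)
    let ?a = "\<bar>real_of_int (x d)\<bar>"
    have "(\<Sum>i<Suc d. (real_of_int (x i))\<^sup>2) \<le> (l1_norm d x)\<^sup>2 + ?a\<^sup>2" using Suc by simp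
    also have "\<dots> \<le> (l1_norm d x)\<^sup>2 + ?a\<^sup>2 + 2 * l1_norm d x * ?a"
      using Suc by simp
    also have "\<dots> = (l1_norm (Suc d) x)\<^sup>2" by (simp add: l1_norm_def power2_sum)
    finally show ?case using Suc by (simp add: l1_norm_def)
  qed (simp add: l1_norm_def)
  then show ?thesis unfolding site_norm_def by (intro real_le_lsqrt) auto
qed

lemma site_norm_nonneg: "0 \<le> site_norm d x"
  by (simp add: site_norm_def sum_nonneg)

lemma l1_norm_edge: "(z, z') \<in> edges d L \<Longrightarrow> \<bar>l1_norm d z - l1_norm d z'\<bar> \<le> 1"
proof -
  assume "(z, z') \<in> edges d L"
  then obtain i where i: "i < d" "z' = z(i := z i + 1)" by (auto simp: edges_def)
  have "l1_norm d z - l1_norm d z' = (\<Sum>j<d. \<bar>real_of_int (z j)\<bar> - \<bar>real_of_int (z' j)\<bar>)"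
    by (simp add: l1_norm_def sum_subtractf)
  also have "\<dots> = (\<Sum>j<d. if j = i then \<bar>real_of_int (z i)\<bar> - \<bar>real_of_int (z i) + 1\<bar> else 0)"
    by (intro sum.cong refl) (simp add: i)
  also have "\<dots> = \<bar>real_of_int (z i)\<bar> - \<bar>real_of_int (z i) + 1\<bar>" using i(1) by simp
  finally show ?thesis by linarith
qed

lemma finite_box: "finite (box d L)"
proof -
  have "finite {x :: site. \<forall>i. (i \<in> {..<d} \<longrightarrow> x i \<in> {- (int L div 2)..int L div 2}) \<and> (i \<notin> {..<d} \<longrightarrow> x i = 0)}"
    by (intro finite_set_of_finite_funs) auto
  then show ?thesis by (rule rev_finite_subset) (auto simp: box_def)
qed

lemma origin_in_box: "origin \<in> box d L"
  by (simp add: box_def origin_def)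

lemma edges_box: "edges d L \<subseteq> box d L \<times> box d L"
  by (auto simp: edges_def)

lemma edges_neq: "(x, y) \<in> edges d L \<Longrightarrow> x \<noteq> y"
  by (auto simp: edges_def fun_eq_iff)

lemma card_neighbours: "card {z'. (z, z') \<in> edges d L \<or> (z', z) \<in> edges d L} \<le> 2 * d"
proof -
  let ?S = "(\<lambda>i. z(i := z i + 1)) ` {..<d} \<union> (\<lambda>i. z(i := z i - 1)) ` {..<d}"
  have "{z'. (z, z') \<in> edges d L \<or> (z', z) \<in> edges d L} \<subseteq> ?S"
  proof
    fix z' assume "z' \<in> {z'. (z, z') \<in> edges d L \<or> (z', z) \<in> edges d L}"
    then consider i where "i < d" "z' = z(i := z i + 1)" | i where "i < d" "z = z'(i := z' i + 1)"
      by (auto simp: edges_def)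
    then show "z' \<in> ?S"
    proof cases
      case 2
      then have "z' = z(i := z i - 1)" by simp
      then show ?thesis using 2(1) by blast
    qed auto
  qed
  then have "card {z'. (z, z') \<in> edges d L \<or> (z', z) \<in> edges d L} \<le> card ?S"
    by (intro card_mono) auto
  also have "\<dots> \<le> card ((\<lambda>i. z(i := z i + 1)) ` {..<d}) + card ((\<lambda>i. z(i := z i - 1)) ` {..<d})"
    by (rule card_Un_le)
  also have "\<dots> \<le> d + d"
    using card_image_le[of "{..<d}" "\<lambda>i. z(i := z i + 1)"] card_image_le[of "{..<d}" "\<lambda>i. z(i := z i - 1)"]
    by simp
  finally show ?thesis by simp
qed

text \<open>Moving one nonzero coordinate a unit towards 0 stays inside the box and lowers the l1
  norm.\<close>

lemma box_connected: "x \<in> box d L \<Longrightarrow> (origin, x) \<in> (edges d L \<union> (edges d L)\<inverse>)\<^sup>*"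
proof (induction "\<Sum>i<d. nat \<bar>x i\<bar>" arbitrary: x rule: less_induct)
  case less
  show ?case
  proof (cases "x = origin")
    case True
    then show ?thesis by simp
  next
    case False
    then obtain i where i: "i < d" "x i \<noteq> 0"
      using less.prems by (auto simp: box_def origin_def fun_eq_iff) (metis not_le)
    define x' where "x' = x(i := x i - sgn (x i))"
    have "(\<Sum>j<d. nat \<bar>x' j\<bar>) < (\<Sum>j<d. nat \<bar>x j\<bar>)"
      using i by (intro sum_strict_mono_ex1) (auto simp: x'_def sgn_if intro!: bexI[of _ i])
    moreover have x': "x' \<in> box d L"
      using less.prems i by (auto simp: x'_def box_def sgn_if)
    ultimately have "(origin, x') \<in> (edges d L \<union> (edges d L)\<inverse>)\<^sup>*" by (rule less.hyps)
    moreover have "(x', x) \<in> edges d L \<union> (edges d L)\<inverse>"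
    proof (cases "0 < x i")
      case True
      then have "x = x'(i := x' i + 1)" by (simp add: x'_def)
      then show ?thesis using x' less.prems i(1) by (auto simp: edges_def)
    next
      case False
      then have "x' = x(i := x i + 1)" using i(2) by (simp add: x'_def sgn_if)
      then show ?thesis using x' less.prems i(1) by (auto simp: edges_def)
    qed
    ultimately show ?thesis by (rule rtrancl_into_rtrancl)
  qed
qed

section \<open>Convergence of the discretised Gibbs weight\<close>

lemma configs_eqI:
  assumes "\<sigma> \<in> configs n \<Lambda>" "\<tau> \<in> configs n \<Lambda>" "\<And>z. z \<in> \<Lambda> \<Longrightarrow> \<sigma> z = \<tau> z"
  shows "\<sigma> = \<tau>"
proof
  fix z show "\<sigma> z = \<tau> z" using assms by (cases "z \<in> \<Lambda>") (auto simp: configs_def)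
qed

lemma transp_op_eq: "transp_op \<Lambda> x y \<sigma> \<tau> = of_real (of_bool (swap_compat \<Lambda> x y \<sigma> \<tau>))"
  by (simp add: transp_op_def swap_compat_def)

lemma Q_op_eq: "Q_op \<Lambda> x y \<sigma> \<tau> = of_real (of_bool (pair_compat \<Lambda> x y \<sigma> \<tau>))"
  by (simp add: Q_op_def pair_compat_def)

lemma op_id_eq: "op_id \<sigma> \<tau> = of_real (of_bool (\<sigma> = \<tau>))"
  by (simp add: op_id_def)

text \<open>The entries are real, and the -1 of each edge becomes \<open>- card (edges d L)\<close>
  on the diagonal. The factor of \<beta> is the derivative of \<open>step_elem\<close> at 0.\<close>

lemma hamiltonian_eq:
  assumes \<sigma>: "\<sigma> \<in> configs n (box d L)" and \<tau>: "\<tau> \<in> configs n (box d L)"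
  shows "- complex_of_real \<beta> * hamiltonian n d L u h \<sigma> \<tau> = of_real (\<beta> * (link_sum (box d L) (edges d L) u \<sigma> \<tau>
    + of_bool (\<sigma> = \<tau>) * (field_energy n (box d L) h \<sigma> - real (card (edges d L)))))"
proof -
  let ?\<Lambda> = "box d L" and ?E = "edges d L"
  have a: "(\<Sum>e\<in>?E. complex_of_real u * transp_op ?\<Lambda> (fst e) (snd e) \<sigma> \<tau>
          + complex_of_real (1 - u) * Q_op ?\<Lambda> (fst e) (snd e) \<sigma> \<tau> - op_id \<sigma> \<tau>)
      = of_real (link_sum ?\<Lambda> ?E u \<sigma> \<tau> - real (card ?E) * of_bool (\<sigma> = \<tau>))"
    unfolding link_sum_def transp_op_eq Q_op_eq op_id_eq
    by (simp add: sum_subtractf case_prod_unfold)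
  have b: "(\<Sum>x\<in>?\<Lambda>. complex_of_real (h x) * site_op ?\<Lambda> x (spin3 n) \<sigma> \<tau>)
      = of_real (of_bool (\<sigma> = \<tau>) * field_energy n ?\<Lambda> h \<sigma>)"
  proof -
    have "site_op ?\<Lambda> x (spin3 n) \<sigma> \<tau> = of_real (of_bool (\<sigma> = \<tau>) * spin_val n (\<sigma> x))" if "x \<in> ?\<Lambda>" for x
    proof (cases "\<sigma> = \<tau>")
      case False
      then have "\<not> (\<forall>y\<in>?\<Lambda>. \<sigma> y = \<tau> y)" using configs_eqI[OF \<sigma> \<tau>] by blast
      then show ?thesis using False by (auto simp: site_op_def spin3_def)
    qed (simp add: site_op_def spin3_def)
    then show ?thesis
      by (simp add: field_energy_def sum_distrib_left mult_ac)
  qed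
  show ?thesis
    unfolding hamiltonian_def a b by (simp add: algebra_simps)
qed

lemma step_elem_deriv:
  "((\<lambda>\<delta>. step_elem n \<Lambda> E u h \<delta> \<sigma> \<tau>) has_real_derivative
     (link_sum \<Lambda> E u \<sigma> \<tau> + of_bool (\<sigma> = \<tau>) * (field_energy n \<Lambda> h \<sigma> - real (card E)))) (at 0)"
  unfolding step_elem_def
  by (auto intro!: derivative_eq_intros simp: field_simps)

text \<open>The step operator is \<open>op_id + X N / N\<close>, where \<open>X N\<close> is \<beta>
  times a difference quotient of \<open>step_elem\<close> at 0 and so tends to -\<beta>H; Euler's
  limit applies.\<close>

lemma step_pow_tendsto:
  assumes \<sigma>: "\<sigma> \<in> configs n (box d L)" and \<tau>: "\<tau> \<in> configs n (box d L)" and \<beta>: "0 < \<beta>"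
  shows "(\<lambda>N. op_pow (configs n (box d L))
      (\<lambda>\<sigma> \<tau>. of_real (step_elem n (box d L) (edges d L) u h (\<beta> / real N) \<sigma> \<tau>)) N \<sigma> \<tau>)
    \<longlonglongrightarrow> op_exp (configs n (box d L)) (\<lambda>\<sigma> \<tau>. - complex_of_real \<beta> * hamiltonian n d L u h \<sigma> \<tau>) \<sigma> \<tau>"
proof -
  let ?C = "configs n (box d L)"
  let ?m = "\<lambda>\<delta> \<sigma> \<tau>. step_elem n (box d L) (edges d L) u h \<delta> \<sigma> \<tau>"
  define X where "X N \<sigma> \<tau> = (of_real (real N * (?m (\<beta> / real N) \<sigma> \<tau> - of_bool (\<sigma> = \<tau>))) :: complex)" for N \<sigma> \<tau>
  have "(\<lambda>N. X N \<sigma> \<tau>) \<longlonglongrightarrow> - complex_of_real \<beta> * hamiltonian n d L u h \<sigma> \<tau>"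
    if st: "\<sigma> \<in> ?C" "\<tau> \<in> ?C" for \<sigma> \<tau>
  proof -
    let ?D = "link_sum (box d L) (edges d L) u \<sigma> \<tau>
      + of_bool (\<sigma> = \<tau>) * (field_energy n (box d L) h \<sigma> - real (card (edges d L)))"
    have m0: "?m 0 \<sigma> \<tau> = of_bool (\<sigma> = \<tau>)" by (simp add: step_elem_def)
    have "((\<lambda>x. (?m x \<sigma> \<tau> - ?m 0 \<sigma> \<tau>) / x) \<longlongrightarrow> ?D) (at 0)"
      using step_elem_deriv[of n "box d L" "edges d L" u h \<sigma> \<tau>] by (simp add: has_field_derivative_iff)
    moreover have "filterlim (\<lambda>N. \<beta> / real N) (at 0) sequentially"
      using \<beta> lim_const_over_n[of \<beta>]
      by (auto simp: filterlim_at intro!: eventually_mono[OF eventually_gt_at_top[of 0]])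
    ultimately have "(\<lambda>N. (?m (\<beta> / real N) \<sigma> \<tau> - ?m 0 \<sigma> \<tau>) / (\<beta> / real N)) \<longlonglongrightarrow> ?D"
      by (rule filterlim_compose)
    then have "(\<lambda>N. complex_of_real (\<beta> * ((?m (\<beta> / real N) \<sigma> \<tau> - ?m 0 \<sigma> \<tau>) / (\<beta> / real N)))) \<longlonglongrightarrow> of_real (\<beta> * ?D)"
      by (intro tendsto_of_real tendsto_mult tendsto_const)
    moreover have "complex_of_real (\<beta> * ((?m (\<beta> / real N) \<sigma> \<tau> - ?m 0 \<sigma> \<tau>) / (\<beta> / real N))) = X N \<sigma> \<tau>" for N
      using \<beta> by (simp add: X_def m0)
    ultimately have "(\<lambda>N. X N \<sigma> \<tau>) \<longlonglongrightarrow> of_real (\<beta> * ?D)" by simp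
    then show ?thesis by (simp only: hamiltonian_eq[OF st])
  qed
  then have "(\<lambda>N. op_pow ?C (\<lambda>\<sigma> \<tau>. op_id \<sigma> \<tau> + X N \<sigma> \<tau> / of_nat N) N \<sigma> \<tau>)
    \<longlonglongrightarrow> op_exp ?C (\<lambda>\<sigma> \<tau>. - complex_of_real \<beta> * hamiltonian n d L u h \<sigma> \<tau>) \<sigma> \<tau>"
    using \<sigma> \<tau> by (intro op_exp_tendsto) (auto simp: configs_eq_colorings finite_colorings finite_box)
  moreover have "\<forall>\<^sub>F N in sequentially. op_pow ?C (\<lambda>\<sigma> \<tau>. op_id \<sigma> \<tau> + X N \<sigma> \<tau> / of_nat N) N \<sigma> \<tau>
      = op_pow ?C (\<lambda>\<sigma> \<tau>. of_real (?m (\<beta> / real N) \<sigma> \<tau>)) N \<sigma> \<tau>"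
  proof (rule eventually_mono[OF eventually_gt_at_top[of 0]])
    fix N :: nat assume "0 < N"
    then have "(\<lambda>\<sigma> \<tau>. op_id \<sigma> \<tau> + X N \<sigma> \<tau> / of_nat N) = (\<lambda>\<sigma> \<tau>. of_real (?m (\<beta> / real N) \<sigma> \<tau>))"
      by (auto simp: X_def op_id_def fun_eq_iff)
    then show "op_pow ?C (\<lambda>\<sigma> \<tau>. op_id \<sigma> \<tau> + X N \<sigma> \<tau> / of_nat N) N \<sigma> \<tau>
      = op_pow ?C (\<lambda>\<sigma> \<tau>. of_real (?m (\<beta> / real N) \<sigma> \<tau>)) N \<sigma> \<tau>" by simp
  qed
  ultimately show ?thesis by (rule Lim_transform_eventually)
qed

section \<open>Matrix elements of a product of two S^1\<close>

definition spin1_elem :: "nat \<Rightarrow> nat \<Rightarrow> nat \<Rightarrow> real" where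
  "spin1_elem n k k' = (if k' = k + 1 \<or> k = k' + 1 then
      sqrt ((real n / 2) * (real n / 2 + 1) - spin_val n k * spin_val n k') / 2 else 0)"

lemma spin1_elem_bounds:
  assumes "k \<le> n" "k' \<le> n"
  shows "0 \<le> spin1_elem n k k'" "spin1_elem n k k' \<le> real (n + 1)"
proof -
  have *: "0 \<le> spin1_elem n j (j + 1) \<and> spin1_elem n j (j + 1) \<le> real (n + 1)" if "j + 1 \<le> n" for j
  proof -
    \<comment> \<open>With S = n/2 and a = j - n/2 this is S(S+1) - a(a+1) = (S-a)(S+a+1).\<close>
    have eq: "(real n / 2) * (real n / 2 + 1) - spin_val n j * spin_val n (j + 1) = (real n - real j) * (real j + 1)"
      by (simp add: spin_val_def field_simps)
    have "(real n - real j) * (real j + 1) \<le> (real n + 1) * (real n + 1)"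
      using that by (intro mult_mono) auto
    then have "sqrt ((real n - real j) * (real j + 1)) \<le> real n + 1"
      by (intro real_le_lsqrt) (auto simp: power2_eq_square)
    moreover have "0 \<le> (real n - real j) * (real j + 1)"
      using that by (intro mult_nonneg_nonneg) auto
    ultimately show ?thesis unfolding spin1_elem_def eq using that by auto
  qed
  have sym: "spin1_elem n k k' = spin1_elem n k' k"
    by (auto simp: spin1_elem_def mult.commute)
  consider "k' = k + 1" | "k = k' + 1" | "\<not> (k' = k + 1 \<or> k = k' + 1)" by blast
  then have "0 \<le> spin1_elem n k k' \<and> spin1_elem n k k' \<le> real (n + 1)"
  proof cases
    case 1 then show ?thesis using *[of k] assms by simp
  next
    case 2 then show ?thesis using *[of k'] assms sym by simp
  next
    case 3 then show ?thesis by (simp add: spin1_elem_def)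
  qed
  then show "0 \<le> spin1_elem n k k'" "spin1_elem n k k' \<le> real (n + 1)" by auto
qed

lemma spin1_elem_pos: "1 \<le> n \<Longrightarrow> k \<le> 1 \<Longrightarrow> k' = 1 - k \<Longrightarrow> 0 < spin1_elem n k k'"
  by (cases k) (auto simp: spin1_elem_def spin_val_def field_simps)

definition pair_elem :: "nat \<Rightarrow> site set \<Rightarrow> site \<Rightarrow> site \<Rightarrow> config \<Rightarrow> config \<Rightarrow> config \<Rightarrow> real" where
  "pair_elem n \<Lambda> x y \<sigma> \<rho> \<tau> = (of_bool (\<forall>z\<in>\<Lambda> - {x}. \<sigma> z = \<rho> z) * spin1_elem n (\<sigma> x) (\<rho> x)) *
     (of_bool (\<forall>z\<in>\<Lambda> - {y}. \<rho> z = \<tau> z) * spin1_elem n (\<rho> y) (\<tau> y))"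

definition spin_pair :: "nat \<Rightarrow> site set \<Rightarrow> site \<Rightarrow> site \<Rightarrow> config \<Rightarrow> config \<Rightarrow> real" where
  "spin_pair n \<Lambda> x y \<sigma> \<tau> = (\<Sum>\<rho>\<in>configs n \<Lambda>. pair_elem n \<Lambda> x y \<sigma> \<rho> \<tau>)"

lemma site_spin1_eq:
  "site_op \<Lambda> x (spin1 n) \<sigma> \<tau> = of_real (of_bool (\<forall>z\<in>\<Lambda> - {x}. \<sigma> z = \<tau> z) * spin1_elem n (\<sigma> x) (\<tau> x))"
  by (simp add: site_op_def spin1_def spin1_elem_def)

lemma spin_pair_eq:
  "op_mult (configs n \<Lambda>) (site_op \<Lambda> x (spin1 n)) (site_op \<Lambda> y (spin1 n)) = (\<lambda>\<sigma> \<tau>. of_real (spin_pair n \<Lambda> x y \<sigma> \<tau>))"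
  unfolding op_mult_def spin_pair_def pair_elem_def site_spin1_eq by simp

lemma pair_elem_bounds:
  assumes "\<sigma> \<in> configs n \<Lambda>" "\<rho> \<in> configs n \<Lambda>" "\<tau> \<in> configs n \<Lambda>" "x \<in> \<Lambda>" "y \<in> \<Lambda>"
  shows "0 \<le> pair_elem n \<Lambda> x y \<sigma> \<rho> \<tau>"
    "pair_elem n \<Lambda> x y \<sigma> \<rho> \<tau> \<le> real ((n + 1)\<^sup>2) *
      of_bool ((\<forall>z\<in>\<Lambda> - {x}. \<sigma> z = \<rho> z) \<and> (\<forall>z\<in>\<Lambda> - {y}. \<rho> z = \<tau> z)
        \<and> (\<rho> x = \<sigma> x + 1 \<or> \<sigma> x = \<rho> x + 1) \<and> (\<tau> y = \<rho> y + 1 \<or> \<rho> y = \<tau> y + 1))"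
proof -
  have le: "\<sigma> x \<le> n" "\<rho> x \<le> n" "\<rho> y \<le> n" "\<tau> y \<le> n"
    using assms by (auto simp: configs_def)
  note b = spin1_elem_bounds[OF le(1,2)] spin1_elem_bounds[OF le(3,4)]
  show "0 \<le> pair_elem n \<Lambda> x y \<sigma> \<rho> \<tau>" using b by (simp add: pair_elem_def)
  have "spin1_elem n (\<sigma> x) (\<rho> x) * spin1_elem n (\<rho> y) (\<tau> y) \<le> real (n + 1) * real (n + 1)"
    using b by (intro mult_mono) auto
  then have m: "spin1_elem n (\<sigma> x) (\<rho> x) * spin1_elem n (\<rho> y) (\<tau> y) \<le> real ((n + 1)\<^sup>2)"
    by (simp only: power2_eq_square of_nat_mult)
  show "pair_elem n \<Lambda> x y \<sigma> \<rho> \<tau> \<le> real ((n + 1)\<^sup>2) *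
      of_bool ((\<forall>z\<in>\<Lambda> - {x}. \<sigma> z = \<rho> z) \<and> (\<forall>z\<in>\<Lambda> - {y}. \<rho> z = \<tau> z)
        \<and> (\<rho> x = \<sigma> x + 1 \<or> \<sigma> x = \<rho> x + 1) \<and> (\<tau> y = \<rho> y + 1 \<or> \<rho> y = \<tau> y + 1))"
  proof (cases "pair_elem n \<Lambda> x y \<sigma> \<rho> \<tau> = 0")
    case True
    then show ?thesis by simp
  next
    case False
    then have "(\<forall>z\<in>\<Lambda> - {x}. \<sigma> z = \<rho> z) \<and> (\<forall>z\<in>\<Lambda> - {y}. \<rho> z = \<tau> z)
        \<and> (\<rho> x = \<sigma> x + 1 \<or> \<sigma> x = \<rho> x + 1) \<and> (\<tau> y = \<rho> y + 1 \<or> \<rho> y = \<tau> y + 1)"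
      by (auto simp: pair_elem_def spin1_elem_def split: if_splits)
    then show ?thesis using m by (simp add: pair_elem_def)
  qed
qed

lemma spin_pair_nonneg:
  assumes "\<sigma> \<in> configs n \<Lambda>" "\<tau> \<in> configs n \<Lambda>" "x \<in> \<Lambda>" "y \<in> \<Lambda>"
  shows "0 \<le> spin_pair n \<Lambda> x y \<sigma> \<tau>"
  unfolding spin_pair_def using assms by (intro sum_nonneg pair_elem_bounds)

text \<open>At different sites the intermediate configuration is forced: it has already changed at
  \<open>x\<close> and not yet at \<open>y\<close>.\<close>

lemma spin_pair_le_two:
  assumes fin: "finite \<Lambda>" and \<sigma>: "\<sigma> \<in> configs n \<Lambda>" and \<tau>: "\<tau> \<in> configs n \<Lambda>"
    and xy: "x \<in> \<Lambda>" "y \<in> \<Lambda>" "x \<noteq> y"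
  shows "spin_pair n \<Lambda> x y \<sigma> \<tau> \<le> real ((n + 1)\<^sup>2) * of_bool
      ((\<forall>z\<in>\<Lambda> - {x, y}. \<sigma> z = \<tau> z) \<and> (\<forall>z\<in>{x, y}. \<tau> z = \<sigma> z + 1 \<or> \<sigma> z = \<tau> z + 1))"
    (is "_ \<le> ?K * of_bool ?R")
proof -
  have finC: "finite (configs n \<Lambda>)" using fin by (simp add: configs_eq_colorings finite_colorings)
  have "spin_pair n \<Lambda> x y \<sigma> \<tau> \<le> (\<Sum>\<rho>\<in>configs n \<Lambda>. if \<rho> = \<sigma>(x := \<tau> x) then ?K * of_bool ?R else 0)"
    unfolding spin_pair_def
  proof (rule sum_mono)
    fix \<rho> assume \<rho>: "\<rho> \<in> configs n \<Lambda>"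
    let ?Q = "(\<forall>z\<in>\<Lambda> - {x}. \<sigma> z = \<rho> z) \<and> (\<forall>z\<in>\<Lambda> - {y}. \<rho> z = \<tau> z)
        \<and> (\<rho> x = \<sigma> x + 1 \<or> \<sigma> x = \<rho> x + 1) \<and> (\<tau> y = \<rho> y + 1 \<or> \<rho> y = \<tau> y + 1)"
    define q where "q \<longleftrightarrow> ?Q"
    have le: "pair_elem n \<Lambda> x y \<sigma> \<rho> \<tau> \<le> ?K * of_bool q"
      unfolding q_def by (rule pair_elem_bounds[OF \<sigma> \<rho> \<tau> xy(1,2)])
    show "pair_elem n \<Lambda> x y \<sigma> \<rho> \<tau> \<le> (if \<rho> = \<sigma>(x := \<tau> x) then ?K * of_bool ?R else 0)"
    proof (cases q)
      case True
      then have Q: ?Q unfolding q_def .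
      have "\<rho> z = (\<sigma>(x := \<tau> x)) z" for z
        using Q xy \<rho> \<sigma> by (cases "z \<in> \<Lambda>") (auto simp: configs_def)
      then have eq: "\<rho> = \<sigma>(x := \<tau> x)" by blast
      have R: ?R using Q xy by auto
      have "pair_elem n \<Lambda> x y \<sigma> \<rho> \<tau> \<le> ?K * 1" using le True by simp
      also have "\<dots> = ?K * of_bool ?R" by (simp only: of_bool_def if_P[OF R])
      also have "\<dots> = (if \<rho> = \<sigma>(x := \<tau> x) then ?K * of_bool ?R else 0)" by (rule if_P[OF eq, symmetric])
      finally show ?thesis .
    next
      case False
      have "pair_elem n \<Lambda> x y \<sigma> \<rho> \<tau> \<le> 0" using le False by simp
      also have "0 \<le> (if \<rho> = \<sigma>(x := \<tau> x) then ?K * of_bool ?R else 0)" by simp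
      finally show ?thesis .
    qed
  qed
  also have "\<dots> \<le> ?K * of_bool ?R" using finC by (simp add: sum.delta)
  finally show ?thesis .
qed

text \<open>At equal sites the intermediate colour at \<open>x\<close> is free, which gives up to n
  + 1 terms and the third power.\<close>

lemma spin_pair_le_one:
  assumes fin: "finite \<Lambda>" and \<sigma>: "\<sigma> \<in> configs n \<Lambda>" and \<tau>: "\<tau> \<in> configs n \<Lambda>" and x: "x \<in> \<Lambda>"
  shows "spin_pair n \<Lambda> x x \<sigma> \<tau> \<le> real ((n + 1) ^ 3) * of_bool (\<forall>z\<in>\<Lambda> - {x}. \<sigma> z = \<tau> z)"
    (is "_ \<le> _ * of_bool ?R")
proof -
  let ?S = "{\<rho> \<in> configs n \<Lambda>. \<forall>z\<in>\<Lambda> - {x}. \<sigma> z = \<rho> z}"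
  let ?K = "real ((n + 1)\<^sup>2)"
  have finC: "finite (configs n \<Lambda>)" using fin by (simp add: configs_eq_colorings finite_colorings)
  have "?S \<subseteq> (\<lambda>k. \<sigma>(x := k)) ` {..n}"
  proof
    fix \<rho> assume \<rho>: "\<rho> \<in> ?S"
    have "\<rho> z = (\<sigma>(x := \<rho> x)) z" for z
      using \<rho> \<sigma> by (cases "z \<in> \<Lambda>") (auto simp: configs_def)
    then have "\<rho> = \<sigma>(x := \<rho> x)" by blast
    moreover have "\<rho> x \<le> n" using \<rho> x by (auto simp: configs_def)
    ultimately show "\<rho> \<in> (\<lambda>k. \<sigma>(x := k)) ` {..n}" by blast
  qed
  then have "card ?S \<le> card ((\<lambda>k. \<sigma>(x := k)) ` {..n})" by (intro card_mono) auto
  also have "\<dots> \<le> n + 1" using card_image_le[of "{..n}" "\<lambda>k. \<sigma>(x := k)"] by simp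
  finally have card: "card ?S \<le> n + 1" .
  have "spin_pair n \<Lambda> x x \<sigma> \<tau> \<le> (\<Sum>\<rho>\<in>configs n \<Lambda>. if \<forall>z\<in>\<Lambda> - {x}. \<sigma> z = \<rho> z then ?K * of_bool ?R else 0)"
    unfolding spin_pair_def
  proof (rule sum_mono)
    fix \<rho> assume \<rho>: "\<rho> \<in> configs n \<Lambda>"
    from pair_elem_bounds(2)[OF \<sigma> \<rho> \<tau> x x]
    show "pair_elem n \<Lambda> x x \<sigma> \<rho> \<tau> \<le> (if \<forall>z\<in>\<Lambda> - {x}. \<sigma> z = \<rho> z then ?K * of_bool ?R else 0)"
      by (rule order_trans) auto
  qed
  also have "\<dots> = real (card ?S) * (?K * of_bool ?R)"
    by (simp only: sum.inter_filter[OF finC, symmetric] sum_constant)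
  also have "\<dots> \<le> real (n + 1) * (?K * of_bool ?R)"
    using card by (intro mult_right_mono) auto
  also have "\<dots> = real ((n + 1) ^ 3) * of_bool ?R"
    by (simp only: power2_eq_square power3_eq_cube of_nat_mult mult.assoc)
  finally show ?thesis .
qed

section \<open>Positivity and conclusion\<close>

lemma op_pow_nonneg:
  assumes A: "\<And>\<sigma> \<tau>. \<sigma> \<in> C \<Longrightarrow> \<tau> \<in> C \<Longrightarrow> Im (A \<sigma> \<tau>) = 0 \<and> 0 \<le> Re (A \<sigma> \<tau>)"
    and "\<sigma> \<in> C" "\<tau> \<in> C"
  shows "Im (op_pow C A m \<sigma> \<tau>) = 0 \<and> 0 \<le> Re (op_pow C A m \<sigma> \<tau>)"
  using assms(2,3)
  by (induction m arbitrary: \<sigma>) (auto simp: op_id_def op_mult_def A intro!: sum_nonneg sum.neutral)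

text \<open>The product along a path of positive entries is a positive summand of a power of
  \<open>A\<close>, and no other summand is negative.\<close>

lemma op_pow_pos:
  assumes fin: "finite C"
    and A: "\<And>\<sigma> \<tau>. \<sigma> \<in> C \<Longrightarrow> \<tau> \<in> C \<Longrightarrow> Im (A \<sigma> \<tau>) = 0 \<and> 0 \<le> Re (A \<sigma> \<tau>)"
    and conn: "(\<sigma>, \<tau>) \<in> {(\<sigma>, \<tau>). \<sigma> \<in> C \<and> \<tau> \<in> C \<and> 0 < Re (A \<sigma> \<tau>)}\<^sup>*" and \<tau>: "\<tau> \<in> C"
  shows "\<exists>m. 0 < Re (op_pow C A m \<sigma> \<tau>)"
  using conn
proof (induction rule: converse_rtrancl_induct)
  case base
  then show ?case by (intro exI[of _ 0]) (simp add: op_id_def)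
next
  case (step \<sigma> \<rho>)
  then obtain m where m: "0 < Re (op_pow C A m \<rho> \<tau>)" by blast
  have \<sigma>: "\<sigma> \<in> C" and \<rho>: "\<rho> \<in> C" and pos: "0 < Re (A \<sigma> \<rho>)" using step by auto
  have "0 < (\<Sum>\<rho>\<in>C. Re (A \<sigma> \<rho> * op_pow C A m \<rho> \<tau>))"
    using A[OF \<sigma>] op_pow_nonneg[of C A, OF A _ \<tau>] m pos \<rho>
    by (intro sum_pos2[OF fin \<rho>]) auto
  then show ?case by (intro exI[of _ "Suc m"]) (simp add: op_mult_def)
qed

lemma Re_op_exp:
  assumes fin: "finite C"
    and A: "\<And>\<sigma> \<tau>. \<sigma> \<in> C \<Longrightarrow> \<tau> \<in> C \<Longrightarrow> Im (A \<sigma> \<tau>) = 0 \<and> 0 \<le> Re (A \<sigma> \<tau>)"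
    and \<sigma>: "\<sigma> \<in> C" and \<tau>: "\<tau> \<in> C"
  shows "0 \<le> Re (op_exp C A \<sigma> \<tau>)"
    "(\<sigma>, \<tau>) \<in> {(\<sigma>, \<tau>). \<sigma> \<in> C \<and> \<tau> \<in> C \<and> 0 < Re (A \<sigma> \<tau>)}\<^sup>* \<Longrightarrow> 0 < Re (op_exp C A \<sigma> \<tau>)"
proof -
  let ?f = "\<lambda>m. op_pow C A m \<sigma> \<tau> / of_nat (fact m)"
  have "summable ?f" by (rule summable_norm_cancel[OF summable_op_exp[OF fin \<sigma> \<tau>]])
  then have sums: "(\<lambda>m. Re (?f m)) sums Re (op_exp C A \<sigma> \<tau>)"
    unfolding op_exp_def by (intro sums_Re summable_sums)
  have Re_f: "Re (?f m) = Re (op_pow C A m \<sigma> \<tau>) / fact m" for m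
    using Re_divide_of_real[of "op_pow C A m \<sigma> \<tau>" "fact m"] by simp
  have nonneg: "0 \<le> Re (?f m)" for m
    using op_pow_nonneg[of C A, OF A \<sigma> \<tau>, of m] unfolding Re_f by simp
  show "0 \<le> Re (op_exp C A \<sigma> \<tau>)" using sums nonneg by (rule sums_le[OF _ sums_zero, rotated])
  assume "(\<sigma>, \<tau>) \<in> {(\<sigma>, \<tau>). \<sigma> \<in> C \<and> \<tau> \<in> C \<and> 0 < Re (A \<sigma> \<tau>)}\<^sup>*"
  from op_pow_pos[OF fin A this \<tau>] obtain m where "0 < Re (op_pow C A m \<sigma> \<tau>)" by blast
  then have "0 < Re (?f m)" unfolding Re_f by simp
  then have "0 < suminf (\<lambda>m. Re (?f m))"
    using sums nonneg by (intro suminf_pos2[of _ m]) (auto simp: sums_iff)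
  then show "0 < Re (op_exp C A \<sigma> \<tau>)" using sums by (simp add: sums_iff)
qed

lemma link_sum_nonneg: "0 \<le> u \<Longrightarrow> u \<le> 1 \<Longrightarrow> 0 \<le> link_sum \<Lambda> E u \<sigma> \<tau>"
  unfolding link_sum_def by (intro sum_nonneg) auto

lemma link_sum_pos:
  assumes "finite E" "0 \<le> u" "u \<le> 1" "(x, y) \<in> E"
    and "0 < u \<and> swap_compat \<Lambda> x y \<sigma> \<tau> \<or> u < 1 \<and> pair_compat \<Lambda> x y \<sigma> \<tau>"
  shows "0 < link_sum \<Lambda> E u \<sigma> \<tau>"
  unfolding link_sum_def using assms by (intro sum_pos2[of E "(x, y)"]) (auto simp: of_bool_def)

text \<open>Reference configurations for the positivity: for \<open>u > 0\<close> a single excited site is moved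
  by transpositions; for \<open>u = 0\<close> flipping one sublattice of the bipartite lattice turns the
  action of \<open>Q\<close> on these configurations into such a move.\<close>

definition excited :: "site set \<Rightarrow> (site \<Rightarrow> nat) \<Rightarrow> site \<Rightarrow> config" where
  "excited \<Lambda> c z = (\<lambda>y. if y \<in> \<Lambda> then if y = z then 1 - c y else c y else 0)"

definition background :: "nat \<Rightarrow> real \<Rightarrow> site \<Rightarrow> nat" where
  "background d u y = (if 0 < u then 0 else nat ((\<Sum>i<d. y i) mod 2))"

lemma background_le: "background d u y \<le> 1"
proof -
  have "(\<Sum>i<d. y i) mod 2 < 2" by simp
  then show ?thesis by (auto simp: background_def)
qed

text \<open>Neighbours have coordinate sums of opposite parity.\<close>

lemma background_edge:
  assumes "(y, z) \<in> edges d L" "u = 0"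
  shows "background d u z = 1 - background d u y"
proof -
  obtain i where i: "i < d" "z = y(i := y i + 1)" using assms by (auto simp: edges_def)
  have "(\<Sum>j<d. z j) = (\<Sum>j<d. y j + (if j = i then 1 else 0))"
    by (intro sum.cong refl) (simp add: i)
  also have "\<dots> = (\<Sum>j<d. y j) + 1" using i(1) by (simp add: sum.distrib)
  finally have "(\<Sum>j<d. z j) = (\<Sum>j<d. y j) + 1" .
  then have "(\<Sum>j<d. z j) mod 2 = 1 - (\<Sum>j<d. y j) mod 2" by presburger
  then show ?thesis using assms(2) by (simp add: background_def nat_diff_distrib)
qed

lemma excited_configs: "1 \<le> n \<Longrightarrow> excited \<Lambda> (background d u) z \<in> configs n \<Lambda>"
  using background_le order_trans[of _ 1 n] by (auto simp: excited_def configs_def intro: order_trans)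

text \<open>For \<open>u = 0\<close> the staggered background differs at the neighbours
  \<open>y\<close> and \<open>z\<close>, so flipping either of them makes both colours equal, as
  \<open>Q\<close> requires on both sides.\<close>

lemma excited_link:
  assumes "(y, z) \<in> edges d L" "0 \<le> u" "u \<le> 1"
  shows "0 < link_sum (box d L) (edges d L) u (excited (box d L) (background d u) y) (excited (box d L) (background d u) z)"
    "0 < link_sum (box d L) (edges d L) u (excited (box d L) (background d u) z) (excited (box d L) (background d u) y)"
proof -
  let ?e = "excited (box d L) (background d u)"
  have fin: "finite (edges d L)" using finite_subset[OF edges_box] finite_box by blast
  have yz: "y \<in> box d L" "z \<in> box d L" "y \<noteq> z" using assms(1) edges_box edges_neq by blast+
  have "0 < u \<and> swap_compat (box d L) y z (?e y) (?e z) \<or> u < 1 \<and> pair_compat (box d L) y z (?e y) (?e z)"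
  proof (cases "0 < u")
    case True
    then show ?thesis using yz by (auto simp: swap_compat_def excited_def background_def)
  next
    case False
    then have "u = 0" using assms by simp
    then show ?thesis
      using yz background_edge[OF assms(1)] background_le[of d u y]
      by (auto simp: pair_compat_def excited_def)
  qed
  then show "0 < link_sum (box d L) (edges d L) u (?e y) (?e z)"
    by (rule link_sum_pos[OF fin assms(2,3,1)])
  have "0 < u \<and> swap_compat (box d L) y z (?e z) (?e y) \<or> u < 1 \<and> pair_compat (box d L) y z (?e z) (?e y)"
  proof (cases "0 < u")
    case True
    then show ?thesis using yz by (auto simp: swap_compat_def excited_def background_def)
  next
    case False
    then have "u = 0" using assms by simp
    then show ?thesis
      using yz background_edge[OF assms(1)] background_le[of d u y]
      by (auto simp: pair_compat_def excited_def)
  qed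
  then show "0 < link_sum (box d L) (edges d L) u (?e z) (?e y)"
    by (rule link_sum_pos[OF fin assms(2,3,1)])
qed

lemma spin_pair_excited_pos:
  assumes fin: "finite \<Lambda>" and x: "x \<in> \<Lambda>" "y \<in> \<Lambda>" and n: "1 \<le> n"
  shows "0 < spin_pair n \<Lambda> x y (excited \<Lambda> (background d u) y) (excited \<Lambda> (background d u) x)"
proof -
  let ?c = "background d u"
  let ?e = "excited \<Lambda> ?c"
  have finC: "finite (configs n \<Lambda>)" using fin by (simp add: configs_eq_colorings finite_colorings)
  \<comment> \<open>The operator at \<open>x\<close> flips the colour there, which leaves two
    excited sites; the one at \<open>y\<close> then flips \<open>y\<close> back. For
    \<open>x = y\<close> the intermediate configuration is the background.\<close>
  define \<rho> where "\<rho> = (\<lambda>z. if z \<in> \<Lambda> then if x \<noteq> y \<and> (z = x \<or> z = y) then 1 - ?c z else ?c z else 0)"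
  have \<rho>: "\<rho> \<in> configs n \<Lambda>"
    using background_le[of d u] n by (auto simp: configs_def \<rho>_def intro: order_trans)
  have "0 < spin1_elem n (?e y x) (\<rho> x)" "0 < spin1_elem n (\<rho> y) (?e x y)"
    using background_le[of d u x] background_le[of d u y] x n
    by (auto intro!: spin1_elem_pos simp: excited_def \<rho>_def)
  moreover have "\<forall>z\<in>\<Lambda> - {x}. ?e y z = \<rho> z" "\<forall>z\<in>\<Lambda> - {y}. \<rho> z = ?e x z"
    by (auto simp: excited_def \<rho>_def)
  ultimately have "0 < pair_elem n \<Lambda> x y (?e y) \<rho> (?e x)" by (simp add: pair_elem_def)
  then show ?thesis
    unfolding spin_pair_def using excited_configs[OF n] x
    by (intro sum_pos2[OF finC \<rho>] pair_elem_bounds) auto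
qed

text \<open>Adding a multiple of the identity makes all entries of -\<beta>H nonnegative. For the
  last claim the excitation is moved from the origin to \<open>x\<close> along edges, each move
  being a positive entry.\<close>

lemma gibbs_weight_pos:
  fixes h :: "site \<Rightarrow> real"
  assumes u: "0 \<le> u" "u \<le> 1" and \<beta>: "0 < \<beta>" and n: "1 \<le> n"
    and \<sigma>: "\<sigma> \<in> configs n (box d L)" and \<tau>: "\<tau> \<in> configs n (box d L)"
  shows "0 \<le> Re (op_exp (configs n (box d L)) (\<lambda>\<sigma> \<tau>. - complex_of_real \<beta> * hamiltonian n d L u h \<sigma> \<tau>) \<sigma> \<tau>)"
    "\<sigma> = \<tau> \<Longrightarrow> 0 < Re (op_exp (configs n (box d L)) (\<lambda>\<sigma> \<tau>. - complex_of_real \<beta> * hamiltonian n d L u h \<sigma> \<tau>) \<sigma> \<tau>)"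
    "x \<in> box d L \<Longrightarrow> \<sigma> = excited (box d L) (background d u) origin \<Longrightarrow> \<tau> = excited (box d L) (background d u) x \<Longrightarrow>
      0 < Re (op_exp (configs n (box d L)) (\<lambda>\<sigma> \<tau>. - complex_of_real \<beta> * hamiltonian n d L u h \<sigma> \<tau>) \<sigma> \<tau>)"
proof -
  let ?\<Lambda> = "box d L" and ?C = "configs n (box d L)" and ?E = "edges d L"
  let ?H = "\<lambda>\<sigma> \<tau>. - complex_of_real \<beta> * hamiltonian n d L u h \<sigma> \<tau>"
  \<comment> \<open>\<open>F\<close> dominates the absolute value of the field energy;
    \<open>card ?E\<close> in \<open>c\<close> compensates the -1 of the edges.\<close>
  define F where "F = (\<Sum>z\<in>?\<Lambda>. \<bar>h z\<bar> * real n)"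
  define c where "c = complex_of_real (\<beta> * (F + real (card ?E)))"
  define A where "A = (\<lambda>\<sigma> \<tau>. c * op_id \<sigma> \<tau> + ?H \<sigma> \<tau>)"
  have fin: "finite ?C" by (simp add: configs_eq_colorings finite_colorings finite_box)
  have A: "A \<sigma> \<tau> = of_real (\<beta> * (link_sum ?\<Lambda> ?E u \<sigma> \<tau> + of_bool (\<sigma> = \<tau>) * (field_energy n ?\<Lambda> h \<sigma> + F)))"
    if "\<sigma> \<in> ?C" "\<tau> \<in> ?C" for \<sigma> \<tau>
    unfolding A_def hamiltonian_eq[OF that] c_def op_id_eq by (simp add: algebra_simps)
  have fe: "0 \<le> field_energy n ?\<Lambda> h \<sigma> + F" if "\<sigma> \<in> ?C" for \<sigma>
  proof -
    have "0 \<le> (\<Sum>z\<in>?\<Lambda>. h z * spin_val n (\<sigma> z) + \<bar>h z\<bar> * real n)"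
    proof (rule sum_nonneg)
      fix z assume z: "z \<in> ?\<Lambda>"
      have "\<bar>spin_val n (\<sigma> z)\<bar> \<le> real n"
        using that z by (auto simp: spin_val_def configs_def abs_le_iff)
      then have "\<bar>h z * spin_val n (\<sigma> z)\<bar> \<le> \<bar>h z\<bar> * real n"
        by (simp add: abs_mult mult_left_mono)
      then show "0 \<le> h z * spin_val n (\<sigma> z) + \<bar>h z\<bar> * real n" by linarith
    qed
    then show ?thesis by (simp add: field_energy_def F_def sum.distrib)
  qed
  have An: "Im (A \<sigma> \<tau>) = 0 \<and> 0 \<le> Re (A \<sigma> \<tau>)" if "\<sigma> \<in> ?C" "\<tau> \<in> ?C" for \<sigma> \<tau>
    unfolding A[OF that] using \<beta> fe[OF that(1)] link_sum_nonneg[OF u, of ?\<Lambda> ?E \<sigma> \<tau>]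
    by (auto intro!: mult_nonneg_nonneg add_nonneg_nonneg)
  have "op_exp ?C A \<sigma> \<tau> = exp c * op_exp ?C ?H \<sigma> \<tau>"
    unfolding A_def by (rule op_exp_shift[OF fin \<sigma> \<tau>])
  then have shift: "Re (op_exp ?C A \<sigma> \<tau>) = exp (\<beta> * (F + real (card ?E))) * Re (op_exp ?C ?H \<sigma> \<tau>)"
    unfolding c_def exp_of_real by simp
  have R1: "0 \<le> Re (op_exp ?C A \<sigma> \<tau>)"
    by (rule Re_op_exp(1)[OF fin _ \<sigma> \<tau>]) (rule An)
  have R2: "0 < Re (op_exp ?C A \<sigma> \<tau>)"
    if "(\<sigma>, \<tau>) \<in> {(\<sigma>, \<tau>). \<sigma> \<in> ?C \<and> \<tau> \<in> ?C \<and> 0 < Re (A \<sigma> \<tau>)}\<^sup>*"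
    by (rule Re_op_exp(2)[OF fin _ \<sigma> \<tau> that]) (rule An)
  show "0 \<le> Re (op_exp ?C ?H \<sigma> \<tau>)"
    using R1 unfolding shift by (simp add: zero_le_mult_iff)
  have pos: "0 < Re (op_exp ?C ?H \<sigma> \<tau>)"
    if "(\<sigma>, \<tau>) \<in> {(\<sigma>, \<tau>). \<sigma> \<in> ?C \<and> \<tau> \<in> ?C \<and> 0 < Re (A \<sigma> \<tau>)}\<^sup>*"
    using R2[OF that] unfolding shift by (simp add: zero_less_mult_iff)
  then show "0 < Re (op_exp ?C ?H \<sigma> \<tau>)" if "\<sigma> = \<tau>" using that by simp
  assume x: "x \<in> ?\<Lambda>" and ends: "\<sigma> = excited ?\<Lambda> (background d u) origin" "\<tau> = excited ?\<Lambda> (background d u) x"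
  let ?e = "excited ?\<Lambda> (background d u)"
  have edge: "(?e y, ?e z) \<in> {(\<sigma>, \<tau>). \<sigma> \<in> ?C \<and> \<tau> \<in> ?C \<and> 0 < Re (A \<sigma> \<tau>)}"
    if yz: "(y, z) \<in> ?E \<union> ?E\<inverse>" for y z
  proof -
    have C: "?e y \<in> ?C" "?e z \<in> ?C" using excited_configs[OF n] by auto
    have "0 < link_sum ?\<Lambda> ?E u (?e y) (?e z)" using yz excited_link[OF _ u] by auto
    moreover have "0 \<le> of_bool (?e y = ?e z) * (field_energy n ?\<Lambda> h (?e y) + F)"
      using fe[OF C(1)] by simp
    ultimately show ?thesis using C \<beta> by (simp add: A[OF C])
  qed
  from box_connected[OF x]
  have "(?e origin, ?e x) \<in> {(\<sigma>, \<tau>). \<sigma> \<in> ?C \<and> \<tau> \<in> ?C \<and> 0 < Re (A \<sigma> \<tau>)}\<^sup>*"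
  proof (induction rule: rtrancl_induct)
    case (step y z)
    then show ?case using edge[of y z] by (meson rtrancl.rtrancl_into_rtrancl)
  qed simp
  then show "0 < Re (op_exp ?C ?H \<sigma> \<tau>)" unfolding ends[symmetric] by (rule pos)
qed

text \<open>The upper bound holds for all fine discretisations and passes to the limit. Strict
  positivity need not survive a limit, so it is proved for the exact Gibbs operator.\<close>

lemma two_point_bounds:
  fixes h :: "site \<Rightarrow> real"
  assumes u: "0 \<le> u" "u \<le> 1" and \<beta>: "0 < \<beta>" and n: "1 \<le> n" and x: "x \<in> box d L"
    and bound: "\<forall>\<^sub>F N in sequentially. loop_model.expansion (box d L) (edges d L) n N (\<beta> / real N) u h (spin_pair n (box d L) origin x)
        \<le> B * loop_model.partition_fun (box d L) (edges d L) n N (\<beta> / real N) u h"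
    and model: "\<forall>\<^sub>F N in sequentially. loop_model (box d L) (edges d L) N (\<beta> / real N) u \<alpha> h"
  shows "Im (two_point n d L u h \<beta> x) = 0" "0 < Re (two_point n d L u h \<beta> x)" "Re (two_point n d L u h \<beta> x) \<le> B"
proof -
  let ?\<Lambda> = "box d L" and ?C = "configs n (box d L)" and ?E = "edges d L"
  let ?X = "spin_pair n ?\<Lambda> origin x"
  let ?G = "op_exp ?C (\<lambda>\<sigma> \<tau>. - complex_of_real \<beta> * hamiltonian n d L u h \<sigma> \<tau>)"
  let ?P = "\<lambda>N. op_pow ?C (\<lambda>\<sigma> \<tau>. of_real (step_elem n ?\<Lambda> ?E u h (\<beta> / real N) \<sigma> \<tau>)) N"
  let ?exp = "\<lambda>N. loop_model.expansion ?\<Lambda> ?E n N (\<beta> / real N) u h ?X"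
  let ?Z = "\<lambda>N. loop_model.partition_fun ?\<Lambda> ?E n N (\<beta> / real N) u h"
  define a where "a = op_trace ?C (op_mult ?C (\<lambda>\<sigma> \<tau>. of_real (?X \<sigma> \<tau>)) ?G)"
  define z where "z = op_trace ?C ?G"
  have fin: "finite ?C" by (simp add: configs_eq_colorings finite_colorings finite_box)
  have tp: "two_point n d L u h \<beta> x = a / z"
    unfolding two_point_def gibbs_state_def Let_def spin_pair_eq a_def z_def ..
  have lim: "(\<lambda>N. op_trace ?C (op_mult ?C Y (?P N))) \<longlonglongrightarrow> op_trace ?C (op_mult ?C Y ?G)" for Y
    unfolding op_trace_def op_mult_def by (intro tendsto_intros step_pow_tendsto \<beta>)
  have z_eq: "op_trace ?C (op_mult ?C (\<lambda>\<sigma> \<tau>. of_real (of_bool (\<sigma> = \<tau>))) ?G) = z"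
    unfolding op_trace_def z_def op_id_eq[symmetric] by (simp add: op_mult_id_left fin)
  have "\<forall>\<^sub>F N in sequentially. op_trace ?C (op_mult ?C (\<lambda>\<sigma> \<tau>. of_real (?X \<sigma> \<tau>)) (?P N)) = of_real (?exp N)"
    using model by eventually_elim (rule loop_model.trace_expansion)
  from Lim_transform_eventually[OF lim this]
  have la: "(\<lambda>N. complex_of_real (?exp N)) \<longlonglongrightarrow> a" by (simp add: a_def)
  have "\<forall>\<^sub>F N in sequentially. op_trace ?C (op_mult ?C (\<lambda>\<sigma> \<tau>. of_real (of_bool (\<sigma> = \<tau>))) (?P N)) = of_real (?Z N)"
    using model
  proof eventually_elim
    fix N assume "loop_model ?\<Lambda> ?E N (\<beta> / real N) u \<alpha> h"
    then interpret loop_model ?\<Lambda> ?E n N "\<beta> / real N" u \<alpha> h .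
    show "op_trace ?C (op_mult ?C (\<lambda>\<sigma> \<tau>. of_real (of_bool (\<sigma> = \<tau>))) (?P N)) = of_real (?Z N)"
      using trace_expansion[of "\<lambda>\<sigma> \<tau>. of_bool (\<sigma> = \<tau>)"] unfolding expansion_id .
  qed
  from Lim_transform_eventually[OF lim this]
  have lz: "(\<lambda>N. complex_of_real (?Z N)) \<longlonglongrightarrow> z" by (simp only: z_eq)
  have Im: "Im a = 0" "Im z = 0"
    using tendsto_Im[OF la] tendsto_Im[OF lz] by (simp_all add: LIMSEQ_const_iff)
  have le: "Re a \<le> B * Re z"
    using tendsto_Re[OF la] tendsto_mult[OF tendsto_const tendsto_Re[OF lz], of B] bound
    by (intro tendsto_le[of sequentially]) auto
  have z_pos: "0 < Re z"
  proof -
    have "(\<lambda>_. 0) \<in> ?C" by (simp add: configs_def)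
    then show ?thesis
      unfolding z_def op_trace_def Re_sum using gibbs_weight_pos(1,2)[OF u \<beta> n]
      by (intro sum_pos2[OF fin]) auto
  qed
  have a_pos: "0 < Re a"
  proof -
    let ?e = "excited ?\<Lambda> (background d u)"
    have eC: "?e y \<in> ?C" for y by (rule excited_configs[OF n])
    have nn: "0 \<le> ?X \<sigma> \<tau> * Re (?G \<tau> \<sigma>)" if "\<sigma> \<in> ?C" "\<tau> \<in> ?C" for \<sigma> \<tau>
      using that gibbs_weight_pos(1)[OF u \<beta> n] spin_pair_nonneg[OF that origin_in_box x]
      by (intro mult_nonneg_nonneg) auto
    have "0 < ?X (?e x) (?e origin) * Re (?G (?e origin) (?e x))"
      by (intro mult_pos_pos spin_pair_excited_pos gibbs_weight_pos(3)[OF u \<beta> n eC eC x refl refl]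
          finite_box origin_in_box x n)
    then have pos: "0 < (\<Sum>\<tau>\<in>?C. ?X (?e x) \<tau> * Re (?G \<tau> (?e x)))"
      using nn eC by (intro sum_pos2[OF fin eC[of origin]]) auto
    have "0 < (\<Sum>\<sigma>\<in>?C. \<Sum>\<tau>\<in>?C. ?X \<sigma> \<tau> * Re (?G \<tau> \<sigma>))"
      by (rule sum_pos2[OF fin eC[of x]]) (rule pos, (intro sum_nonneg nn; assumption))
    then show ?thesis by (simp add: a_def op_trace_def op_mult_def)
  qed
  have "a / z = of_real (Re a / Re z)"
    using Im by (simp add: complex_eq_iff Re_divide Im_divide power2_eq_square)
  then have tp': "two_point n d L u h \<beta> x = of_real (Re a / Re z)" by (simp add: tp)
  show "Im (two_point n d L u h \<beta> x) = 0" by (simp only: tp' Im_complex_of_real)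
  show "0 < Re (two_point n d L u h \<beta> x)" using a_pos z_pos by (simp only: tp' Re_complex_of_real divide_pos_pos)
  show "Re (two_point n d L u h \<beta> x) \<le> B"
    using le z_pos by (simp only: tp' Re_complex_of_real pos_divide_le_eq)
qed

theorem theorem1p1:
  fixes d n :: nat and \<alpha> :: real
  assumes "d \<ge> 1" and "n \<ge> 1" and "\<alpha> > 0"
  shows "\<exists>C>0. \<exists>c>0. \<forall>u \<beta> (L::nat) (h::site \<Rightarrow> real).
           0 \<le> u \<and> u \<le> 1 \<and> \<beta> > 0 \<and> even L \<and> (\<forall>x\<in>box d L. \<alpha> \<le> h x) \<longrightarrow>
           (\<forall>x\<in>box d L. Im (two_point n d L u h \<beta> x) = 0
              \<and> 0 < Re (two_point n d L u h \<beta> x)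
              \<and> Re (two_point n d L u h \<beta> x) < C * exp (- c * site_norm d x))"
proof -
  define \<mu> where "\<mu> = 64 * real ((n + 1) ^ 4) * real (2 * d) * exp 3"
  \<comment> \<open>The rates for long and for short arcs.\<close>
  define c where "c = min (\<alpha> / (4 * \<mu>)) 1"
  define K where "K = real ((n + 1)\<^sup>2)"
  \<comment> \<open>\<open>6 * K\<close> is the prefactor \<open>2 * K * (1 + 2)\<close> away from
    the origin, the second term covers the origin, and the 1 makes the inequality strict.\<close>
  define C where "C = 6 * K + real ((n + 1) ^ 3) * K + 1"
  have \<mu>: "0 < \<mu>" unfolding \<mu>_def using assms(1) by (intro mult_pos_pos) auto
  have c: "0 < c" using \<mu> assms(3) by (simp add: c_def)
  have K: "0 \<le> K" by (simp add: K_def)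
  have K3: "0 \<le> real ((n + 1) ^ 3) * K" using K by (intro mult_nonneg_nonneg) auto
  have C: "0 < C" "6 * K < C" using K K3 unfolding C_def by linarith+
  have main: "Im (two_point n d L u h \<beta> x) = 0 \<and> 0 < Re (two_point n d L u h \<beta> x)
      \<and> Re (two_point n d L u h \<beta> x) < C * exp (- c * site_norm d x)"
    if u: "0 \<le> u" "u \<le> 1" and \<beta>: "0 < \<beta>" and h: "\<forall>x\<in>box d L. \<alpha> \<le> h x" and x: "x \<in> box d L"
    for u \<beta> L and h :: "site \<Rightarrow> real" and x
  proof -
    let ?\<Lambda> = "box d L" and ?E = "edges d L"
    let ?r = "site_norm d x"
    define B where "B = (if x = origin then real ((n + 1) ^ 3) * K
      else 2 * K * (exp (- (\<alpha> / (4 * \<mu>)) * ?r) + 2 * exp (- ?r)))"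
    \<comment> \<open>How small the time step must be depends on \<beta> and on the box; the
      constants do not, and only the limit enters the result.\<close>
    have l1: "(\<lambda>N. \<beta> / real N * real (card ?E)) \<longlonglongrightarrow> 0 * real (card ?E)"
      and l2: "(\<lambda>N. \<mu> * (\<beta> / real N)) \<longlonglongrightarrow> \<mu> * 0"
      by (intro tendsto_intros lim_const_over_n)+
    have small: "\<forall>\<^sub>F N in sequentially. \<beta> / real N * real (card ?E) < 1 / 2"
      "\<forall>\<^sub>F N in sequentially. \<mu> * (\<beta> / real N) < 1"
      using order_tendstoD(2)[OF l1, of "1 / 2"] order_tendstoD(2)[OF l2, of 1] by auto
    have model: "\<forall>\<^sub>F N in sequentially. loop_model ?\<Lambda> ?E N (\<beta> / real N) u \<alpha> h"
      using small(1) eventually_gt_at_top[of 0]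
      by eventually_elim (unfold_locales, use u \<beta> h assms(3) finite_box edges_box edges_neq in auto)
    have "\<forall>\<^sub>F N in sequentially. loop_model.expansion ?\<Lambda> ?E n N (\<beta> / real N) u h (spin_pair n ?\<Lambda> origin x)
        \<le> B * loop_model.partition_fun ?\<Lambda> ?E n N (\<beta> / real N) u h"
      using model small(2)
    proof eventually_elim
      fix N assume m: "loop_model ?\<Lambda> ?E N (\<beta> / real N) u \<alpha> h" and sm: "\<mu> * (\<beta> / real N) < 1"
      interpret loop_model ?\<Lambda> ?E n N "\<beta> / real N" u \<alpha> h by (rule m)
      show "expansion (spin_pair n ?\<Lambda> origin x) \<le> B * partition_fun"
      proof (cases "x = origin")
        case True
        have "expansion (spin_pair n ?\<Lambda> x x) \<le> real ((n + 1) ^ 3) * real ((n + 1)\<^sup>2) * partition_fun"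
        proof (rule expansion_one_le[OF x])
          show "spin_pair n ?\<Lambda> x x \<sigma> \<tau> \<le> real ((n + 1) ^ 3) * of_bool (\<forall>z\<in>?\<Lambda> - {x}. \<sigma> z = \<tau> z)"
            if "\<sigma> \<in> configs n ?\<Lambda>" "\<tau> \<in> configs n ?\<Lambda>" for \<sigma> \<tau>
            by (rule spin_pair_le_one[OF finite_box that x])
        qed simp
        then show ?thesis using True by (simp add: B_def K_def)
      next
        case False
        have "expansion (spin_pair n ?\<Lambda> origin x)
            \<le> 2 * K * (exp (- (\<alpha> / (4 * \<mu>)) * ?r) + 2 * exp (- ?r)) * partition_fun"
        proof (rule expansion_two_le[where D = "2 * d"])
          show "spin_pair n ?\<Lambda> origin x \<sigma> \<tau> \<le> K * of_bool ((\<forall>z\<in>?\<Lambda> - {origin, x}. \<sigma> z = \<tau> z) \<and>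
              (\<forall>z\<in>{origin, x}. \<tau> z = \<sigma> z + 1 \<or> \<sigma> z = \<tau> z + 1))"
            if "\<sigma> \<in> configs n ?\<Lambda>" "\<tau> \<in> configs n ?\<Lambda>" for \<sigma> \<tau>
            unfolding K_def using that x False by (intro spin_pair_le_two finite_box origin_in_box) auto
          show "card (nbrs z) \<le> 2 * d" for z unfolding nbrs_def by (rule card_neighbours)
          show "?r \<le> real m" if "w \<in> walks m origin" "end_site origin w = x" for m w
          proof -
            have "l1_norm d x \<le> l1_norm d origin + real m"
              using walk_lipschitz[OF l1_norm_edge that(1)] that(2) by simp
            then show ?thesis using site_norm_le_l1_norm[of d x] by (simp add: l1_norm_def origin_def)
          qed
        qed (use x False K \<mu> sm in \<open>auto simp: origin_in_box site_norm_nonneg \<mu>_def\<close>)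
        then show ?thesis using False by (simp add: B_def)
      qed
    qed
    note tp = two_point_bounds[OF u \<beta> assms(2) x this model]
    have "B < C * exp (- c * ?r)"
    proof (cases "x = origin")
      case True
      then have "?r = 0" by (simp add: site_norm_def origin_def)
      then show ?thesis using True K by (simp add: B_def C_def)
    next
      case False
      have "c * ?r \<le> \<alpha> / (4 * \<mu>) * ?r" "c * ?r \<le> 1 * ?r"
        by (intro mult_right_mono; simp add: c_def site_norm_nonneg)+
      then have "exp (- (\<alpha> / (4 * \<mu>)) * ?r) \<le> exp (- c * ?r)" "exp (- ?r) \<le> exp (- c * ?r)"
        by simp_all
      then have "B \<le> 2 * K * (exp (- c * ?r) + 2 * exp (- c * ?r))"
        unfolding B_def if_not_P[OF False] using K by (intro mult_left_mono add_mono) auto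
      also have "\<dots> = 6 * K * exp (- c * ?r)" by simp
      also have "\<dots> < C * exp (- c * ?r)" using C(2) by (intro mult_strict_right_mono) auto
      finally show ?thesis .
    qed
    then show ?thesis using tp by simp
  qed
  show ?thesis
    using C(1) c main by (intro exI[of _ C] exI[of _ c] conjI allI impI ballI) auto
qed

end
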